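(* Let $f$ be a map of the form described in the context, with parameters $\tau_R\in\mathbb{R}$, $\tau_L>0$, $\delta_L,\delta_R>0$, $\mu=1$. Suppose that the Algorithm described in the context, applied to $f$, outputs CHAOS, and let $p_{\min},p_{\max}$, $\Omega$, $\Xi_\infty$, $J$ and $C_J$ be the associated objects defined in the context. Then $$\liminf_{n\to\infty}\frac1n\ln\left(\left\|\mathrm{D}f^n(Z)\,v\right\|\right)>0$$ for all $Z\in\Omega\setminus\Xi_\infty$ and all nonzero $v\in C_J$.
   Context: **The map.** Let $A_L=\begin{bmatrix}\tau_L&1\\-\delta_L&0\end{bmatrix}$, $A_R=\begin{bmatrix}\tau_R&1\\-\delta_R&0\end{bmatrix}$, $f_L(Z)=A_LZ+(1,0)^T$, $f_R(Z)=A_RZ+(1,0)^T$ for $Z\in\mathbb{R}^2$, and let $f(x,y)=f_L(x,y)$ if $x\le 0$, $f(x,y)=f_R(x,y)$ if $x\ge0$ (the two agree on $x=0$). Under the parameter assumptions $f$ is a homeomorphism of $\mathbb{R}^2$. Let $\Sigma=\{x=0\}$, $\Pi_L=\{x\le0\}$, $\Pi_R=\{x\ge0\}$. $\|\cdot\|$ is the Euclidean norm, $\pi_1(x,y)=x$, $\pi_2(x,y)=y$. **Induced map.** Let $\Phi=\{(x,y): x<0,\ y\le0\}$, $\Phi_{\rm pre}=\bigcup_{n\ge1}f^{-n}(\Phi)$, $\Phi_0=\Phi_{\rm pre}\cap\Phi$. For $Z\in\Phi_0$, $F(Z)=f^n(Z)$ for the smallest $n\ge1$ with $f^n(Z)\in\Phi$.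 For $Z\in\mathbb{R}^2$, $\chi_L(Z)$ is the smallest $i\ge1$ with $f^i(Z)\notin\Pi_L$ and $\chi_R(Z)$ is the smallest $j\ge1$ with $f^j(Z)\notin\Pi_R$ (if they exist). **Preimages of $\Sigma$.** For $i\ge1$, if the line $f_L^{-i}(\Sigma)$ is not vertical write it as $y=m_ix+c_i$. Let $p^*$ be the smallest $i\ge1$ with $m_i\ge0$ ($p^*=\infty$ if $m_i<0$ for all $i\ge1$). For finite $1\le i\le p^*$ these lines are not vertical; $c_1=-1$, $p^*\ge2$, and the $c_i$ are decreasing for $i\le p^*$. **Points and conditions.** For integers $1\le p_{\min}<p_{\max}\le p^*$ with $p_{\max}<\infty$ let $S=(0,c_{p_{\max}})$, $T=(0,c_{p_{\min}})$; one has $\chi_L(S)=p_{\max}+1$, $\chi_L(T)=p_{\min}+1$. When $f(S),f(T)\in\Phi_{\rm pre}$, set $q_S=\chi_R(f_L^{\chi_L(S)}(S))$, $q_T=\chi_R(f_L^{\chi_L(T)}(T))$, $F(S)=f_R^{q_S}(f_L^{\chi_L(S)}(S))$, $F(T)=f_R^{q_T}(f_L^{\chi_L(T)}(T))$, $q_{\min}=\min[q_S,q_T]$, $q_{\max}=\max[q_S,q_T]+1$. Let $U$ be the intersection with $\Sigma$ of the line through $F(S)$ and $f^{-1}(F(S))$, and $V$ the intersection with $\Sigma$ of the line through $F(T)$ and $f^{-1}(F(T))$. Consider the conditions - (U) $\pi_2(U)>\pi_2(S)$; - (V) $\pi_2(V)<\pi_2(T)$; - (FS) $\pi_1(f(S))\pi_2(F(S))+\pi_2(S)\pi_1(F(S))<\pi_1(f(S))\pi_2(S)$;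 - (FT) $\pi_1(f(T))\pi_2(F(T))+\pi_2(T)\pi_1(F(T))>\pi_1(f(T))\pi_2(T)$. Here (U) and (FS) involve only $S$, and (V) and (FT) involve only $T$. Saying (U), (FS) are satisfied with a given $S$ includes $f(S)\in\Phi_{\rm pre}$, and saying (V), (FT) are satisfied with a given $T$ includes $f(T)\in\Phi_{\rm pre}$. Let $$\Omega=\left\{(x,y)\in\Phi:\ \tfrac{c_{p_{\max}}+1}{c_{p_{\max}}}(c_{p_{\max}}-y)\le x\le\tfrac{c_{p_{\min}}+1}{c_{p_{\min}}}(c_{p_{\min}}-y)\right\}$$ and $\Gamma=\{(p,q)\in\mathbb{Z}^2: p_{\min}\le p\le p_{\max},\ q_{\min}\le q\le q_{\max}\}$. **Angle maps.** $K=[0,\pi)$ with $0$ and $\pi$ identified (a circle). For $\theta_0,\theta_1\in K$, $[\theta_0,\theta_1]=\{\theta\in K:\theta_0\le\theta\le\theta_1\}$ if $\theta_0\le\theta_1$, and $\{\theta\in K:\theta\le\theta_1\}\cup\{\theta\in K:\theta\ge\theta_0\}$ if $\theta_0>\theta_1$; these are the closed intervals in $K$. Let $M_{p,q}=A_R^qA_L^p$. For $\theta\in K$, $v=(\cos\theta,\sin\theta)$, $G_{p,q}(\theta)\in K$ is the angle (mod $\pi$) of $M_{p,q}v$, and $H_{p,q}(\theta)=\|M_{p,q}v\|$. If $\det(M_{p,q})<\frac14\mathrm{trace}(M_{p,q})^2$, then $G_{p,q}$ has exactly two fixed points: $\theta^s_{p,q}$, where the derivative of $G_{p,q}$ lies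 in $(0,1)$, and $\theta^u_{p,q}$, where it is greater than $1$. The fixed points of the $G_{p,q}$ are *unmixed* if there is a closed interval $J\subset K$ with $\theta^s_{p,q}\in J$ and $\theta^u_{p,q}\notin J$ for all $(p,q)\in\Gamma$; otherwise they are mixed. If unmixed, $J$ denotes the smallest such interval (the intersection of all such intervals). If $H_{p,q}(\theta)=1$ has exactly two solutions in $K$, then $\theta^{\rm dec}_{p,q}$ is the one at which $H_{p,q}$ is decreasing and $\theta^{\rm inc}_{p,q}$ the one at which it is increasing; otherwise they are said not to exist. Let $C_J=\{\alpha(\cos\theta,\sin\theta):\alpha\in\mathbb{R},\theta\in J\}$. **Algorithm** (computations understood as exact). 1. Let $p_{\max}$ be the smallest $p\in\{2,\ldots,\min[p^*,15]\}$ for which (U) and (FS) are satisfied with $S=(0,c_p)$; if none exists STOP. 2. Let $p_{\min}$ be the largest $p\in\{1,\ldots,p_{\max}-1\}$ for which (V) and (FT) are satisfied with $T=(0,c_p)$; if none exists STOP. 3. Form $\Gamma$ using $q_{\min},q_{\max}$. If $\det(M_{p,q})<\frac14\mathrm{trace}(M_{p,q})^2$ fails for some $(p,q)\in\Gamma$, STOP. 4. If the fixed points of the $G_{p,q}$ are mixed, STOP. 5. With $J$ the smallest closed interval in $K$ such that $\theta^s_{p,q}\in J$ and $\theta^u_{p,q}\notin J$ for all $(p,q)\in\Gamma$ (the intersection of all such closed intervals), if for some $(p,q)\in\Gamma$ the values $\theta^{\rm dec}_{p,q},\theta^{\rm inc}_{p,q}$ do not exist or $J\cap[\theta^{\rm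 dec}_{p,q},\theta^{\rm inc}_{p,q}]\ne\varnothing$, STOP; otherwise output CHAOS. **Switching set.** $\Xi\subset\Omega$ is the union of the switching manifolds of $F$, i.e. the set of $Z\in\Omega$ such that, with $n$ the integer with $F(Z)=f^n(Z)$ in the definition of $F$, $f^i(Z)\in\Sigma$ for some $1\le i\le n-1$. $\Xi_\infty=\bigcup_{i\ge0}\{Z\in\Omega: F^i(Z)\in\Xi\}$. (When the Algorithm outputs CHAOS, $\Omega\subseteq\Phi_0$ and $F(\Omega)\subseteq\Omega$, so these are well defined.) For $Z\in\Omega\setminus\Xi_\infty$ the forward orbit of $Z$ avoids $\Sigma$, so $\mathrm{D}f^n(Z)$ is defined for all $n\ge1$. *)

theory Defs
  imports "HOL-Analysis.Analysis" "HOL-Library.Extended_Nat"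
begin

section \<open>The two-dimensional border-collision normal form\<close>

text \<open>The border-collision parameter is normalised to \<open>\<mu> = 1\<close>; it only enters through
  the translation vector \<open>(1, 0)\<close>.\<close>

record params =
  tau_L :: real
  delta_L :: real
  tau_R :: real
  delta_R :: real

definition A_L :: "params \<Rightarrow> real^2^2" where
  "A_L P = vector [vector [tau_L P, 1], vector [- delta_L P, 0]]"

definition A_R :: "params \<Rightarrow> real^2^2" where
  "A_R P = vector [vector [tau_R P, 1], vector [- delta_R P, 0]]"

definition f_L :: "params \<Rightarrow> real^2 \<Rightarrow> real^2" where
  "f_L P Z = A_L P *v Z + vector [1, 0]"

definition f_R :: "params \<Rightarrow> real^2 \<Rightarrow> real^2" where
  "f_R P Z = A_R P *v Z + vector [1, 0]"

definition bcmap :: "params \<Rightarrow> real^2 \<Rightarrow> real^2" where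
  "bcmap P Z = (if Z $ 1 \<le> 0 then f_L P Z else f_R P Z)"

definition switching_line :: "(real^2) set" where
  "switching_line = {Z. Z $ 1 = 0}"

definition Pi_L :: "(real^2) set" where
  "Pi_L = {Z. Z $ 1 \<le> 0}"

definition Pi_R :: "(real^2) set" where
  "Pi_R = {Z. Z $ 1 \<ge> 0}"


section \<open>The induced map\<close>

definition Phi :: "(real^2) set" where
  "Phi = {Z. Z $ 1 < 0 \<and> Z $ 2 \<le> 0}"

definition Phi_pre :: "params \<Rightarrow> (real^2) set" where
  "Phi_pre P = (\<Union>n\<in>{1..}. (bcmap P ^^ n) -` Phi)"

text \<open>\<open>return_time\<close> and \<open>induced_map\<close> are only meaningful on \<open>\<Phi>\<^sub>0 = \<Phi>\<^sub>p\<^sub>r\<^sub>e \<inter> \<Phi>\<close>,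
  and \<open>chi_L\<close>, \<open>chi_R\<close> only where the orbit does leave the half plane; elsewhere they
  have unspecified values.\<close>

definition return_time :: "params \<Rightarrow> real^2 \<Rightarrow> nat" where
  "return_time P Z = (LEAST n. 1 \<le> n \<and> (bcmap P ^^ n) Z \<in> Phi)"

definition induced_map :: "params \<Rightarrow> real^2 \<Rightarrow> real^2" where
  "induced_map P Z = (bcmap P ^^ return_time P Z) Z"

definition chi_L :: "params \<Rightarrow> real^2 \<Rightarrow> nat" where
  "chi_L P Z = (LEAST i. 1 \<le> i \<and> (bcmap P ^^ i) Z \<notin> Pi_L)"

definition chi_R :: "params \<Rightarrow> real^2 \<Rightarrow> nat" where
  "chi_R P Z = (LEAST j. 1 \<le> j \<and> (bcmap P ^^ j) Z \<notin> Pi_R)"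


section \<open>Preimages of the switching line\<close>

definition line_graph :: "real \<Rightarrow> real \<Rightarrow> (real^2) set" where
  "line_graph m c = {Z. Z $ 2 = m * Z $ 1 + c}"

definition pre_line :: "params \<Rightarrow> nat \<Rightarrow> (real^2) set" where
  "pre_line P i = (f_L P ^^ i) -` switching_line"

definition non_vertical :: "params \<Rightarrow> nat \<Rightarrow> bool" where
  "non_vertical P i \<longleftrightarrow> (\<exists>m c. pre_line P i = line_graph m c)"

definition slope :: "params \<Rightarrow> nat \<Rightarrow> real" where
  "slope P i = (THE m. \<exists>c. pre_line P i = line_graph m c)"

definition intercept :: "params \<Rightarrow> nat \<Rightarrow> real" where
  "intercept P i = (THE c. \<exists>m. pre_line P i = line_graph m c)"

text \<open>The infimum of the empty set in \<^typ>\<open>enat\<close> is \<open>\<infinity>\<close>.\<close>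

definition p_star :: "params \<Rightarrow> enat" where
  "p_star P = Inf (enat ` {i. 1 \<le> i \<and> non_vertical P i \<and> slope P i \<ge> 0})"


section \<open>The conditions (U), (V), (FS), (FT)\<close>

text \<open>\<open>sigma_point P p\<close> is the point \<open>(0, c\<^sub>p)\<close>, so that \<open>S\<close> and \<open>T\<close> are
  \<open>sigma_point P p\<close> with \<open>p = p\<^sub>m\<^sub>a\<^sub>x\<close> and \<open>p = p\<^sub>m\<^sub>i\<^sub>n\<close>. For \<open>X\<close> equal to \<open>S\<close> or \<open>T\<close>,
  \<open>q_of P X\<close> is \<open>q\<^sub>S\<close> or \<open>q\<^sub>T\<close>, \<open>landing P X\<close> is \<open>F(S)\<close> or \<open>F(T)\<close> (these points lie
  outside the domain \<open>\<Phi>\<^sub>0\<close> of \<^term>\<open>induced_map P\<close>), and \<open>crossing P X\<close> is \<open>U\<close> or \<open>V\<close>.\<close>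

definition sigma_point :: "params \<Rightarrow> nat \<Rightarrow> real^2" where
  "sigma_point P p = vector [0, intercept P p]"

definition q_of :: "params \<Rightarrow> real^2 \<Rightarrow> nat" where
  "q_of P X = chi_R P ((f_L P ^^ chi_L P X) X)"

definition landing :: "params \<Rightarrow> real^2 \<Rightarrow> real^2" where
  "landing P X = (f_R P ^^ q_of P X) ((f_L P ^^ chi_L P X) X)"

definition crossing :: "params \<Rightarrow> real^2 \<Rightarrow> real^2" where
  "crossing P X =
     (THE W. W \<in> switching_line \<inter> affine hull {landing P X, inv (bcmap P) (landing P X)})"

definition cond_U :: "params \<Rightarrow> real^2 \<Rightarrow> bool" where
  "cond_U P S \<longleftrightarrow> bcmap P S \<in> Phi_pre P \<and> crossing P S $ 2 > S $ 2"

definition cond_V :: "params \<Rightarrow> real^2 \<Rightarrow> bool" where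
  "cond_V P T \<longleftrightarrow> bcmap P T \<in> Phi_pre P \<and> crossing P T $ 2 < T $ 2"

definition cond_FS :: "params \<Rightarrow> real^2 \<Rightarrow> bool" where
  "cond_FS P S \<longleftrightarrow> bcmap P S \<in> Phi_pre P \<and>
     bcmap P S $ 1 * landing P S $ 2 + S $ 2 * landing P S $ 1 < bcmap P S $ 1 * S $ 2"

definition cond_FT :: "params \<Rightarrow> real^2 \<Rightarrow> bool" where
  "cond_FT P T \<longleftrightarrow> bcmap P T \<in> Phi_pre P \<and>
     bcmap P T $ 1 * landing P T $ 2 + T $ 2 * landing P T $ 1 > bcmap P T $ 1 * T $ 2"


section \<open>Angle maps\<close>

definition K_circle :: "real set" where
  "K_circle = {0..<pi}"

definition K_interval :: "real \<Rightarrow> real \<Rightarrow> real set" where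
  "K_interval t0 t1 =
     (if t0 \<le> t1 then {t \<in> K_circle. t0 \<le> t \<and> t \<le> t1} else {t \<in> K_circle. t \<le> t1} \<union> {t \<in> K_circle. t \<ge> t0})"

definition closed_K_interval :: "real set \<Rightarrow> bool" where
  "closed_K_interval I \<longleftrightarrow> (\<exists>t0\<in>K_circle. \<exists>t1\<in>K_circle. I = K_interval t0 t1)"

definition unit_dir :: "real \<Rightarrow> real^2" where
  "unit_dir t = vector [cos t, sin t]"

text \<open>The power operation \<open>^\<close> on \<^typ>\<open>real^2^2\<close> is componentwise, hence a separate matrix power.\<close>

primrec matrix_power :: "real^2^2 \<Rightarrow> nat \<Rightarrow> real^2^2" where
  "matrix_power A 0 = mat 1"
| "matrix_power A (Suc n) = A ** matrix_power A n"

definition M_mat :: "params \<Rightarrow> nat \<Rightarrow> nat \<Rightarrow> real^2^2" where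
  "M_mat P p q = matrix_power (A_R P) q ** matrix_power (A_L P) p"

text \<open>A function on the circle \<open>K_circle\<close> is represented by a \<open>\<pi>\<close>-periodic function on the reals. In
  \<open>G_map\<close> the factor \<open>r\<close> may be negative, as angles are taken modulo \<open>\<pi>\<close>.\<close>

definition G_map :: "params \<Rightarrow> nat \<Rightarrow> nat \<Rightarrow> real \<Rightarrow> real" where
  "G_map P p q t = (THE s. s \<in> K_circle \<and> (\<exists>r. M_mat P p q *v unit_dir t = r *\<^sub>R unit_dir s))"

definition H_map :: "params \<Rightarrow> nat \<Rightarrow> nat \<Rightarrow> real \<Rightarrow> real" where
  "H_map P p q t = norm (M_mat P p q *v unit_dir t)"

text \<open>Derivative of a map of the circle \<open>K_circle\<close>: as \<open>0\<close> and \<open>\<pi>\<close> are identified, the map may jump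
  by \<open>\<pi>\<close> as a real-valued function, so one differentiates a lift, i.e. a real function
  congruent to it modulo \<open>\<pi>\<close>. A lift differentiable at \<open>t\<close> is continuous there, which makes
  the derivative unique.\<close>

definition has_circle_derivative :: "(real \<Rightarrow> real) \<Rightarrow> real \<Rightarrow> real \<Rightarrow> bool" where
  "has_circle_derivative g D t \<longleftrightarrow>
     (\<exists>l. (\<forall>s. \<exists>k::int. l s = g s + of_int k * pi) \<and> (l has_real_derivative D) (at t))"

definition theta_s :: "params \<Rightarrow> nat \<Rightarrow> nat \<Rightarrow> real" where
  "theta_s P p q = (THE t. t \<in> K_circle \<and> G_map P p q t = t \<and>
     (\<exists>D. has_circle_derivative (G_map P p q) D t \<and> 0 < D \<and> D < 1))"

definition theta_u :: "params \<Rightarrow> nat \<Rightarrow> nat \<Rightarrow> real" where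
  "theta_u P p q = (THE t. t \<in> K_circle \<and> G_map P p q t = t \<and>
     (\<exists>D. has_circle_derivative (G_map P p q) D t \<and> D > 1))"

definition dec_inc_exist :: "params \<Rightarrow> nat \<Rightarrow> nat \<Rightarrow> bool" where
  "dec_inc_exist P p q \<longleftrightarrow> card {t \<in> K_circle. H_map P p q t = 1} = 2"

definition theta_dec :: "params \<Rightarrow> nat \<Rightarrow> nat \<Rightarrow> real" where
  "theta_dec P p q = (THE t. t \<in> K_circle \<and> H_map P p q t = 1 \<and>
     (\<exists>e>0. strict_antimono_on {t - e<..<t + e} (H_map P p q)))"

definition theta_inc :: "params \<Rightarrow> nat \<Rightarrow> nat \<Rightarrow> real" where
  "theta_inc P p q = (THE t. t \<in> K_circle \<and> H_map P p q t = 1 \<and>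
     (\<exists>e>0. strict_mono_on {t - e<..<t + e} (H_map P p q)))"

definition separates :: "params \<Rightarrow> (nat \<times> nat) set \<Rightarrow> real set \<Rightarrow> bool" where
  "separates P \<Gamma> J \<longleftrightarrow>
     closed_K_interval J \<and> (\<forall>(p, q)\<in>\<Gamma>. theta_s P p q \<in> J \<and> theta_u P p q \<notin> J)"

definition unmixed :: "params \<Rightarrow> (nat \<times> nat) set \<Rightarrow> bool" where
  "unmixed P \<Gamma> \<longleftrightarrow> (\<exists>J. separates P \<Gamma> J)"


section \<open>The algorithm\<close>

definition p_max_ok :: "params \<Rightarrow> nat \<Rightarrow> bool" where
  "p_max_ok P p \<longleftrightarrow> 2 \<le> p \<and> enat p \<le> min (p_star P) 15 \<and>
     cond_U P (sigma_point P p) \<and> cond_FS P (sigma_point P p)"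

definition p_max :: "params \<Rightarrow> nat" where
  "p_max P = (LEAST p. p_max_ok P p)"

definition p_min_ok :: "params \<Rightarrow> nat \<Rightarrow> bool" where
  "p_min_ok P p \<longleftrightarrow> p \<in> {1..p_max P - 1} \<and>
     cond_V P (sigma_point P p) \<and> cond_FT P (sigma_point P p)"

definition p_min :: "params \<Rightarrow> nat" where
  "p_min P = (GREATEST p. p_min_ok P p)"

definition S_pt :: "params \<Rightarrow> real^2" where
  "S_pt P = sigma_point P (p_max P)"

definition T_pt :: "params \<Rightarrow> real^2" where
  "T_pt P = sigma_point P (p_min P)"

definition q_min :: "params \<Rightarrow> nat" where
  "q_min P = min (q_of P (S_pt P)) (q_of P (T_pt P))"

definition q_max :: "params \<Rightarrow> nat" where
  "q_max P = max (q_of P (S_pt P)) (q_of P (T_pt P)) + 1"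

definition Gamma_set :: "params \<Rightarrow> (nat \<times> nat) set" where
  "Gamma_set P = {(p, q). p_min P \<le> p \<and> p \<le> p_max P \<and> q_min P \<le> q \<and> q \<le> q_max P}"

definition J_set :: "params \<Rightarrow> real set" where
  "J_set P = \<Inter> {J. separates P (Gamma_set P) J}"

datatype outcome = STOP | CHAOS

definition algorithm :: "params \<Rightarrow> outcome" where
  "algorithm P =
    (if \<not> (\<exists>p. p_max_ok P p) then STOP
     else if \<not> (\<exists>p. p_min_ok P p) then STOP
     else if \<not> (\<forall>(p, q)\<in>Gamma_set P. det (M_mat P p q) < (1/4) * (trace (M_mat P p q))\<^sup>2) then STOP
     else if \<not> unmixed P (Gamma_set P) then STOP
     else if \<exists>(p, q)\<in>Gamma_set P. \<not> dec_inc_exist P p q \<or>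
               J_set P \<inter> K_interval (theta_dec P p q) (theta_inc P p q) \<noteq> {} then STOP
     else CHAOS)"


section \<open>The trapping region, the switching set and the cone\<close>

definition Omega_set :: "params \<Rightarrow> (real^2) set" where
  "Omega_set P = {Z \<in> Phi.
     (intercept P (p_max P) + 1) / intercept P (p_max P) * (intercept P (p_max P) - Z $ 2) \<le> Z $ 1 \<and>
     Z $ 1 \<le> (intercept P (p_min P) + 1) / intercept P (p_min P) * (intercept P (p_min P) - Z $ 2)}"

definition Xi :: "params \<Rightarrow> (real^2) set" where
  "Xi P = {Z \<in> Omega_set P.
     \<exists>i. 1 \<le> i \<and> i \<le> return_time P Z - 1 \<and> (bcmap P ^^ i) Z \<in> switching_line}"

definition Xi_inf :: "params \<Rightarrow> (real^2) set" where
  "Xi_inf P = (\<Union>i. {Z \<in> Omega_set P. (induced_map P ^^ i) Z \<in> Xi P})"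

definition C_J :: "params \<Rightarrow> (real^2) set" where
  "C_J P = {\<alpha> *\<^sub>R unit_dir t | \<alpha> t. t \<in> J_set P}"

end

theory Submission
  imports Defs
begin

text \<open>
  The iterates of a point of \<open>\<Omega>\<close> are grouped by its returns to \<open>\<Omega>\<close>. Each return consists of \<open>p\<close>
  steps of the left piece followed by \<open>q\<close> steps of the right piece with \<open>(p, q) \<in> \<Gamma>\<close>
  (\<open>induced_return\<close>), so away from the switching line its Jacobian is \<open>M\<^sub>p\<^sub>,\<^sub>q\<close>. All these
  matrices map the cone \<open>C\<^sub>J\<close> into itself (\<open>C_J_invariant\<close>) and expand its vectors by a uniform factor
  \<open>\<kappa> > 1\<close> (\<open>C_J_expanding\<close>). As returns take a bounded number of steps, the norm of the derivative
  grows exponentially (\<open>jacobian_growth\<close>), which is the claim.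

  \<^emph>\<open>The left half-plane.\<close> The preimages \<open>y = - a\<^sub>i x + c\<^sub>i\<close> of the switching line have decreasing \<open>a\<^sub>i\<close> and
  \<open>c\<^sub>i\<close>, and their positions relative to \<open>\<Omega>\<close> give the possible values of \<open>p\<close>. The \<open>p\<close>-th image of the
  point \<open>(0, c\<^sub>p)\<close> is again on the switching line, at a height \<open>s\<^sub>p\<close> that increases with \<open>p\<close>. Comparison
  with the images of the lines shows that the points of \<open>\<Omega>\<close> enter the right half-plane in the region
  covered by the segments from \<open>(0, w)\<close> to \<open>(w + 1, 0)\<close> with \<open>w\<close> between the values \<open>t\<close> and \<open>s\<close>
  belonging to the corners \<open>T\<close> and \<open>S\<close> (\<open>left_entry\<close>).

  \<^emph>\<open>The right half-plane.\<close> There the map is affine, so it suffices to follow the orbits of the points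
  \<open>(0, w)\<close>, which depend affinely on \<open>w\<close>. The key point is that such an orbit cannot come back to the
  switching line at a height \<open>b \<ge> -1\<close>: otherwise the convex hull of the origin and of the orbit up to
  then would be invariant and contain \<open>(t + 1, 0)\<close>, whereas the orbit of \<open>T\<close> leaves the right half-plane
  (\<open>return_height\<close>). Hence an orbit that hits the switching line exits in the next step, and this allows
  to compare the crossings of different orbits even when they exit at different times. They exit no later than
  the later one of the two corners (\<open>exit_aux\<close>), their crossing points are ordered, and so they lie between
  those of \<open>S\<close> and \<open>T\<close>; the sides of \<open>\<Omega>\<close> on which the corners land are inherited by all
  orbits in between (\<open>crosses_mono\<close>). With the conditions on \<open>S\<close> and \<open>T\<close> this puts the landing points
  in \<open>\<Omega>\<close> (\<open>right_exit\<close>).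

  \<^emph>\<open>The cone.\<close> A closed interval of directions is the set where a suitable quadratic form is nonnegative. The
  fixed points of the angle maps are the eigendirections of \<open>M\<^sub>p\<^sub>,\<^sub>q\<close>. If a form is nonnegative at the
  attracting and negative at the repelling eigendirection, then the set where it is nonnegative is mapped into
  itself, since the matrix shortens the repelling component relative to the attracting one
  (\<open>quad_form_contract\<close>). Finally, \<open>H\<^sub>p\<^sub>,\<^sub>q\<close> exceeds \<open>1\<close> outside the interval from its decreasing to its
  increasing solution (\<open>H_map_expands\<close>), so that the algorithm's last test and compactness give \<open>\<kappa>\<close>.
\<close>

section \<open>Coordinates, affine combinations and signed areas\<close>

lemma vec2_eq_iff: "(Z::real^2) = W \<longleftrightarrow> Z $ 1 = W $ 1 \<and> Z $ 2 = W $ 2"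
  by (simp add: vec_eq_iff forall_2)

lemma f_L_nth [simp]:
  "f_L P Z $ 1 = tau_L P * Z $ 1 + Z $ 2 + 1" "f_L P Z $ 2 = - delta_L P * Z $ 1"
  by (simp_all add: f_L_def A_L_def matrix_vector_mult_def sum_2 vector_2)

lemma f_R_nth [simp]:
  "f_R P Z $ 1 = tau_R P * Z $ 1 + Z $ 2 + 1" "f_R P Z $ 2 = - delta_R P * Z $ 1"
  by (simp_all add: f_R_def A_R_def matrix_vector_mult_def sum_2 vector_2)

lemma bcmap_L: "Z $ 1 \<le> 0 \<Longrightarrow> bcmap P Z = f_L P Z"
  by (simp add: bcmap_def)

lemma bcmap_R: "Z $ 1 \<ge> 0 \<Longrightarrow> bcmap P Z = f_R P Z"
  by (auto simp add: bcmap_def vec2_eq_iff)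

lemma bcmap_funpow_L:
  "(\<And>i. i < n \<Longrightarrow> (f_L P ^^ i) Z $ 1 \<le> 0) \<Longrightarrow> (bcmap P ^^ n) Z = (f_L P ^^ n) Z"
  by (induction n) (simp_all add: bcmap_L)

lemma bcmap_funpow_R:
  "(\<And>i. i < n \<Longrightarrow> (f_R P ^^ i) Z $ 1 \<ge> 0) \<Longrightarrow> (bcmap P ^^ n) Z = (f_R P ^^ n) Z"
  by (induction n) (simp_all add: bcmap_R)

lemma f_R_combination:
  "f_R P ((1 - u) *\<^sub>R A + u *\<^sub>R B) = (1 - u) *\<^sub>R f_R P A + u *\<^sub>R f_R P B"
  by (simp add: vec2_eq_iff algebra_simps)

lemma f_R_funpow_combination:
  "(f_R P ^^ n) ((1 - u) *\<^sub>R A + u *\<^sub>R B) = (1 - u) *\<^sub>R (f_R P ^^ n) A + u *\<^sub>R (f_R P ^^ n) B"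
  by (induction n) (simp_all add: f_R_combination)

text \<open>Twice the signed area of the triangle \<open>A B C\<close>, positive when its vertices are in
  anticlockwise order.\<close>

definition area :: "real^2 \<Rightarrow> real^2 \<Rightarrow> real^2 \<Rightarrow> real" where
  "area A B C = (B $ 1 - A $ 1) * (C $ 2 - A $ 2) - (B $ 2 - A $ 2) * (C $ 1 - A $ 1)"

lemma area_f_L: "area (f_L P A) (f_L P B) (f_L P C) = delta_L P * area A B C"
  by (simp add: area_def algebra_simps)

lemma area_f_R: "area (f_R P A) (f_R P B) (f_R P C) = delta_R P * area A B C"
  by (simp add: area_def algebra_simps)

lemma area_f_L_funpow:
  "area ((f_L P ^^ n) A) ((f_L P ^^ n) B) ((f_L P ^^ n) C) = delta_L P ^ n * area A B C"
  by (induction n) (simp_all add: area_f_L)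

lemma area_f_R_funpow:
  "area ((f_R P ^^ n) A) ((f_R P ^^ n) B) ((f_R P ^^ n) C) = delta_R P ^ n * area A B C"
  by (induction n) (simp_all add: area_f_R)


section \<open>The fan of segments from a point of the switching line to its image\<close>

text \<open>The sign of \<open>fan c Z\<close> tells on which side of the line through \<open>(0, c)\<close> and its image
  \<open>(c + 1, 0)\<close> the point \<open>Z\<close> lies; it is positive on the side of the origin when \<open>c < -1\<close>. The
  set \<open>\<Omega>\<close> is cut out of \<open>\<Phi>\<close> by two such conditions.\<close>

definition fan :: "real \<Rightarrow> real^2 \<Rightarrow> real" where
  "fan c Z = Z $ 1 - (c + 1) / c * (c - Z $ 2)"

lemma fan_eq: "fan c Z = Z $ 1 + (c + 1) / c * Z $ 2 - (c + 1) / c * c"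
  unfolding fan_def right_diff_distrib by simp

lemma fan_combination:
  "fan c ((1 - u) *\<^sub>R A + u *\<^sub>R B) = (1 - u) * fan c A + u * fan c B"
proof -
  define m where "m = (c + 1) / c"
  show ?thesis unfolding fan_eq m_def[symmetric] by (simp add: algebra_simps)
qed

lemma fan_switching:
  assumes "c < - 1"
  shows "c \<le> b \<Longrightarrow> 0 \<le> fan c (vector [0, b])"
    and "c \<le> b \<Longrightarrow> 0 \<le> fan c (vector [b + 1, 0])"
proof -
  have "0 < (c + 1) / c" using assms by (simp add: zero_less_divide_iff)
  then show "c \<le> b \<Longrightarrow> 0 \<le> fan c (vector [0, b])"
    by (simp add: fan_def mult_nonneg_nonpos del: times_divide_eq_left)
  show "c \<le> b \<Longrightarrow> 0 \<le> fan c (vector [b + 1, 0])"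
    using assms by (simp add: fan_def)
qed

lemma fan_switching':
  assumes "c \<le> - 1"
  shows "b \<le> c \<Longrightarrow> fan c (vector [0, b]) \<le> 0"
    and "b \<le> c \<Longrightarrow> fan c (vector [b + 1, 0]) \<le> 0"
proof -
  have "0 \<le> (c + 1) / c" using assms by (simp add: zero_le_divide_iff)
  then show "b \<le> c \<Longrightarrow> fan c (vector [0, b]) \<le> 0"
    by (simp add: fan_def del: times_divide_eq_left)
  show "b \<le> c \<Longrightarrow> fan c (vector [b + 1, 0]) \<le> 0"
    using assms by (simp add: fan_def)
qed

lemma area_fan:
  assumes "u \<noteq> 0"
  shows "area Y (vector [0, u]) (vector [u + 1, 0]) = u * fan u Y"
  using assms by (simp add: area_def fan_def field_simps)

lemma fan_diff:
  assumes "u \<noteq> 0" "c \<noteq> 0"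
  shows "fan c Y - fan u Y = (u - c) * (1 + Y $ 2 / (u * c))"
  using assms by (simp add: fan_def field_simps)

text \<open>In the closed third quadrant the segments from \<open>(0, c)\<close> to \<open>(c + 1, 0)\<close> are nested.\<close>

lemma fan_mono_pos:
  assumes "c \<le> u" "u < - 1" "fan u Y \<ge> 0" "Y $ 1 \<le> 0" "Y $ 2 \<le> 0"
  shows "fan c Y \<ge> 0"
proof -
  have "0 < (u + 1) / u" using assms(2) by (simp add: zero_less_divide_iff)
  moreover have "(u + 1) / u * (u - Y $ 2) \<le> 0" using assms by (simp add: fan_def)
  ultimately have 1: "Y $ 2 \<ge> u" by (metis diff_le_0_iff_le mult_le_0_iff not_less)
  have uc: "0 < u * c" using assms by (simp add: mult_neg_neg)
  have "u * 1 \<ge> u * (- c)" using assms by (intro mult_left_mono_neg) auto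
  with 1 have "Y $ 2 \<ge> - (u * c)" by simp
  then have "- 1 \<le> Y $ 2 / (u * c)" using uc by (subst pos_le_divide_eq) auto
  then have "0 \<le> 1 + Y $ 2 / (u * c)" by simp
  then have "0 \<le> (u - c) * (1 + Y $ 2 / (u * c))" using assms by simp
  then show ?thesis using fan_diff[of u c Y] assms by simp
qed

lemma fan_mono_neg:
  assumes "v \<le> c" "c \<le> - 1" "fan v Y \<le> 0" "Y $ 1 \<le> 0" "Y $ 2 \<le> 0"
  shows "fan c Y \<le> 0"
proof (cases "Y $ 2 \<ge> - (v * c)")
  case True
  have vc: "0 < v * c" using assms by (simp add: mult_neg_neg)
  then have "- 1 \<le> Y $ 2 / (v * c)" using True by (subst pos_le_divide_eq) auto
  then have "0 \<le> 1 + Y $ 2 / (v * c)" by simp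
  then have "(v - c) * (1 + Y $ 2 / (v * c)) \<le> 0" using assms by (simp add: mult_nonpos_nonneg)
  then show ?thesis using fan_diff[of v c Y] assms by simp
next
  case False
  have "c * (- v) \<le> c * 1" using assms by (intro mult_left_mono_neg) auto
  with False have 1: "Y $ 2 \<le> c" by (simp add: mult.commute)
  have "0 \<le> (c + 1) / c" using assms by (simp add: zero_le_divide_iff)
  then have "0 \<le> (c + 1) / c * (c - Y $ 2)" using 1 by (intro mult_nonneg_nonneg) auto
  then show ?thesis using assms by (simp add: fan_def)
qed

text \<open>As \<^term>\<open>fan c\<close> is affine, its value at \<open>Y\<close> is the mean of its values at the vertices of a triangle,
  with the barycentric coordinates of \<open>Y\<close> as weights.\<close>

lemma fan_barycentric:
  "area A B C * fan c Y = area Y B C * fan c A + area A Y C * fan c B + area A B Y * fan c C"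
proof -
  have *: "area A B C = area Y B C + area A Y C + area A B Y"
    "area A B C * Y $ i = area Y B C * A $ i + area A Y C * B $ i + area A B Y * C $ i"
    if "i = 1 \<or> i = 2" for i
    using that by (auto simp: area_def algebra_simps)
  define m where "m = (c + 1) / c"
  have f: "fan c Z = Z $ 1 + m * Z $ 2 - m * c" for Z
    by (simp add: fan_eq m_def)
  have "area A B C * fan c Y = area A B C * Y $ 1 + m * (area A B C * Y $ 2) - m * c * area A B C"
    unfolding f by (simp add: algebra_simps)
  also have "\<dots> = (area Y B C * A $ 1 + area A Y C * B $ 1 + area A B Y * C $ 1)
      + m * (area Y B C * A $ 2 + area A Y C * B $ 2 + area A B Y * C $ 2)
      - m * c * (area Y B C + area A Y C + area A B Y)"
    using *(2)[of 1] *(2)[of 2] *(1)[of 1] by simp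
  also have "\<dots> = area Y B C * fan c A + area A Y C * fan c B + area A B Y * fan c C"
    unfolding f by (simp add: algebra_simps)
  finally show ?thesis .
qed

lemma area_split: "area A B C = area Y B C + area A Y C + area A B Y"
  by (simp add: area_def algebra_simps)

text \<open>Let \<open>U\<close> be the point \<open>(0, u)\<close> and \<open>U'\<close> its image. If \<open>Y\<close> lies to the left of the lines from \<open>X\<close> to
  \<open>U\<close> and from \<open>U'\<close> to \<open>X\<close>, then either \<open>Y\<close> is on the same side of the line \<open>U U'\<close> as the origin, or \<open>Y\<close> is in
  the triangle \<open>X U U'\<close>. In both cases \<open>Y\<close> inherits a lower bound on the fan coordinate from \<open>X\<close>
  and \<open>U\<close>. The next lemma is the mirror image, with upper bounds.\<close>

lemma fan_above:
  assumes c: "c < - 1" and u: "c \<le> u" "u < - 1"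
    and X: "fan c X \<ge> 0" and Y: "Y $ 1 \<le> 0" "Y $ 2 \<le> 0"
    and 1: "area X (vector [0, u]) Y \<ge> 0" and 2: "area X Y (vector [u + 1, 0]) \<ge> 0"
  shows "fan c Y \<ge> 0"
proof (cases "fan u Y \<ge> 0")
  case True
  then show ?thesis using fan_mono_pos u Y by blast
next
  case False
  let ?U = "vector [0, u] :: real^2" and ?V = "vector [u + 1, 0] :: real^2"
  have K: "area Y ?U ?V > 0" using False u by (simp add: area_fan mult_neg_neg)
  have pos: "area X ?U ?V > 0" using area_split[of X ?U ?V Y] K 1 2 by linarith
  have "area X ?U ?V * fan c Y \<ge> 0"
    unfolding fan_barycentric[of X ?U ?V c Y]
    using K X 1 2 fan_switching[OF c u(1)] by simp
  then show ?thesis using pos by (simp add: zero_le_mult_iff)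
qed

lemma fan_below:
  assumes c: "c \<le> - 1" and v: "v \<le> c" "v < - 1"
    and Y: "fan c Y \<le> 0" and X: "X $ 1 \<le> 0" "X $ 2 \<le> 0"
    and 1: "area (vector [0, v]) Y X \<ge> 0" and 2: "area Y (vector [v + 1, 0]) X \<ge> 0"
  shows "fan c X \<le> 0"
proof (cases "fan v X \<le> 0")
  case True
  then show ?thesis using fan_mono_neg c v X by blast
next
  case False
  let ?U = "vector [0, v] :: real^2" and ?V = "vector [v + 1, 0] :: real^2"
  have K: "area X ?U ?V < 0" using False v by (simp add: area_fan mult_neg_pos)
  have a1: "area Y ?U X \<le> 0" and a2: "area Y X ?V \<le> 0"
    using 1 2 by (simp_all add: area_def algebra_simps)
  have neg: "area Y ?U ?V < 0" using area_split[of Y ?U ?V X] K a1 a2 by linarith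
  have "area Y ?U ?V * fan c X \<ge> 0"
    unfolding fan_barycentric[of Y ?U ?V c X]
    using K Y a1 a2 fan_switching'[OF c v(1)] by (simp add: mult_nonpos_nonpos)
  then show ?thesis using neg by (simp add: zero_le_mult_iff)
qed


section \<open>The passage through the right half-plane\<close>

text \<open>The affine orbit under the right piece of a point of the switching line.\<close>

definition R_orbit :: "params \<Rightarrow> nat \<Rightarrow> real \<Rightarrow> real^2" where
  "R_orbit P j w = (f_R P ^^ j) (vector [0, w])"

lemma R_orbit_0 [simp]: "R_orbit P 0 w = vector [0, w]"
  by (simp add: R_orbit_def)

lemma R_orbit_Suc: "R_orbit P (Suc j) w = f_R P (R_orbit P j w)"
  by (simp add: R_orbit_def)

lemma R_orbit_1: "R_orbit P (Suc 0) w = vector [w + 1, 0]"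
  by (simp add: R_orbit_Suc vec2_eq_iff)

lemma R_orbit_Suc': "R_orbit P (Suc j) w = (f_R P ^^ j) (vector [w + 1, 0])"
proof -
  have "f_R P (vector [0, w]) = vector [w + 1, 0]" by (simp add: vec2_eq_iff)
  then show ?thesis by (simp add: R_orbit_def funpow_Suc_right del: funpow.simps)
qed

lemma R_orbit_combination:
  "R_orbit P j ((1 - u) * w1 + u * w2) = (1 - u) *\<^sub>R R_orbit P j w1 + u *\<^sub>R R_orbit P j w2"
proof -
  have "vector [0, (1 - u) * w1 + u * w2] = (1 - u) *\<^sub>R vector [0, w1] + u *\<^sub>R (vector [0, w2] :: real^2)"
    by (simp add: vec2_eq_iff)
  then show ?thesis by (simp add: R_orbit_def f_R_funpow_combination)
qed

lemma between_combination:
  fixes w1 w2 w :: real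
  assumes "w1 \<le> w" "w \<le> w2"
  obtains u where "0 \<le> u" "u \<le> 1" "w = (1 - u) * w1 + u * w2"
proof (cases "w1 = w2")
  case True
  then show ?thesis using assms that[of 0] by simp
next
  case False
  then have d: "w2 - w1 > 0" using assms by simp
  define u where "u = (w - w1) / (w2 - w1)"
  have "u * (w2 - w1) = w - w1" using d by (simp add: u_def)
  then have "w = (1 - u) * w1 + u * w2" by (simp add: algebra_simps)
  moreover have "0 \<le> u" "u \<le> 1" using d assms by (simp_all add: u_def)
  ultimately show ?thesis using that by blast
qed

text \<open>Each coordinate of a point of \<^const>\<open>R_orbit\<close> is an affine function of the starting height.\<close>

lemma R_orbit_nonneg_between:
  assumes "w1 \<le> w" "w \<le> w2" "R_orbit P j w1 $ 1 \<ge> 0" "R_orbit P j w2 $ 1 \<ge> 0"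
  shows "R_orbit P j w $ 1 \<ge> 0"
proof -
  obtain u where u: "0 \<le> u" "u \<le> 1" "w = (1 - u) * w1 + u * w2"
    using between_combination assms by metis
  show ?thesis unfolding u(3) R_orbit_combination using u assms by simp
qed

lemma R_orbit_neg_between:
  assumes "w1 \<le> w" "w \<le> w2" "R_orbit P j w1 $ 1 < 0" "R_orbit P j w2 $ 1 < 0"
  shows "R_orbit P j w $ 1 < 0"
proof -
  obtain u where u: "0 \<le> u" "u \<le> 1" "w = (1 - u) * w1 + u * w2"
    using between_combination assms by metis
  have "(1 - u) * R_orbit P j w1 $ 1 + u * R_orbit P j w2 $ 1 < 0"
  proof (cases "u = 0")
    case False
    then have "u * R_orbit P j w2 $ 1 < 0" "(1 - u) * R_orbit P j w1 $ 1 \<le> 0"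
      using u assms by (auto simp: mult_pos_neg mult_nonneg_nonpos)
    then show ?thesis by linarith
  qed (use assms in simp)
  then show ?thesis unfolding u(3) R_orbit_combination by simp
qed

lemma R_orbit_zero_between:
  assumes "w1 \<le> w2"
    and "R_orbit P j w1 $ 1 \<le> 0 \<and> 0 \<le> R_orbit P j w2 $ 1 \<or> R_orbit P j w2 $ 1 \<le> 0 \<and> 0 \<le> R_orbit P j w1 $ 1"
  obtains w where "w1 \<le> w" "w \<le> w2" "R_orbit P j w $ 1 = 0"
proof -
  define g where "g u = (1 - u) * R_orbit P j w1 $ 1 + u * R_orbit P j w2 $ 1" for u
  have "\<exists>u. 0 \<le> u \<and> u \<le> 1 \<and> g u = 0"
    using assms(2)
  proof
    assume "R_orbit P j w1 $ 1 \<le> 0 \<and> 0 \<le> R_orbit P j w2 $ 1"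
    then show ?thesis by (intro IVT') (auto simp: g_def intro!: continuous_intros)
  next
    assume "R_orbit P j w2 $ 1 \<le> 0 \<and> 0 \<le> R_orbit P j w1 $ 1"
    then show ?thesis by (intro IVT2') (auto simp: g_def intro!: continuous_intros)
  qed
  then obtain u where u: "0 \<le> u" "u \<le> 1" "g u = 0" by blast
  show ?thesis
  proof (rule that[of "(1 - u) * w1 + u * w2"])
    show "w1 \<le> (1 - u) * w1 + u * w2" "(1 - u) * w1 + u * w2 \<le> w2"
      using u assms(1) mult_left_mono[of w1 w2 u] mult_left_mono[of w1 w2 "1 - u"]
      by (simp_all add: algebra_simps)
    show "R_orbit P j ((1 - u) * w1 + u * w2) $ 1 = 0"
      unfolding R_orbit_combination using u(3) by (simp add: g_def)
  qed
qed

lemma R_orbit_area: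
  "area (R_orbit P j w1) (R_orbit P (Suc j) w1) (R_orbit P (Suc j) w2) = delta_R P ^ j * ((w2 - w1) * w1)"
  "area (R_orbit P j w1) (R_orbit P (Suc j) w1) (R_orbit P j w2) = delta_R P ^ j * ((w2 - w1) * (w1 + 1))"
  "area (R_orbit P j w1) (R_orbit P (Suc j) w2) (R_orbit P j w2) = delta_R P ^ j * ((w2 - w1) * (w2 + 1))"
  "area (R_orbit P (Suc j) w1) (R_orbit P (Suc j) w2) (R_orbit P j w2) = delta_R P ^ j * ((w2 - w1) * w2)"
  unfolding R_orbit_Suc' R_orbit_def[of P j] area_f_R_funpow
  by (simp_all add: area_def algebra_simps)

text \<open>\<open>crosses P k w b\<close>: the orbit of \<open>(0, w)\<close> stays in the right half-plane up to time \<open>k\<close>, and the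
  segment between its points at times \<open>k\<close> and \<open>k + 1\<close> meets the switching line in \<open>(0, b)\<close>, being
  directed to the left. An orbit that is on the switching line at time \<open>k + 1\<close> crosses at time \<open>k\<close>, and
  again at time \<open>k + 1\<close> if \<open>b \<le> -1\<close>; admitting both allows to pass from one crossing time to the next.\<close>

definition crosses :: "params \<Rightarrow> nat \<Rightarrow> real \<Rightarrow> real \<Rightarrow> bool" where
  "crosses P k w b \<longleftrightarrow> (\<forall>j\<le>k. 0 \<le> R_orbit P j w $ 1) \<and> R_orbit P (Suc k) w $ 1 \<le> 0 \<and>
     (\<exists>r\<in>{0..1}. vector [0, b] = (1 - r) *\<^sub>R R_orbit P k w + r *\<^sub>R R_orbit P (Suc k) w)"

lemma crosses_exists:
  assumes "\<forall>j\<le>k. 0 \<le> R_orbit P j w $ 1" and "R_orbit P (Suc k) w $ 1 < 0"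
  shows "\<exists>b. crosses P k w b"
proof -
  let ?x = "R_orbit P k w $ 1" and ?z = "R_orbit P (Suc k) w $ 1"
  define r where "r = ?x / (?x - ?z)"
  have d: "?x - ?z > 0" "?x \<ge> 0" using assms by (auto simp: less_le_trans)
  then have "r \<in> {0..1}" using assms(2) by (auto simp: r_def divide_simps)
  moreover have "(1 - r) * ?x + r * ?z = 0" using d by (simp add: r_def field_simps)
  then have "vector [0, (1 - r) * R_orbit P k w $ 2 + r * R_orbit P (Suc k) w $ 2]
      = (1 - r) *\<^sub>R R_orbit P k w + r *\<^sub>R R_orbit P (Suc k) w"
    by (simp add: vec2_eq_iff)
  ultimately show ?thesis unfolding crosses_def using assms by (metis less_imp_le)
qed

lemma crosses_at_switching:
  assumes "\<forall>j\<le>k. 0 \<le> R_orbit P j w $ 1" and "R_orbit P (Suc k) w = vector [0, b]"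
  shows "crosses P k w b" and "b \<le> - 1 \<Longrightarrow> crosses P (Suc k) w b"
proof -
  show "crosses P k w b" unfolding crosses_def using assms by (auto intro!: bexI[of _ 1])
  assume "b \<le> - 1"
  then show "crosses P (Suc k) w b"
    unfolding crosses_def using assms
    by (auto simp: R_orbit_Suc[of P "Suc k"] le_Suc_eq intro!: bexI[of _ 0])
qed

text \<open>The orbit of \<open>(0, t)\<close>, which enters the right half-plane at \<open>(t + 1, 0)\<close>, is assumed to leave
  it again. In the application \<open>(0, t)\<close> lies on the orbit of the corner \<open>T\<close>, and the heights \<open>w \<ge> t\<close> are
  those of the points between the orbits of \<open>T\<close> and \<open>S\<close>.\<close>

locale right_passage =
  fixes P :: params and t :: real
  assumes delta_R_pos: "0 < delta_R P" and t_nonneg: "0 \<le> t"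
    and exits: "\<exists>j. R_orbit P j t $ 1 < 0"
begin

text \<open>If an orbit came back to the switching line at a height \<open>b \<ge> -1\<close>, the convex hull of its points
  and of the origin would be invariant under the right piece, and the orbit of \<open>(0, t)\<close> could
  not leave the right half-plane.\<close>

lemma return_height:
  assumes w: "t \<le> w" and right: "\<forall>j\<le>i. 0 \<le> R_orbit P j w $ 1"
    and i: "1 \<le> i" and zero: "R_orbit P i w $ 1 = 0"
  shows "R_orbit P i w $ 2 < - 1"
proof (rule ccontr)
  define b where "b = R_orbit P i w $ 2"
  assume "\<not> R_orbit P i w $ 2 < - 1"
  then have b1: "- 1 \<le> b" by (simp add: b_def)
  obtain i' where i': "i = Suc i'" using i by (cases i) auto
  have b0: "b \<le> 0" unfolding b_def i' R_orbit_Suc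
    using right delta_R_pos by (simp add: i')
  define C where "C = convex hull (insert 0 ((\<lambda>j. R_orbit P j w) ` {1..i}))"
  have w0: "0 \<le> w" using w t_nonneg by simp
  have C: "convex C" "0 \<in> C" "\<And>j. 1 \<le> j \<Longrightarrow> j \<le> i \<Longrightarrow> R_orbit P j w \<in> C"
    unfolding C_def by (auto intro: hull_inc)
  have axis: "vector [a, 0] \<in> C" if "0 \<le> a" "a \<le> w + 1" for a
  proof -
    have "(1 - a / (w + 1)) *\<^sub>R 0 + (a / (w + 1)) *\<^sub>R R_orbit P (Suc 0) w \<in> C"
      using that w0 C(3)[of 1] i by (intro convexD_alt C) auto
    moreover have "(1 - a / (w + 1)) *\<^sub>R 0 + (a / (w + 1)) *\<^sub>R R_orbit P (Suc 0) w = vector [a, 0]"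
      using w0 by (simp add: R_orbit_1 vec2_eq_iff)
    ultimately show ?thesis by simp
  qed
  have "C \<subseteq> {Z. f_R P Z \<in> C}"
    unfolding C_def
  proof (rule hull_minimal)
    show "convex {Z. f_R P Z \<in> convex hull (insert 0 ((\<lambda>j. R_orbit P j w) ` {1..i}))}"
      using C(1) unfolding C_def[symmetric]
      by (auto simp: convex_alt f_R_combination)
    have "f_R P 0 = vector [1, 0]" by (simp add: vec2_eq_iff)
    then have "f_R P 0 \<in> C" using axis[of 1] w0 by simp
    moreover have "f_R P (R_orbit P j w) \<in> C" if j: "1 \<le> j" "j \<le> i" for j
    proof (cases "j = i")
      case True
      have "f_R P (R_orbit P i w) = vector [b + 1, 0]" using zero by (simp add: vec2_eq_iff b_def)
      then show ?thesis using True axis[of "b + 1"] b0 b1 w0 by simp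
    next
      case False
      then show ?thesis using C(3)[of "Suc j"] j by (simp add: R_orbit_Suc)
    qed
    ultimately show "insert 0 ((\<lambda>j. R_orbit P j w) ` {1..i})
        \<subseteq> {Z. f_R P Z \<in> convex hull (insert 0 ((\<lambda>j. R_orbit P j w) ` {1..i}))}"
      unfolding C_def[symmetric] by auto
  qed
  then have inv: "f_R P Z \<in> C" if "Z \<in> C" for Z using that by blast
  have nonneg: "C \<subseteq> {Z. 0 \<le> Z $ 1}"
    unfolding C_def
  proof (rule hull_minimal)
    show "convex {Z :: real^2. 0 \<le> Z $ 1}"
      by (auto simp: convex_alt intro!: add_nonneg_nonneg mult_nonneg_nonneg)
  qed (use right in auto)
  have "R_orbit P (Suc j) t \<in> C" for j
  proof (induction j)
    case 0
    then show ?case using axis[of "t + 1"] w t_nonneg by (simp add: R_orbit_1)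
  qed (simp add: R_orbit_Suc inv)
  moreover have "R_orbit P 0 t $ 1 = 0" by simp
  ultimately have "0 \<le> R_orbit P j t $ 1" for j using nonneg by (cases j) auto
  then show False using exits by (meson not_le)
qed

lemma return_switching:
  assumes "t \<le> w" "\<forall>j\<le>k. 0 \<le> R_orbit P j w $ 1" "R_orbit P (Suc k) w $ 1 = 0"
  obtains b where "b < - 1" "R_orbit P (Suc k) w = vector [0, b]"
    "crosses P k w b" "crosses P (Suc k) w b" "R_orbit P (Suc (Suc k)) w = vector [b + 1, 0]"
proof -
  define b where "b = R_orbit P (Suc k) w $ 2"
  have eq: "R_orbit P (Suc k) w = vector [0, b]" using assms(3) by (simp add: b_def vec2_eq_iff)
  have b: "b < - 1" unfolding b_def
    by (rule return_height) (use assms in \<open>auto simp: le_Suc_eq\<close>)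
  have "R_orbit P (Suc (Suc k)) w = vector [b + 1, 0]"
    by (simp add: R_orbit_Suc[of P "Suc k"] eq vec2_eq_iff)
  then show ?thesis using that b eq crosses_at_switching[OF assms(2) eq] by simp
qed

lemma not_both_switching:
  assumes "t \<le> w" "\<forall>j\<le>k. 0 \<le> R_orbit P j w $ 1"
  shows "R_orbit P k w $ 1 > 0 \<or> R_orbit P (Suc k) w $ 1 \<noteq> 0"
proof (rule ccontr)
  assume "\<not> ?thesis"
  then have z: "R_orbit P k w $ 1 = 0" "R_orbit P (Suc k) w $ 1 = 0"
    using assms(2) by (auto simp: not_less intro: antisym)
  show False
  proof (cases k)
    case 0
    then show ?thesis using z assms t_nonneg by (simp add: R_orbit_1)
  next
    case (Suc k')
    then have "R_orbit P k w $ 2 < - 1" using return_height[of w k] assms z by simp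
    then show ?thesis using z by (simp add: R_orbit_Suc)
  qed
qed

text \<open>Two orbits crossing at the same time: their points at times \<open>k\<close> and \<open>k + 1\<close> form a convex
  quadrilateral, oriented as at time \<open>0\<close> because the determinant is positive. Hence the lower start
  \<open>w1\<close> has the higher crossing, and bounds on the fan coordinate pass from one landing point
  to the other.\<close>

lemma crosses_same_time:
  assumes w: "t \<le> w1" "w1 \<le> w2"
    and c1: "crosses P k w1 b1" and c2: "crosses P k w2 b2"
  shows "b2 \<le> b1"
    and "c < - 1 \<Longrightarrow> c \<le> b2 \<Longrightarrow> b2 < - 1 \<Longrightarrow> 0 \<le> fan c (R_orbit P (Suc k) w2) \<Longrightarrow>
         0 \<le> fan c (R_orbit P (Suc k) w1)"
    and "c \<le> - 1 \<Longrightarrow> b1 \<le> c \<Longrightarrow> b1 < - 1 \<Longrightarrow> fan c (R_orbit P (Suc k) w1) \<le> 0 \<Longrightarrow>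
         fan c (R_orbit P (Suc k) w2) \<le> 0"
proof -
  let ?P1 = "R_orbit P k w1" and ?Q1 = "R_orbit P (Suc k) w1"
  let ?P2 = "R_orbit P k w2" and ?Q2 = "R_orbit P (Suc k) w2"
  have w0: "0 \<le> w1" "0 \<le> w2" using w t_nonneg by auto
  have A: "area ?P1 ?Q1 ?Q2 \<ge> 0" "area ?P1 ?Q1 ?P2 \<ge> 0" "area ?P1 ?Q2 ?P2 \<ge> 0" "area ?Q1 ?Q2 ?P2 \<ge> 0"
    unfolding R_orbit_area using w w0 delta_R_pos by simp_all
  obtain r1 where r1: "0 \<le> r1" "r1 \<le> 1" and V: "vector [0, b1] = (1 - r1) *\<^sub>R ?P1 + r1 *\<^sub>R ?Q1"
    using c1 by (auto simp: crosses_def)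
  obtain r2 where r2: "0 \<le> r2" "r2 \<le> 1" and U: "vector [0, b2] = (1 - r2) *\<^sub>R ?P2 + r2 *\<^sub>R ?Q2"
    using c2 by (auto simp: crosses_def)
  have fV: "vector [b1 + 1, 0] = f_R P (vector [0, b1])" and fU: "vector [b2 + 1, 0] = f_R P (vector [0, b2])"
    by (simp_all add: vec2_eq_iff)
  have x1: "0 \<le> ?P1 $ 1" "?Q1 $ 1 \<le> 0" and x2: "0 \<le> ?P2 $ 1" "?Q2 $ 1 \<le> 0"
    using c1 c2 by (auto simp: crosses_def)
  then have y: "?Q1 $ 2 \<le> 0" "?Q2 $ 2 \<le> 0"
    using delta_R_pos by (simp_all add: R_orbit_Suc)
  have "0 < ?P1 $ 1 \<or> ?Q1 $ 1 \<noteq> 0"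
    using not_both_switching w c1 by (auto simp: crosses_def)
  then have d: "0 < ?P1 $ 1 - ?Q1 $ 1" using x1 by auto
  have lin: "area A B ((1 - r) *\<^sub>R C + r *\<^sub>R D) = (1 - r) * area A B C + r * area A B D"
    "area A ((1 - r) *\<^sub>R C + r *\<^sub>R D) B = (1 - r) * area A C B + r * area A D B"
    "area ((1 - r) *\<^sub>R C + r *\<^sub>R D) A B = (1 - r) * area C A B + r * area D A B" for A B C D r
    by (simp_all add: area_def algebra_simps)
  have deg: "area A A B = 0" "area A B B = 0" "area A B A = 0" for A B
    by (simp_all add: area_def)
  show "b2 \<le> b1"
  proof -
    have "0 \<le> area ?P1 ?Q1 (vector [0, b2])" unfolding U lin using A r2 by simp
    moreover have "area ?P1 ?Q1 (vector [0, b1]) = 0" unfolding V lin by (simp add: deg)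
    moreover have "area ?P1 ?Q1 (vector [0, b2]) - area ?P1 ?Q1 (vector [0, b1])
        = (?P1 $ 1 - ?Q1 $ 1) * (b1 - b2)" by (simp add: area_def algebra_simps)
    ultimately have "0 \<le> (?P1 $ 1 - ?Q1 $ 1) * (b1 - b2)" by simp
    then show ?thesis using d by (simp add: zero_le_mult_iff)
  qed
  show "0 \<le> fan c ?Q1" if "c < - 1" "c \<le> b2" "b2 < - 1" "0 \<le> fan c ?Q2"
  proof (rule fan_above[OF that x1(2) y(1)])
    have "area ?Q2 ?P2 ?Q1 = area ?Q1 ?Q2 ?P2" by (simp add: area_def algebra_simps)
    then show "0 \<le> area ?Q2 (vector [0, b2]) ?Q1" unfolding U lin deg using A r2 by simp
    have "area ?P2 ?P1 ?Q2 = area ?P1 ?Q2 ?P2" by (simp add: area_def algebra_simps)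
    then have "0 \<le> area ?P2 ?P1 (vector [0, b2])" unfolding U lin deg using A r2 by simp
    then show "0 \<le> area ?Q2 ?Q1 (vector [b2 + 1, 0])"
      unfolding fU R_orbit_Suc area_f_R using delta_R_pos by simp
  qed
  show "fan c ?Q2 \<le> 0" if "c \<le> - 1" "b1 \<le> c" "b1 < - 1" "fan c ?Q1 \<le> 0"
  proof (rule fan_below[OF that x2(2) y(2)])
    show "0 \<le> area (vector [0, b1]) ?Q1 ?Q2" unfolding V lin deg using A r1 by simp
    have "0 \<le> area ?P1 (vector [0, b1]) ?P2" unfolding V lin deg using A r1 by simp
    then show "0 \<le> area ?Q1 (vector [b1 + 1, 0]) ?Q2"
      unfolding fV R_orbit_Suc area_f_R using delta_R_pos by simp
  qed
qed

text \<open>The comparison extends to different crossing times through the intermediate orbits that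
  hit the switching line.\<close>

lemma crosses_mono:
  assumes "t \<le> w1" "w1 \<le> w2" "crosses P k1 w1 b1" "crosses P k2 w2 b2"
  shows "b2 \<le> b1 \<and>
    (c < - 1 \<longrightarrow> c \<le> b2 \<longrightarrow> b2 < - 1 \<longrightarrow> 0 \<le> fan c (R_orbit P (Suc k2) w2) \<longrightarrow> 0 \<le> fan c (R_orbit P (Suc k1) w1)) \<and>
    (c \<le> - 1 \<longrightarrow> b1 \<le> c \<longrightarrow> b1 < - 1 \<longrightarrow> fan c (R_orbit P (Suc k1) w1) \<le> 0 \<longrightarrow> fan c (R_orbit P (Suc k2) w2) \<le> 0)"
  using assms
proof (induction "nat \<bar>int k1 - int k2\<bar>" arbitrary: w1 w2 k1 k2 b1 b2)
  case 0
  then show ?case using crosses_same_time(1)[of w1 w2 k1 b1 b2] crosses_same_time(2,3)[of w1 w2 k1 b1 b2 c]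
    by simp
next
  case (Suc d)
  show ?case
  proof (cases "k1 < k2")
    case True
    have p: "R_orbit P (Suc k1) w1 $ 1 \<le> 0 \<and> 0 \<le> R_orbit P (Suc k1) w2 $ 1"
      using Suc.prems True by (auto simp: crosses_def)
    obtain w where w: "w1 \<le> w" "w \<le> w2" "R_orbit P (Suc k1) w $ 1 = 0"
      using R_orbit_zero_between[of w1 w2 P "Suc k1"] Suc.prems(2) p by blast
    have tw: "t \<le> w" using w Suc.prems(1) by simp
    have st: "\<forall>j\<le>k1. 0 \<le> R_orbit P j w $ 1"
      using R_orbit_nonneg_between[OF w(1,2)] Suc.prems(3,4) True by (auto simp: crosses_def)
    obtain b where b: "b < - 1" "R_orbit P (Suc k1) w = vector [0, b]"
      "crosses P k1 w b" "crosses P (Suc k1) w b" "R_orbit P (Suc (Suc k1)) w = vector [b + 1, 0]"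
      using return_switching[OF tw st w(3)] by blast
    have "d = nat \<bar>int (Suc k1) - int k2\<bar>" using Suc.hyps(2) True by linarith
    from Suc.hyps(1)[OF this, of w w2 b b2] b w Suc.prems
    have IH: "b2 \<le> b"
      "c \<le> - 1 \<Longrightarrow> b \<le> c \<Longrightarrow> fan c (vector [b + 1, 0]) \<le> 0 \<Longrightarrow> fan c (R_orbit P (Suc k2) w2) \<le> 0"
      by auto
    note same = crosses_same_time[OF Suc.prems(1) w(1) Suc.prems(3) b(3)]
    show ?thesis
    proof (intro conjI impI)
      show "b2 \<le> b1" using same(1) IH by simp
      show "0 \<le> fan c (R_orbit P (Suc k1) w1)" if "c < - 1" "c \<le> b2"
        using same(2)[of c] that IH(1) b(1,2) fan_switching(1)[of c b] by simp
      show "fan c (R_orbit P (Suc k2) w2) \<le> 0" if "c \<le> - 1" "b1 \<le> c"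
        using IH(2) that same(1) fan_switching'(2)[of c b] by simp
    qed
  next
    case False
    then have less: "k2 < k1" using Suc.hyps(2) by linarith
    have p: "R_orbit P (Suc k2) w2 $ 1 \<le> 0 \<and> 0 \<le> R_orbit P (Suc k2) w1 $ 1"
      using Suc.prems less by (auto simp: crosses_def)
    obtain w where w: "w1 \<le> w" "w \<le> w2" "R_orbit P (Suc k2) w $ 1 = 0"
      using R_orbit_zero_between[of w1 w2 P "Suc k2"] Suc.prems(2) p by blast
    have tw: "t \<le> w" using w Suc.prems(1) by simp
    have st: "\<forall>j\<le>k2. 0 \<le> R_orbit P j w $ 1"
      using R_orbit_nonneg_between[OF w(1,2)] Suc.prems(3,4) less by (auto simp: crosses_def)
    obtain b where b: "b < - 1" "R_orbit P (Suc k2) w = vector [0, b]"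
      "crosses P k2 w b" "crosses P (Suc k2) w b" "R_orbit P (Suc (Suc k2)) w = vector [b + 1, 0]"
      using return_switching[OF tw st w(3)] by blast
    have "d = nat \<bar>int k1 - int (Suc k2)\<bar>" using Suc.hyps(2) less by linarith
    from Suc.hyps(1)[OF this, of w1 w b1 b] b w Suc.prems
    have IH: "b \<le> b1"
      "c < - 1 \<Longrightarrow> c \<le> b \<Longrightarrow> 0 \<le> fan c (vector [b + 1, 0]) \<Longrightarrow> 0 \<le> fan c (R_orbit P (Suc k1) w1)"
      by auto
    note same = crosses_same_time[OF tw w(2) b(3) Suc.prems(4)]
    show ?thesis
    proof (intro conjI impI)
      show "b2 \<le> b1" using same(1) IH by simp
      show "0 \<le> fan c (R_orbit P (Suc k1) w1)" if "c < - 1" "c \<le> b2"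
        using IH(2) that same(1) fan_switching(2)[of c b] by simp
      show "fan c (R_orbit P (Suc k2) w2) \<le> 0" if "c \<le> - 1" "b1 \<le> c"
        using same(3)[of c] that IH(1) b(1,2) fan_switching'(1)[of c b] by simp
    qed
  qed
qed

text \<open>An orbit that starts between two exiting ones exits by the time both of them have: while
  \<open>(0, w)\<close> stays, the exiting point \<open>o1\<close> can be moved towards \<open>w\<close> until its orbit hits the
  switching line, and it then exits exactly one step later than before.\<close>

lemma exit_aux:
  assumes w: "t \<le> w" "t \<le> o1" "t \<le> e"
    and btw: "o1 \<le> w \<and> w \<le> e \<or> e \<le> w \<and> w \<le> o1"
    and e: "R_orbit P (Suc m) e $ 1 < 0"
    and o1: "\<forall>j\<le>k. 0 \<le> R_orbit P j o1 $ 1" "R_orbit P (Suc k) o1 $ 1 < 0" "k \<le> m"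
  shows "\<exists>j\<le>Suc m. R_orbit P j w $ 1 < 0"
proof (rule ccontr)
  assume "\<not> ?thesis"
  then have stay: "\<forall>j\<le>Suc m. 0 \<le> R_orbit P j w $ 1" by (auto simp: not_less)
  show False
    using w(2) btw o1
  proof (induction "m - k" arbitrary: k o1)
    case 0
    then have "R_orbit P (Suc m) o1 $ 1 < 0" by simp
    then have "R_orbit P (Suc m) w $ 1 < 0"
      using R_orbit_neg_between[of o1 w e P "Suc m"] R_orbit_neg_between[of e w o1 P "Suc m"] 0 e by blast
    then show ?case using stay by (meson le_refl not_le)
  next
    case (Suc d)
    have k: "Suc k \<le> m" using Suc.hyps(2) by simp
    have wk: "0 \<le> R_orbit P j w $ 1" if "j \<le> Suc k" for j using that stay k by simp
    have "\<exists>w'. (w \<le> w' \<and> w' \<le> o1 \<or> o1 \<le> w' \<and> w' \<le> w) \<and> R_orbit P (Suc k) w' $ 1 = 0"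
    proof (cases "w \<le> o1")
      case True
      then show ?thesis
        using R_orbit_zero_between[of w o1 P "Suc k"] Suc.prems(4) wk[of "Suc k"] by (metis le_refl less_imp_le)
    next
      case False
      then show ?thesis
        using R_orbit_zero_between[of o1 w P "Suc k"] Suc.prems(4) wk[of "Suc k"]
        by (metis le_refl less_imp_le linear)
    qed
    then obtain w' where w': "w \<le> w' \<and> w' \<le> o1 \<or> o1 \<le> w' \<and> w' \<le> w" "R_orbit P (Suc k) w' $ 1 = 0"
      by blast
    have tw: "t \<le> w'" using w' w Suc.prems by auto
    have "0 \<le> R_orbit P j w' $ 1" if "j \<le> k" for j
      using that w'(1) R_orbit_nonneg_between[of w w' o1 P j] R_orbit_nonneg_between[of o1 w' w P j]
        wk Suc.prems by auto
    then have st: "\<forall>j\<le>k. 0 \<le> R_orbit P j w' $ 1" by blast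
    obtain b where b: "b < - 1" "R_orbit P (Suc (Suc k)) w' = vector [b + 1, 0]"
      using return_switching[OF tw st w'(2)] by blast
    show ?case
    proof (rule Suc.hyps(1)[of "Suc k" w'])
      show "w' \<le> w \<and> w \<le> e \<or> e \<le> w \<and> w \<le> w'"
        using w' Suc.prems(2) by auto
    qed (use tw st b k w'(2) Suc.hyps(2) in \<open>auto simp: le_Suc_eq\<close>)
  qed
qed

end


section \<open>The passage through the left half-plane\<close>

text \<open>\<open>pre_slope\<close> and \<open>pre_icpt\<close> describe the \<open>i\<close>-th preimage \<open>y = - a\<^sub>i x + c\<^sub>i\<close> of the switching line
  under the left piece, and \<open>img_icpt\<close> gives the height \<open>s\<^sub>i\<close> of the intersection of its \<open>i\<close>-th image
  with the switching line. The recursions are meant for \<open>i \<ge> 1\<close>; because \<open>x / 0 = 0\<close>, the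
  value \<open>0\<close> at \<open>i = 0\<close> gives the correct first terms \<open>a\<^sub>1 = \<tau>\<^sub>L\<close>, \<open>c\<^sub>1 = -1\<close> and \<open>s\<^sub>1 = 0\<close>.\<close>

primrec pre_slope :: "params \<Rightarrow> nat \<Rightarrow> real" where
  "pre_slope P 0 = 0"
| "pre_slope P (Suc i) = tau_L P - delta_L P / pre_slope P i"

primrec pre_icpt :: "params \<Rightarrow> nat \<Rightarrow> real" where
  "pre_icpt P 0 = 0"
| "pre_icpt P (Suc i) = pre_icpt P i / pre_slope P i - 1"

primrec img_icpt :: "params \<Rightarrow> nat \<Rightarrow> real" where
  "img_icpt P 0 = 0"
| "img_icpt P (Suc i) = delta_L P * (img_icpt P i + 1) / pre_slope P i"

lemma area_switching:
  "area W (vector [0, u]) (vector [u + 1, 0]) = u * W $ 1 + (u + 1) * W $ 2 - u * (u + 1)"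
  by (simp add: area_def algebra_simps)

lemma f_L_preimage:
  assumes "0 < delta_L P"
  obtains Z' where "f_L P Z' = Z" "Z' $ 1 = - (Z $ 2) / delta_L P"
proof (rule that[of "vector [- (Z $ 2) / delta_L P, Z $ 1 - 1 + tau_L P * Z $ 2 / delta_L P]"])
qed (use assms in \<open>simp_all add: vec2_eq_iff\<close>)

text \<open>The part of the closed first quadrant between two segments of the fan is covered by the
  segments in between. For \<open>t = 0\<close> the condition \<open>lower\<close> says nothing
  about the points of the horizontal axis; hence the condition \<open>axis\<close>.\<close>

lemma fan_covers:
  fixes W :: "real^2"
  assumes ts: "0 \<le> t" "t \<le> s" and W: "0 \<le> W $ 1" "0 \<le> W $ 2"
    and upper: "s * W $ 1 + (s + 1) * W $ 2 \<le> s * (s + 1)"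
    and lower: "t * (t + 1) \<le> t * W $ 1 + (t + 1) * W $ 2"
    and axis: "W $ 2 = 0 \<Longrightarrow> t + 1 \<le> W $ 1"
    and s: "0 < s"
  obtains w r where "t \<le> w" "w \<le> s" "0 \<le> r" "r \<le> 1"
    "W = (1 - r) *\<^sub>R vector [0, w] + r *\<^sub>R vector [w + 1, 0]"
proof (cases "W $ 2 = 0")
  case True
  have "s * W $ 1 \<le> s * (s + 1)" using upper True by simp
  then have "W $ 1 \<le> s + 1" using s by simp
  then show ?thesis using that[of "W $ 1 - 1" 1] axis True by (simp add: vec2_eq_iff)
next
  case False
  then have y: "0 < W $ 2" using W by simp
  define g where "g w = w * W $ 1 + (w + 1) * W $ 2 - w * (w + 1)" for w
  have "\<exists>w. t \<le> w \<and> w \<le> s \<and> g w = 0"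
    by (intro IVT2') (use ts upper lower in \<open>auto simp: g_def intro!: continuous_intros\<close>)
  then obtain w where w: "t \<le> w" "w \<le> s" "g w = 0" by blast
  define r where "r = W $ 1 / (w + 1)"
  have w0: "0 < w + 1" using w ts by simp
  have r0: "0 \<le> r" using W w0 by (simp add: r_def)
  have X: "W $ 1 = r * (w + 1)" using w0 by (simp add: r_def)
  have "(w + 1) * W $ 2 = (w + 1) * ((1 - r) * w)" using w(3) unfolding g_def X by (simp add: algebra_simps)
  then have Y: "W $ 2 = (1 - r) * w" using w0 by simp
  have "r \<le> 1"
  proof (rule ccontr)
    assume "\<not> r \<le> 1"
    then have "(1 - r) * w \<le> 0" using w ts by (simp add: mult_nonpos_nonneg)
    then show False using Y y by simp
  qed
  then show ?thesis using that[of w r] w r0 X Y by (simp add: vec2_eq_iff)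
qed

text \<open>The preimages of the switching line have negative slope \<open>- a\<^sub>i\<close> for \<open>i < N\<close>, as is the case when
  \<open>N \<le> p*\<close>.\<close>

locale left_passage =
  fixes P :: params and N :: nat
  assumes tau_L_pos: "0 < tau_L P" and delta_L_pos: "0 < delta_L P"
    and slope_pos: "\<And>i. 1 \<le> i \<Longrightarrow> i < N \<Longrightarrow> 0 < pre_slope P i"
begin

lemma left_step:
  assumes "1 \<le> i" "i < N"
  shows "pre_slope P (Suc i) < pre_slope P i \<and> pre_icpt P (Suc i) < pre_icpt P i \<and>
     img_icpt P i < img_icpt P (Suc i) \<and> pre_icpt P i \<le> - 1 \<and> 0 \<le> img_icpt P i"
  using assms
proof (induction i rule: dec_induct)
  case base
  then show ?case using slope_pos[of 1] tau_L_pos delta_L_pos by simp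
next
  case (step n)
  let ?a = "pre_slope P n" and ?b = "pre_slope P (Suc n)"
  let ?c = "pre_icpt P n" and ?s = "img_icpt P n"
  have ab: "0 < ?b" "?b < ?a" "0 < ?a" using slope_pos[of n] slope_pos[of "Suc n"] step by auto
  have c: "pre_icpt P (Suc n) < ?c" "?c < 0" and s: "?s < img_icpt P (Suc n)" "0 \<le> ?s"
    and cn: "pre_icpt P n \<le> - 1"
    using step by auto
  have "delta_L P / ?a < delta_L P / ?b" using ab delta_L_pos by (simp add: divide_strict_left_mono)
  moreover have "pre_icpt P (Suc n) / ?b < ?c / ?a"
  proof -
    have "pre_icpt P (Suc n) / ?b < ?c / ?b" using ab c by (simp add: divide_strict_right_mono)
    also have "\<dots> < ?c / ?a" using ab c by (simp add: divide_strict_left_mono_neg)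
    finally show ?thesis .
  qed
  moreover have "delta_L P * (?s + 1) / ?a < delta_L P * (img_icpt P (Suc n) + 1) / ?b"
    using ab s delta_L_pos by (intro frac_less2) auto
  moreover have "pre_slope P (Suc (Suc n)) = tau_L P - delta_L P / ?b" "?b = tau_L P - delta_L P / ?a"
    "pre_icpt P (Suc (Suc n)) = pre_icpt P (Suc n) / ?b - 1" "pre_icpt P (Suc n) = ?c / ?a - 1"
    "img_icpt P (Suc (Suc n)) = delta_L P * (img_icpt P (Suc n) + 1) / ?b"
    "img_icpt P (Suc n) = delta_L P * (?s + 1) / ?a"
    by simp_all
  ultimately show ?case using c s cn by (intro conjI; linarith)
qed

lemma left_mono:
  assumes "1 \<le> i" "i < j" "j \<le> N"
  shows "pre_slope P j < pre_slope P i" "pre_icpt P j < pre_icpt P i" "img_icpt P i < img_icpt P j"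
proof -
  have "pre_slope P j < pre_slope P i \<and> pre_icpt P j < pre_icpt P i \<and> img_icpt P i < img_icpt P j"
    using assms(2,3)
  proof (induction j)
    case (Suc j)
    then show ?case using left_step[of j] assms(1) by (cases "i = j") (auto simp del: pre_slope.simps pre_icpt.simps img_icpt.simps)
  qed simp
  then show "pre_slope P j < pre_slope P i" "pre_icpt P j < pre_icpt P i" "img_icpt P i < img_icpt P j"
    by auto
qed


declare pre_slope.simps(2) [simp del] pre_icpt.simps(2) [simp del] img_icpt.simps(2) [simp del]

lemma first_terms: "pre_slope P (Suc 0) = tau_L P" "pre_icpt P (Suc 0) = - 1" "img_icpt P (Suc 0) = 0"
  by (simp_all add: pre_slope.simps(2) pre_icpt.simps(2) img_icpt.simps(2))

lemma pre_icpt_le: "1 \<le> i \<Longrightarrow> i \<le> N \<Longrightarrow> pre_icpt P i \<le> - 1"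
  using left_mono(2)[of 1 i] first_terms by (cases "i = 1") auto

lemma pre_icpt_less: "2 \<le> i \<Longrightarrow> i \<le> N \<Longrightarrow> pre_icpt P i < - 1"
  using left_mono(2)[of 1 i] first_terms by auto

lemma img_icpt_nonneg: "1 \<le> i \<Longrightarrow> i \<le> N \<Longrightarrow> 0 \<le> img_icpt P i"
  using left_mono(3)[of 1 i] first_terms by (cases "i = 1") auto

lemma img_icpt_pos: "2 \<le> i \<Longrightarrow> i \<le> N \<Longrightarrow> 0 < img_icpt P i"
  using left_mono(3)[of 1 i] first_terms by auto

text \<open>The position of a point relative to the \<open>i\<close>-th preimage of the switching line tells the
  side on which its \<open>i\<close>-th image lies, and the position of the image relative to the image of the
  switching line tells the side from which it came.\<close>

lemma f_L_funpow_fst: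
  assumes "1 \<le> i" "i \<le> N"
  shows "\<exists>k>0. \<forall>Z. (f_L P ^^ i) Z $ 1 = k * (Z $ 2 + pre_slope P i * Z $ 1 - pre_icpt P i)"
  using assms
proof (induction i rule: dec_induct)
  case base
  then show ?case by (intro exI[of _ 1]) (simp add: first_terms)
next
  case (step n)
  then obtain k where k: "0 < k"
    "\<And>Z. (f_L P ^^ n) Z $ 1 = k * (Z $ 2 + pre_slope P n * Z $ 1 - pre_icpt P n)" by auto
  have a: "0 < pre_slope P n" using slope_pos step by simp
  have "(f_L P ^^ Suc n) Z $ 1
      = (k * pre_slope P n) * (Z $ 2 + pre_slope P (Suc n) * Z $ 1 - pre_icpt P (Suc n))" for Z
    using a by (simp add: funpow_Suc_right k(2) pre_slope.simps(2) pre_icpt.simps(2) field_simps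
        del: funpow.simps)
  then show ?case using k(1) a by (intro exI[of _ "k * pre_slope P n"]) simp
qed

lemma f_L_funpow_preimage:
  assumes "n < N"
  shows "\<exists>k>0. \<forall>Z. Z $ 1 =
    - k * ((f_L P ^^ Suc n) Z $ 2 + delta_L P / pre_slope P n * (f_L P ^^ Suc n) Z $ 1 - img_icpt P (Suc n))"
  using assms
proof (induction n)
  case 0
  then show ?case using delta_L_pos by (intro exI[of _ "1 / delta_L P"]) (simp add: first_terms)
next
  case (Suc n)
  then obtain k where k: "0 < k" and eq: "\<And>Z. Z $ 1 =
    - k * ((f_L P ^^ Suc n) Z $ 2 + delta_L P / pre_slope P n * (f_L P ^^ Suc n) Z $ 1 - img_icpt P (Suc n))"
    by auto
  define a where "a = pre_slope P (Suc n)"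
  have a: "0 < a" using slope_pos[of "Suc n"] Suc by (simp add: a_def)
  have an: "delta_L P / pre_slope P n = tau_L P - a" by (simp add: a_def pre_slope.simps(2))
  have s: "a * img_icpt P (Suc (Suc n)) = delta_L P * (img_icpt P (Suc n) + 1)"
    using a by (simp add: a_def img_icpt.simps(2)[of P "Suc n"])
  have "Z $ 1 = - (k * a / delta_L P) * ((f_L P ^^ Suc (Suc n)) Z $ 2
      + delta_L P / a * (f_L P ^^ Suc (Suc n)) Z $ 1 - img_icpt P (Suc (Suc n)))" for Z
  proof -
    define V where "V = (f_L P ^^ Suc n) Z"
    have W: "(f_L P ^^ Suc (Suc n)) Z = f_L P V" by (simp add: V_def)
    have "- (k * a / delta_L P) * (f_L P V $ 2 + delta_L P / a * f_L P V $ 1 - img_icpt P (Suc (Suc n)))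
        = - (k / delta_L P) * (a * f_L P V $ 2 + delta_L P * f_L P V $ 1 - a * img_icpt P (Suc (Suc n)))"
      using a delta_L_pos by (simp add: field_simps)
    also have "\<dots> = - k * (V $ 2 + (tau_L P - a) * V $ 1 - img_icpt P (Suc n))"
      unfolding s using delta_L_pos by (simp add: field_simps)
    also have "\<dots> = Z $ 1" using eq[of Z] unfolding an V_def[symmetric] by (rule sym)
    finally show ?thesis unfolding W by (rule sym)
  qed
  moreover have "0 < k * a / delta_L P" using k a delta_L_pos by simp
  ultimately show ?case unfolding a_def[symmetric] by blast
qed

lemma pre_line_eq:
  assumes "1 \<le> i" "i \<le> N"
  shows "pre_line P i = line_graph (- pre_slope P i) (pre_icpt P i)"
proof -
  obtain k where "0 < k"
    "\<And>Z. (f_L P ^^ i) Z $ 1 = k * (Z $ 2 + pre_slope P i * Z $ 1 - pre_icpt P i)"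
    using f_L_funpow_fst[OF assms] by blast
  then show ?thesis
    by (auto simp: pre_line_def line_graph_def switching_line_def)
qed

lemma f_L_funpow_switching:
  assumes "1 \<le> i" "i \<le> N"
  shows "(f_L P ^^ i) (vector [0, pre_icpt P i]) = vector [0, img_icpt P i]"
proof -
  let ?Z = "vector [0, pre_icpt P i] :: real^2"
  obtain k where k: "(f_L P ^^ i) ?Z $ 1 = k * (?Z $ 2 + pre_slope P i * ?Z $ 1 - pre_icpt P i)"
    using f_L_funpow_fst[OF assms] by blast
  obtain n where n: "i = Suc n" using assms by (cases i) auto
  obtain l where "0 < l" "?Z $ 1 = - l * ((f_L P ^^ Suc n) ?Z $ 2
      + delta_L P / pre_slope P n * (f_L P ^^ Suc n) ?Z $ 1 - img_icpt P (Suc n))"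
    using f_L_funpow_preimage[of n] assms n Suc_le_lessD by blast
  then show ?thesis using k unfolding n by (simp add: vec2_eq_iff del: funpow.simps)
qed

lemma f_L_funpow_switching_Suc:
  assumes "1 \<le> i" "i \<le> N"
  shows "(f_L P ^^ i) (vector [pre_icpt P i + 1, 0]) = vector [img_icpt P i + 1, 0]"
proof -
  have "vector [pre_icpt P i + 1, 0] = f_L P (vector [0, pre_icpt P i])" by (simp add: vec2_eq_iff)
  then have "(f_L P ^^ i) (vector [pre_icpt P i + 1, 0]) = f_L P ((f_L P ^^ i) (vector [0, pre_icpt P i]))"
    by (simp add: funpow_swap1)
  then show ?thesis using f_L_funpow_switching[OF assms] by (simp add: vec2_eq_iff)
qed

lemma area_f_L_funpow_switching:
  assumes "1 \<le> i" "i \<le> N"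
  shows "area ((f_L P ^^ i) Z) (vector [0, img_icpt P i]) (vector [img_icpt P i + 1, 0])
    = delta_L P ^ i * (pre_icpt P i * fan (pre_icpt P i) Z)"
  using area_f_L_funpow[of i P Z "vector [0, pre_icpt P i]" "vector [pre_icpt P i + 1, 0]"]
    pre_icpt_le[OF assms] area_fan[of "pre_icpt P i" Z]
  unfolding f_L_funpow_switching[OF assms] f_L_funpow_switching_Suc[OF assms] by simp

text \<open>The points between the two segments of the fan that end at \<open>(0, c\<^sub>m)\<close> and \<open>(0, c\<^sub>N)\<close> enter the
  right half-plane between the times \<open>m\<close> and \<open>N\<close>, and between the image segments.\<close>

lemma above_last_preimage:
  assumes N: "2 \<le> N" and Z: "Z $ 1 < 0" "0 \<le> fan (pre_icpt P N) Z"
  shows "0 < Z $ 2 + pre_slope P N * Z $ 1 - pre_icpt P N"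
proof -
  define c where "c = pre_icpt P N"
  obtain n where n: "N = Suc n" "1 \<le> n" using N by (cases N) auto
  define a where "a = pre_slope P n"
  have a: "0 < a" "pre_slope P N < a" using slope_pos[of n] left_mono(1)[of n N] n by (auto simp: a_def)
  have cn: "pre_icpt P n < 0" "c < pre_icpt P n" using pre_icpt_le[of n] left_mono(2)[of n N] n by (auto simp: c_def)
  have c: "c + 1 = pre_icpt P n / a" by (simp add: c_def n pre_icpt.simps(2) a_def)
  define m where "m = (c + 1) / c"
  have "c + 1 < 0" using cn a c by (simp add: divide_neg_pos)
  then have m: "0 < m" by (simp add: m_def zero_less_divide_iff)
  have "m * a = pre_icpt P n / c" using a c by (simp add: m_def)
  also have "\<dots> < 1" using cn by (simp add: divide_less_eq)
  finally have "m * pre_slope P N < 1" using mult_strict_left_mono[OF a(2) m] by simp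
  then have "0 < - (Z $ 1) * (1 - m * pre_slope P N)" using Z by (intro mult_pos_pos) auto
  also have "\<dots> \<le> m * Z $ 2 - m * c + m * pre_slope P N * Z $ 1"
    using Z(2) unfolding fan_eq c_def[symmetric] m_def[symmetric] by (simp add: algebra_simps)
  also have "\<dots> = m * (Z $ 2 + pre_slope P N * Z $ 1 - c)" by (simp add: algebra_simps)
  finally show ?thesis using m by (simp add: zero_less_mult_iff c_def)
qed

lemma below_earlier_preimages:
  assumes m: "1 \<le> i" "i < m" "m \<le> N" and Z: "Z $ 1 < 0" "Z $ 2 \<le> 0" "fan (pre_icpt P m) Z \<le> 0"
  shows "Z $ 2 + pre_slope P i * Z $ 1 - pre_icpt P i \<le> 0"
proof -
  define c where "c = pre_icpt P m"
  obtain n where n: "m = Suc n" "1 \<le> n" "i \<le> n" using m by (cases m) auto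
  define a where "a = pre_slope P n"
  define d where "d = pre_icpt P n"
  have a: "0 < a" using slope_pos[of n] n m by (auto simp: a_def)
  have d: "d < 0" "c < d" using pre_icpt_le[of n] left_mono(2)[of n m] n m by (auto simp: c_def d_def)
  have c: "c + 1 = d / a" by (simp add: c_def n pre_icpt.simps(2) a_def d_def)
  then have c1: "c + 1 < 0" using a d by (simp add: divide_neg_pos)
  have "Z $ 2 + a * Z $ 1 - d \<le> 0"
  proof (cases "c + 1 \<le> Z $ 1")
    case True
    have m0: "0 < (c + 1) / c" using c1 by (simp add: zero_less_divide_iff)
    have "(c + 1) / c * Z $ 2 \<le> (c + 1) / c * (c - c / (c + 1) * Z $ 1)"
    proof -
      have "(c + 1) / c * (c / (c + 1) * Z $ 1) = Z $ 1" using c1 by simp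
      then show ?thesis using Z(3) unfolding c_def[symmetric] fan_eq right_diff_distrib by linarith
    qed
    then have "Z $ 2 \<le> c - c / (c + 1) * Z $ 1" using m0 by (simp only: mult_le_cancel_left_pos)
    moreover have "c / (c + 1) = a * c / d" using c by simp
    ultimately have "Z $ 2 + a * Z $ 1 - d \<le> c - a * c / d * Z $ 1 + a * Z $ 1 - d" by simp
    also have "\<dots> = (d - c) * (Z $ 1 / (d / a) - 1)" using a d by (simp add: field_simps)
    also have "\<dots> \<le> 0"
    proof -
      have "Z $ 1 / (c + 1) \<le> 1" using True c1 by (simp add: divide_le_eq)
      then show ?thesis using d unfolding c by (intro mult_nonneg_nonpos) auto
    qed
    finally show ?thesis .
  next
    case False
    then have "a * Z $ 1 \<le> a * (d / a)" using a c by (intro mult_left_mono) auto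
    then show ?thesis using Z a by simp
  qed
  moreover have "a \<le> pre_slope P i" "d \<le> pre_icpt P i"
    using left_mono(1,2)[of i n] n m by (cases "i = n"; auto simp: a_def d_def)+
  moreover from this have "pre_slope P i * Z $ 1 \<le> a * Z $ 1" using Z by (simp add: mult_right_mono_neg)
  ultimately show ?thesis by linarith
qed

lemma left_entry:
  assumes m: "1 \<le> m" "m < N"
    and Z: "Z $ 1 < 0" "Z $ 2 \<le> 0" "0 \<le> fan (pre_icpt P N) Z" "fan (pre_icpt P m) Z \<le> 0"
  obtains p w r where "m \<le> p" "p \<le> N"
    "\<And>i. 1 \<le> i \<Longrightarrow> i < p \<Longrightarrow> (f_L P ^^ i) Z $ 1 \<le> 0 \<and> 0 < (f_L P ^^ i) Z $ 2"
    "0 < (f_L P ^^ p) Z $ 1"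
    "img_icpt P m \<le> w" "w \<le> img_icpt P N" "0 \<le> r" "r \<le> 1"
    "(f_L P ^^ p) Z = (1 - r) *\<^sub>R vector [0, w] + r *\<^sub>R vector [w + 1, 0]"
proof -
  have sgn: "0 < (f_L P ^^ i) Z $ 1 \<longleftrightarrow> 0 < Z $ 2 + pre_slope P i * Z $ 1 - pre_icpt P i"
    if i: "1 \<le> i" "i \<le> N" for i
  proof -
    obtain k where "0 < k" "(f_L P ^^ i) Z $ 1 = k * (Z $ 2 + pre_slope P i * Z $ 1 - pre_icpt P i)"
      using f_L_funpow_fst[OF i] by blast
    then show ?thesis by (simp add: zero_less_mult_iff)
  qed
  define p where "p = (LEAST i. 1 \<le> i \<and> 0 < (f_L P ^^ i) Z $ 1)"
  have N2: "2 \<le> N" using m by simp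
  have exN: "1 \<le> N \<and> 0 < (f_L P ^^ N) Z $ 1" using above_last_preimage[OF N2 Z(1,3)] sgn[of N] m by simp
  then have "1 \<le> p \<and> 0 < (f_L P ^^ p) Z $ 1" and pN: "p \<le> N"
    unfolding p_def by (rule LeastI, rule Least_le)
  then have p: "1 \<le> p" "0 < (f_L P ^^ p) Z $ 1" by auto
  have before: "(f_L P ^^ i) Z $ 1 \<le> 0" if "1 \<le> i" "i < p" for i
    using not_less_Least[of i "\<lambda>i. 1 \<le> i \<and> 0 < (f_L P ^^ i) Z $ 1"] that unfolding p_def[symmetric] by auto
  have mp: "m \<le> p"
  proof (rule ccontr)
    assume "\<not> m \<le> p"
    then show False using below_earlier_preimages[of p m Z] p m Z sgn[of p] by simp
  qed
  have le0: "(f_L P ^^ i) Z $ 1 \<le> 0" if "i < p" for i using before[of i] that Z(1) by (cases i) auto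
  have y_nonneg: "0 \<le> (f_L P ^^ i) Z $ 2" if "1 \<le> i" "i \<le> p" for i
    using that le0[of "i - 1"] delta_L_pos by (cases i) (auto simp: mult_le_0_iff)
  have not_zero: "(f_L P ^^ i) Z $ 1 < 0" if "Suc i < p" for i
  proof (cases i)
    case 0
    then show ?thesis using Z by simp
  next
    case (Suc j)
    have "(f_L P ^^ Suc i) Z $ 1 \<le> 0" using le0 that by blast
    moreover have "0 \<le> (f_L P ^^ i) Z $ 2" using y_nonneg[of i] Suc that by linarith
    ultimately have "tau_L P * (f_L P ^^ i) Z $ 1 < 0" by simp
    then show ?thesis using tau_L_pos by (simp add: mult_less_0_iff)
  qed
  have y_pos: "0 < (f_L P ^^ i) Z $ 2" if "1 \<le> i" "i < p" for i
    using not_zero[of "i - 1"] that delta_L_pos by (cases i) (auto simp: mult_less_0_iff)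
  define W where "W = (f_L P ^^ p) Z"
  define s where "s = img_icpt P N"
  define t where "t = img_icpt P m"
  have t0: "0 \<le> t" "t < s" using img_icpt_nonneg[of m] left_mono(3)[of m N] m by (auto simp: t_def s_def)
  have X: "0 < W $ 1" and Y: "0 \<le> W $ 2" using p y_nonneg[of p] by (auto simp: W_def)
  have slope_eq: "delta_L P / pre_slope P i = img_icpt P (Suc i) / (img_icpt P i + 1)"
    if "1 \<le> i" "i < N" for i
    using img_icpt_nonneg[of i] that by (simp add: img_icpt.simps(2))
  have upper: "s * W $ 1 + (s + 1) * W $ 2 \<le> s * (s + 1)"
  proof (cases "p = N")
    case True
    have "area W (vector [0, s]) (vector [s + 1, 0]) \<le> 0"
      using area_f_L_funpow_switching[of N Z] pre_icpt_le[of N] m Z(3) delta_L_pos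
      by (simp add: W_def s_def True mult_nonneg_nonpos mult_nonpos_nonneg)
    then show ?thesis by (simp add: area_switching)
  next
    case False
    then have pN': "p < N" using pN by simp
    \<comment> \<open>As \<open>Z\<close> is below the horizontal axis, its preimage \<open>Z'\<close> is right of the switching line, so that
      the image of \<open>Z'\<close> is below the line \<open>p + 1\<close>.\<close>
    obtain Z' where Z': "f_L P Z' = Z" "Z' $ 1 = - (Z $ 2) / delta_L P" using f_L_preimage[OF delta_L_pos, of Z] by blast
    have W': "(f_L P ^^ Suc p) Z' = W" using Z'(1) by (simp add: funpow_Suc_right W_def del: funpow.simps)
    define d where "d = img_icpt P p + 1"
    define sp where "sp = img_icpt P (Suc p)"
    have d: "0 < d" "d \<le> s + 1" using img_icpt_nonneg[of p] left_mono(3)[of p N] p pN' by (auto simp: d_def s_def)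
    have sp: "0 < sp" "sp \<le> s" using img_icpt_pos[of "Suc p"] left_mono(3)[of "Suc p" N] p pN'
      by (cases "Suc p = N"; auto simp: sp_def s_def)+
    obtain k where "0 < k" and k': "\<And>Z. Z $ 1 =
        - k * ((f_L P ^^ Suc p) Z $ 2 + delta_L P / pre_slope P p * (f_L P ^^ Suc p) Z $ 1 - sp)"
      using f_L_funpow_preimage[OF pN'] unfolding sp_def by blast
    then have k: "0 < k" "Z' $ 1 = - k * (W $ 2 + delta_L P / pre_slope P p * W $ 1 - sp)"
      using k'[of Z'] unfolding W' by blast+
    have "0 \<le> Z' $ 1" using Z' Z delta_L_pos by (simp add: divide_le_0_iff)
    then have "W $ 2 + delta_L P / pre_slope P p * W $ 1 \<le> sp"
      using k by (simp add: mult_le_0_iff)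
    then have "W $ 2 + sp / d * W $ 1 \<le> sp"
      using slope_eq[of p] p pN' by (simp add: sp_def d_def)
    then have le: "W $ 2 \<le> sp * (1 - W $ 1 / d)" by (simp add: algebra_simps)
    then have "0 \<le> 1 - W $ 1 / d" using Y sp(1) by (smt (verit) mult_pos_neg)
    then have "sp * (1 - W $ 1 / d) \<le> s * (1 - W $ 1 / d)" using sp by (intro mult_right_mono) auto
    also have "\<dots> \<le> s * (1 - W $ 1 / (s + 1))"
      using d X t0 by (intro mult_left_mono diff_mono divide_left_mono) auto
    finally have "W $ 2 \<le> s * (1 - W $ 1 / (s + 1))" using le by simp
    then have "(s + 1) * W $ 2 \<le> (s + 1) * (s * (1 - W $ 1 / (s + 1)))" using t0 by (intro mult_left_mono) auto
    also have "\<dots> = s * (s + 1) - s * W $ 1" using t0 by (simp add: field_simps)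
    finally show ?thesis by simp
  qed
  have lower: "t * (t + 1) \<le> t * W $ 1 + (t + 1) * W $ 2 \<and> (W $ 2 = 0 \<longrightarrow> t + 1 \<le> W $ 1)"
  proof (cases "p = m")
    case True
    have "0 \<le> area W (vector [0, t]) (vector [t + 1, 0])"
      using area_f_L_funpow_switching[of m Z] pre_icpt_le[of m] m Z(4) delta_L_pos
      by (simp add: W_def t_def True mult_nonpos_nonpos)
    then have 1: "t * (t + 1) \<le> t * W $ 1 + (t + 1) * W $ 2" by (simp add: area_switching)
    moreover have "t + 1 \<le> W $ 1" if 0: "W $ 2 = 0"
    proof -
      obtain n where n: "p = Suc n" using p by (cases p) auto
      have "(f_L P ^^ n) Z $ 1 = 0" using 0 delta_L_pos by (simp add: W_def n)
      then have "2 \<le> m" using True n Z(1) by (cases n) auto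
      then have "0 < t" using img_icpt_pos m by (simp add: t_def)
      then show ?thesis using 1 0 by simp
    qed
    ultimately show ?thesis by blast
  next
    case False
    then obtain n where n: "p = Suc n" "m \<le> n" using mp by (cases p) auto
    \<comment> \<open>As \<open>Z\<close> is left of the switching line, its image is above the line \<open>p\<close>.\<close>
    define d where "d = img_icpt P n + 1"
    define sp where "sp = img_icpt P p"
    have nN: "1 \<le> n" "n < N" using n m pN by auto
    have d: "0 < d" "t + 1 \<le> d" using img_icpt_nonneg[of n] left_mono(3)[of m n] nN m n
      by (cases "m = n"; auto simp: d_def t_def)+
    have sp: "0 < sp" "t \<le> sp" using img_icpt_pos[of p] left_mono(3)[of m p] nN m n pN by (auto simp: sp_def t_def)
    obtain k where k: "0 < k" "Z $ 1 = - k * (W $ 2 + delta_L P / pre_slope P n * W $ 1 - sp)"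
      using f_L_funpow_preimage[OF nN(2)] unfolding sp_def W_def n by blast
    then have "0 < W $ 2 + delta_L P / pre_slope P n * W $ 1 - sp"
      using Z(1) by (simp add: mult_less_0_iff zero_less_mult_iff)
    then have "sp < W $ 2 + sp / d * W $ 1"
      using slope_eq[of n] nN by (simp add: sp_def d_def n)
    then have gt: "sp * (1 - W $ 1 / d) < W $ 2" by (simp add: algebra_simps)
    show ?thesis
    proof (cases "d < W $ 1")
      case True
      then have "t * (t + 1 - W $ 1) \<le> 0" using d t0 by (intro mult_nonneg_nonpos) auto
      moreover have "0 \<le> (t + 1) * W $ 2" using t0 Y by simp
      ultimately show ?thesis using d True by (simp add: algebra_simps)
    next
      case False
      then have pos: "0 \<le> 1 - W $ 1 / d" using d by simp
      have "t * (1 - W $ 1 / (t + 1)) \<le> t * (1 - W $ 1 / d)"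
        using d X t0 by (intro mult_left_mono diff_mono divide_left_mono) auto
      also have "\<dots> \<le> sp * (1 - W $ 1 / d)" using sp pos by (intro mult_right_mono) auto
      finally have "t * (1 - W $ 1 / (t + 1)) \<le> W $ 2" using gt by simp
      then have "(t + 1) * (t * (1 - W $ 1 / (t + 1))) \<le> (t + 1) * W $ 2" using t0 by (intro mult_left_mono) auto
      moreover have "(t + 1) * (t * (1 - W $ 1 / (t + 1))) = t * (t + 1) - t * W $ 1" using t0 by (simp add: field_simps)
      moreover have "0 < W $ 2" using gt pos sp by (smt (verit) mult_nonneg_nonneg)
      ultimately show ?thesis by simp
    qed
  qed
  obtain w r where "t \<le> w" "w \<le> s" "0 \<le> r" "r \<le> 1" "W = (1 - r) *\<^sub>R vector [0, w] + r *\<^sub>R vector [w + 1, 0]"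
  proof (rule fan_covers[of t s W])
  qed (use t0 X Y upper lower in auto)
  then show ?thesis
    using that[of p w r] mp pN before y_pos p(2) unfolding W_def t_def s_def by blast
qed

end


section \<open>The corners of the trapping region\<close>

lemma line_graph_eq_iff: "line_graph m c = line_graph m' c' \<longleftrightarrow> m = m' \<and> c = c'"
proof
  assume eq: "line_graph m c = line_graph m' c'"
  have "vector [0, c] \<in> line_graph m c" "vector [1, m + c] \<in> line_graph m c"
    by (simp_all add: line_graph_def)
  then show "m = m' \<and> c = c'" unfolding eq by (simp add: line_graph_def)
qed simp

lemma p_star_left_passage:
  assumes "0 < tau_L P" "0 < delta_L P" and N: "enat N \<le> p_star P"
  shows "left_passage P N"
proof
  show "0 < pre_slope P i" if "1 \<le> i" "i < N" for i
    using that
  proof (induction i rule: less_induct)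
    case (less i)
    interpret left_passage P i by standard (use assms less in auto)
    have line: "pre_line P i = line_graph (- pre_slope P i) (pre_icpt P i)" using pre_line_eq less.prems by simp
    show ?case
    proof (rule ccontr)
      assume neg: "\<not> ?thesis"
      have "slope P i = - pre_slope P i" unfolding slope_def line by (auto simp: line_graph_eq_iff)
      then have "1 \<le> i \<and> non_vertical P i \<and> slope P i \<ge> 0"
        using neg less.prems line unfolding non_vertical_def by auto
      then have "p_star P \<le> enat i" unfolding p_star_def by (intro Inf_lower) auto
      then show False using N less.prems by (meson enat_ord_simps(2) le_less_trans not_le order_trans)
    qed
  qed
qed (use assms in auto)

lemma inj_bcmap:
  assumes "0 < delta_L P" "0 < delta_R P"
  shows "inj (bcmap P)"
proof (rule injI)
  fix Z W assume eq: "bcmap P Z = bcmap P W"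
  then have "bcmap P Z $ 2 = bcmap P W $ 2" "bcmap P Z $ 1 = bcmap P W $ 1" by simp_all
  moreover have "(bcmap P Z $ 2 \<ge> 0) = (Z $ 1 \<le> 0)" for Z
    using assms by (auto simp: bcmap_def zero_le_mult_iff mult_le_0_iff)
  ultimately have "(Z $ 1 \<le> 0) = (W $ 1 \<le> 0)" by metis
  then show "Z = W" using \<open>bcmap P Z $ 2 = _\<close> \<open>bcmap P Z $ 1 = _\<close> assms
    by (auto simp: bcmap_def vec2_eq_iff split: if_splits)
qed

context left_passage
begin

lemma intercept_eq:
  assumes "1 \<le> i" "i \<le> N"
  shows "intercept P i = pre_icpt P i"
  unfolding intercept_def pre_line_eq[OF assms] by (auto simp: line_graph_eq_iff)

text \<open>Up to and including time \<open>i + 1\<close> the orbit of the corner \<open>(0, c\<^sub>i)\<close> is governed by the left piece.\<close>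

lemma corner_orbit:
  assumes i: "1 \<le> i" "i \<le> N"
  shows "n < i \<Longrightarrow> 1 \<le> n \<Longrightarrow> (f_L P ^^ n) (sigma_point P i) $ 1 < 0"
    and "n \<le> Suc i \<Longrightarrow> (bcmap P ^^ n) (sigma_point P i) = (f_L P ^^ n) (sigma_point P i)"
    and "(f_L P ^^ Suc i) (sigma_point P i) = vector [img_icpt P i + 1, 0]"
    and "chi_L P (sigma_point P i) = Suc i"
    and "bcmap P (sigma_point P i) $ 1 = pre_icpt P i + 1"
proof -
  let ?X = "sigma_point P i"
  have X: "?X = vector [0, pre_icpt P i]" by (simp add: sigma_point_def intercept_eq[OF i])
  show "bcmap P ?X $ 1 = pre_icpt P i + 1" by (simp add: X bcmap_def)
  show neg: "(f_L P ^^ n) ?X $ 1 < 0" if n: "n < i" "1 \<le> n" for n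
  proof -
    have "n \<le> N" using n i by simp
    then obtain k where "0 < k" "(f_L P ^^ n) ?X $ 1 = k * (?X $ 2 + pre_slope P n * ?X $ 1 - pre_icpt P n)"
      using f_L_funpow_fst[of n] n by blast
    then show ?thesis using left_mono(2)[of n i] n i by (simp add: X mult_pos_neg)
  qed
  have fi: "(f_L P ^^ i) ?X = vector [0, img_icpt P i]" unfolding X by (rule f_L_funpow_switching[OF i])
  then show last: "(f_L P ^^ Suc i) ?X = vector [img_icpt P i + 1, 0]" by (simp add: vec2_eq_iff)
  have nonpos: "(f_L P ^^ n) ?X $ 1 \<le> 0" if "n \<le> i" for n
  proof -
    consider "n = 0" | "n = i" | "1 \<le> n" "n < i" using \<open>n \<le> i\<close> by linarith
    then show ?thesis by cases (use X fi neg[of n] in auto)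
  qed
  show bc: "(bcmap P ^^ n) ?X = (f_L P ^^ n) ?X" if "n \<le> Suc i" for n
    by (rule bcmap_funpow_L) (use that nonpos in auto)
  show "chi_L P ?X = Suc i"
    unfolding chi_L_def
  proof (rule Least_equality)
    show "1 \<le> Suc i \<and> (bcmap P ^^ Suc i) ?X \<notin> Pi_L"
      using bc[of "Suc i"] last img_icpt_nonneg[OF i] by (simp add: Pi_L_def del: funpow.simps)
    show "Suc i \<le> n" if "1 \<le> n \<and> (bcmap P ^^ n) ?X \<notin> Pi_L" for n
    proof (rule ccontr)
      assume "\<not> Suc i \<le> n"
      then show False using that bc[of n] nonpos[of n] by (simp add: Pi_L_def)
    qed
  qed
qed

lemma corner_exits:
  assumes i: "1 \<le> i" "i \<le> N" and pre: "bcmap P (sigma_point P i) \<in> Phi_pre P"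
  shows "\<exists>j. R_orbit P j (img_icpt P i) $ 1 < 0"
proof (rule ccontr)
  let ?X = "sigma_point P i"
  assume "\<not> ?thesis"
  then have right: "0 \<le> R_orbit P j (img_icpt P i) $ 1" for j by (simp add: not_less)
  obtain n where n: "1 \<le> n" "(bcmap P ^^ n) (bcmap P ?X) \<in> Phi" using pre by (auto simp: Phi_pre_def)
  then have n': "(bcmap P ^^ Suc n) ?X \<in> Phi" by (simp add: funpow_swap1)
  show False
  proof (cases "n < i")
    case True
    then have "(bcmap P ^^ Suc n) ?X = f_L P ((f_L P ^^ n) ?X)" using corner_orbit(2)[OF i, of "Suc n"] by simp
    then have "(bcmap P ^^ Suc n) ?X $ 2 > 0"
      using corner_orbit(1)[OF i True n(1)] delta_L_pos by (simp add: mult_less_0_iff)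
    then show False using n' by (simp add: Phi_def)
  next
    case False
    then obtain j where j: "Suc n = j + Suc i" by (metis add.commute le_Suc_ex not_less Suc_le_mono add_Suc_right)
    have "(bcmap P ^^ Suc n) ?X = (bcmap P ^^ j) ((bcmap P ^^ Suc i) ?X)"
      unfolding j funpow_add by (simp only: comp_def)
    also have "(bcmap P ^^ Suc i) ?X = vector [img_icpt P i + 1, 0]"
      using corner_orbit(2)[OF i, of "Suc i"] corner_orbit(3)[OF i] by (simp only: order_refl)
    also have "(bcmap P ^^ j) \<dots> = (f_R P ^^ j) \<dots>"
      by (rule bcmap_funpow_R) (use right[of "Suc _"] in \<open>simp add: R_orbit_Suc'\<close>)
    also have "\<dots> = R_orbit P (Suc j) (img_icpt P i)" by (simp add: R_orbit_Suc')
    finally show False using n' right[of "Suc j"] by (simp add: Phi_def del: funpow.simps)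
  qed
qed

text \<open>The quantities that the algorithm attaches to a corner, in terms of the orbit under the right
  piece that enters at \<open>(s\<^sub>i + 1, 0)\<close>.\<close>

lemma corner_passage:
  assumes i: "1 \<le> i" "i \<le> N" and pre: "bcmap P (sigma_point P i) \<in> Phi_pre P"
    and delta_R_pos: "0 < delta_R P"
  defines "q \<equiv> q_of P (sigma_point P i)" and "s \<equiv> img_icpt P i"
  obtains b where "1 \<le> q" "\<forall>j\<le>q. 0 \<le> R_orbit P j s $ 1" "R_orbit P (Suc q) s $ 1 < 0"
    "landing P (sigma_point P i) = R_orbit P (Suc q) s"
    "crosses P q s b" "crossing P (sigma_point P i) = vector [0, b]"
proof -
  let ?X = "sigma_point P i"
  let ?Y = "vector [s + 1, 0] :: real^2"
  have s0: "0 \<le> s" using img_icpt_nonneg[OF i] by (simp add: s_def)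
  define k where "k = (LEAST j. R_orbit P j s $ 1 < 0)"
  have k: "R_orbit P k s $ 1 < 0" and before: "\<And>j. j < k \<Longrightarrow> 0 \<le> R_orbit P j s $ 1"
    using corner_exits[OF i pre] LeastI_ex[of "\<lambda>j. R_orbit P j s $ 1 < 0"] not_less_Least
    unfolding k_def s_def[symmetric] by (blast, force)
  obtain n where n: "k = Suc n" "1 \<le> n"
  proof (cases k)
    case (Suc n)
    then show ?thesis using that[of n] k s0 by (cases n) (auto simp: R_orbit_1)
  qed (use k in simp)
  have Y: "(f_L P ^^ chi_L P ?X) ?X = ?Y"
    using corner_orbit(3,4)[OF i] by (simp only: s_def)
  have bc: "(bcmap P ^^ j) ?Y = R_orbit P (Suc j) s" if "j \<le> n" for j
    unfolding R_orbit_Suc'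
    by (rule bcmap_funpow_R) (use that before[of "Suc _"] n in \<open>simp add: R_orbit_Suc'\<close>)
  have q: "q = n"
    unfolding q_def q_of_def Y chi_R_def
  proof (rule Least_equality)
    show "1 \<le> n \<and> (bcmap P ^^ n) ?Y \<notin> Pi_R" using n k bc[of n] by (simp add: Pi_R_def)
    show "n \<le> j" if "1 \<le> j \<and> (bcmap P ^^ j) ?Y \<notin> Pi_R" for j
      using that bc[of j] before[of "Suc j"] n by (fastforce simp: Pi_R_def not_le)
  qed
  have land: "landing P ?X = R_orbit P (Suc q) s"
    unfolding landing_def Y q_def[symmetric] by (simp add: R_orbit_Suc')
  have stay: "\<forall>j\<le>q. 0 \<le> R_orbit P j s $ 1" and out: "R_orbit P (Suc q) s $ 1 < 0"
    using before k n q by auto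
  then obtain b where b: "crosses P q s b" using crosses_exists by blast
  have "bcmap P (R_orbit P q s) = landing P ?X" using stay by (simp add: land R_orbit_Suc bcmap_R)
  then have inv: "inv (bcmap P) (landing P ?X) = R_orbit P q s"
    using inj_bcmap[OF delta_L_pos delta_R_pos] by (metis inv_f_f)
  have "crossing P ?X = vector [0, b]"
    unfolding crossing_def inv unfolding land
  proof (rule the_equality)
    let ?A = "R_orbit P (Suc q) s" and ?B = "R_orbit P q s"
    obtain r where "vector [0, b] = (1 - r) *\<^sub>R ?B + r *\<^sub>R ?A"
      using b by (auto simp: crosses_def)
    then have r: "vector [0, b] = r *\<^sub>R ?A + (1 - r) *\<^sub>R ?B" by (simp add: add.commute)
    have "vector [0, b] \<in> affine hull {?A, ?B}"
      unfolding affine_hull_2 mem_Collect_eq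
      by (rule exI[of _ r], rule exI[of _ "1 - r"]) (use r in simp)
    moreover have "vector [0, b] \<in> switching_line" by (simp add: switching_line_def)
    ultimately show "vector [0, b] \<in> switching_line \<inter> affine hull {?A, ?B}" by blast
    fix W assume W: "W \<in> switching_line \<inter> affine hull {?A, ?B}"
    then obtain u where u: "W = u *\<^sub>R ?A + (1 - u) *\<^sub>R ?B" "W $ 1 = 0"
      by (auto simp: affine_hull_2 switching_line_def) (metis add_diff_cancel_left')
    have "(u - r) * (?A $ 1 - ?B $ 1) = W $ 1 - (vector [0, b] :: real^2) $ 1"
      unfolding u(1) r by (simp add: algebra_simps)
    then have "(u - r) * (?A $ 1 - ?B $ 1) = 0" using u(2) by simp
    moreover have "?A $ 1 - ?B $ 1 \<noteq> 0" using stay out by force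
    ultimately show "W = vector [0, b]" using u(1) r by simp
  qed
  then show ?thesis using that[of b] n q stay out land b by simp
qed

end

section \<open>The induced map on the trapping region\<close>

lemma segment_split:
  fixes A B :: "real^2"
  assumes "0 \<le> r" "r \<le> 1" "0 \<le> r1" "r1 \<le> 1"
  shows "r \<le> r1 \<Longrightarrow> \<exists>u. 0 \<le> u \<and> u \<le> 1 \<and>
      (1 - r) *\<^sub>R A + r *\<^sub>R B = (1 - u) *\<^sub>R A + u *\<^sub>R ((1 - r1) *\<^sub>R A + r1 *\<^sub>R B)"
    and "r1 \<le> r \<Longrightarrow> \<exists>u. 0 \<le> u \<and> u \<le> 1 \<and>
      (1 - r) *\<^sub>R A + r *\<^sub>R B = (1 - u) *\<^sub>R B + u *\<^sub>R ((1 - r1) *\<^sub>R A + r1 *\<^sub>R B)"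
proof -
  have *: "\<exists>u. 0 \<le> u \<and> u \<le> 1 \<and> x = u * y" if "0 \<le> x" "x \<le> y" for x y :: real
    using that by (cases "y = 0") (auto intro!: exI[of _ "x / y"])
  show "\<exists>u. 0 \<le> u \<and> u \<le> 1 \<and>
      (1 - r) *\<^sub>R A + r *\<^sub>R B = (1 - u) *\<^sub>R A + u *\<^sub>R ((1 - r1) *\<^sub>R A + r1 *\<^sub>R B)" if "r \<le> r1"
    using *[of r r1] assms that by (auto simp: vec2_eq_iff algebra_simps)
  have "r = 1 - u + u * r1" if "1 - r = u * (1 - r1)" for u using that by (simp add: algebra_simps)
  then show "\<exists>u. 0 \<le> u \<and> u \<le> 1 \<and>
      (1 - r) *\<^sub>R A + r *\<^sub>R B = (1 - u) *\<^sub>R B + u *\<^sub>R ((1 - r1) *\<^sub>R A + r1 *\<^sub>R B)" if "r1 \<le> r"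
    using *[of "1 - r" "1 - r1"] assms that by (fastforce simp: vec2_eq_iff algebra_simps)
qed

text \<open>The hypotheses on the parameters, with the outcome of the algorithm.\<close>

locale chaotic =
  fixes P :: params
  assumes tau_L_pos: "0 < tau_L P" and delta_L_pos: "0 < delta_L P" and delta_R_pos: "0 < delta_R P"
    and chaos: "algorithm P = CHAOS"
begin

lemma p_max_ok: "p_max_ok P (p_max P)"
  using chaos LeastI_ex[of "p_max_ok P"] unfolding algorithm_def p_max_def by (auto split: if_splits)

lemma p_min_ok: "p_min_ok P (p_min P)"
proof -
  have "\<exists>p. p_min_ok P p" using chaos unfolding algorithm_def by (auto split: if_splits)
  then show ?thesis unfolding p_min_def
    by (rule GreatestI_ex_nat[where b = "p_max P"]) (auto simp: p_min_ok_def)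
qed

lemma det_less: "(p, q) \<in> Gamma_set P \<Longrightarrow> det (M_mat P p q) < (1/4) * (trace (M_mat P p q))\<^sup>2"
  and unmixed: "unmixed P (Gamma_set P)"
  and dec_inc_exist: "(p, q) \<in> Gamma_set P \<Longrightarrow> dec_inc_exist P p q"
  and J_avoids: "(p, q) \<in> Gamma_set P \<Longrightarrow> J_set P \<inter> K_interval (theta_dec P p q) (theta_inc P p q) = {}"
  using chaos unfolding algorithm_def by (auto split: if_splits)

lemma p_min_less: "1 \<le> p_min P" "p_min P < p_max P"
  using p_min_ok by (auto simp: p_min_ok_def)

sublocale left_passage P "p_max P"
  by (rule p_star_left_passage[OF tau_L_pos delta_L_pos]) (use p_max_ok in \<open>simp add: p_max_ok_def\<close>)

lemma Omega_set_eq: "Omega_set P =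
   {Z. Z $ 1 < 0 \<and> Z $ 2 \<le> 0 \<and> 0 \<le> fan (pre_icpt P (p_max P)) Z \<and> fan (pre_icpt P (p_min P)) Z \<le> 0}"
  using p_min_less by (auto simp: Omega_set_def Phi_def fan_def intercept_eq)

text \<open>Points between a point \<open>V\<close> of the region and a crossing point \<open>(0, b)\<close>, or its image, are in the
  trapping region.\<close>

lemma Omega_segment:
  assumes b: "b < - 1" "pre_icpt P (p_max P) \<le> b" "b \<le> pre_icpt P (p_min P)"
    and V: "0 \<le> fan (pre_icpt P (p_max P)) V" "fan (pre_icpt P (p_min P)) V \<le> 0"
    and u: "0 \<le> u" "u \<le> 1" and Y: "Y = vector [0, b] \<or> Y = vector [b + 1, 0]"
    and W: "W = (1 - u) *\<^sub>R V + u *\<^sub>R Y" "W $ 1 < 0" "W $ 2 \<le> 0"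
  shows "W \<in> Omega_set P"
proof -
  have c: "pre_icpt P (p_max P) < - 1" "pre_icpt P (p_min P) \<le> - 1"
    using pre_icpt_less[of "p_max P"] pre_icpt_le[of "p_min P"] p_min_less by auto
  have "0 \<le> fan (pre_icpt P (p_max P)) Y" "fan (pre_icpt P (p_min P)) Y \<le> 0"
    using Y fan_switching[OF c(1) b(2)] fan_switching'[OF c(2) b(3)] by auto
  then have "0 \<le> fan (pre_icpt P (p_max P)) W" "fan (pre_icpt P (p_min P)) W \<le> 0"
    unfolding W(1) fan_combination using V u by (auto intro!: add_nonneg_nonneg add_nonpos_nonpos mult_nonneg_nonpos)
  then show ?thesis unfolding Omega_set_eq using W by simp
qed

text \<open>A point of the segment from \<open>(0, w)\<close> to its image moves in the right half-plane along the segments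
  joining successive points of the orbit of \<open>(0, w)\<close>. If that orbit crosses the switching line at time
  \<open>n\<close>, the point is across it at time \<open>n\<close> or at time \<open>n + 1\<close>, depending on its
  position on the segment.\<close>

lemma right_exit:
  assumes w: "img_icpt P (p_min P) \<le> w" "w \<le> img_icpt P (p_max P)" and r: "0 \<le> r" "r \<le> 1"
  defines "E \<equiv> \<lambda>j. (f_R P ^^ j) ((1 - r) *\<^sub>R vector [0, w] + r *\<^sub>R vector [w + 1, 0])"
  obtains q where "1 \<le> q" "q_min P \<le> q" "q \<le> q_max P" "\<And>j. j < q \<Longrightarrow> 0 \<le> E j $ 1" "E q \<in> Omega_set P"
proof -
  define t where "t = img_icpt P (p_min P)"
  define s where "s = img_icpt P (p_max P)"
  define c where "c = pre_icpt P (p_max P)"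
  define d where "d = pre_icpt P (p_min P)"
  let ?S = "sigma_point P (p_max P)" and ?T = "sigma_point P (p_min P)"
  let ?qS = "q_of P ?S" and ?qT = "q_of P ?T"
  note pm = p_min_less
  have iM: "1 \<le> p_max P" "p_max P \<le> p_max P" and im: "1 \<le> p_min P" "p_min P \<le> p_max P" using pm by auto
  have US: "cond_U P ?S" "cond_FS P ?S" and VT: "cond_V P ?T" "cond_FT P ?T"
    using p_max_ok p_min_ok by (auto simp: p_max_ok_def p_min_ok_def)
  have preS: "bcmap P ?S \<in> Phi_pre P" and preT: "bcmap P ?T \<in> Phi_pre P"
    using US VT by (auto simp: cond_U_def cond_V_def)
  obtain bS where S: "1 \<le> ?qS" "\<forall>j\<le>?qS. 0 \<le> R_orbit P j s $ 1" "R_orbit P (Suc ?qS) s $ 1 < 0"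
    "landing P ?S = R_orbit P (Suc ?qS) s" "crosses P ?qS s bS" "crossing P ?S = vector [0, bS]"
    using corner_passage[OF iM preS delta_R_pos] unfolding s_def by blast
  obtain bT where T: "1 \<le> ?qT" "\<forall>j\<le>?qT. 0 \<le> R_orbit P j t $ 1" "R_orbit P (Suc ?qT) t $ 1 < 0"
    "landing P ?T = R_orbit P (Suc ?qT) t" "crosses P ?qT t bT" "crossing P ?T = vector [0, bT]"
    using corner_passage[OF im preT delta_R_pos] unfolding t_def by blast
  have t0: "0 \<le> t" "t \<le> w" "w \<le> s" using img_icpt_nonneg[OF im] w by (auto simp: t_def s_def)
  have c: "c < - 1" "d \<le> - 1" using pre_icpt_less[of "p_max P"] pre_icpt_le[OF im] pm by (auto simp: c_def d_def)
  have bS: "c < bS" using US(1) S(6) by (simp add: cond_U_def sigma_point_def intercept_eq[OF iM] c_def)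
  have bT: "bT < d" using VT(1) T(6) by (simp add: cond_V_def sigma_point_def intercept_eq[OF im] d_def)
  have fS: "0 \<le> fan c (R_orbit P (Suc ?qS) s)"
  proof -
    let ?F = "R_orbit P (Suc ?qS) s"
    have "(c + 1) * ?F $ 2 + c * ?F $ 1 < (c + 1) * c"
      using US(2) corner_orbit(5)[OF iM] unfolding cond_FS_def S(4) by (simp add: sigma_point_def intercept_eq[OF iM] c_def)
    moreover have "c * fan c ?F = c * ?F $ 1 - (c + 1) * (c - ?F $ 2)"
      unfolding fan_def using c by (simp add: right_diff_distrib)
    ultimately have "c * fan c ?F < 0" by (simp add: algebra_simps)
    then show ?thesis using c by (simp add: mult_less_0_iff)
  qed
  have fT: "fan d (R_orbit P (Suc ?qT) t) \<le> 0"
  proof -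
    let ?F = "R_orbit P (Suc ?qT) t"
    have "(d + 1) * ?F $ 2 + d * ?F $ 1 > (d + 1) * d"
      using VT(2) corner_orbit(5)[OF im] unfolding cond_FT_def T(4) by (simp add: sigma_point_def intercept_eq[OF im] d_def)
    moreover have "d * fan d ?F = d * ?F $ 1 - (d + 1) * (d - ?F $ 2)"
      unfolding fan_def using c by (simp add: right_diff_distrib)
    ultimately have "0 < d * fan d ?F" by (simp add: algebra_simps)
    then show ?thesis using c by (simp add: zero_less_mult_iff)
  qed
  interpret right_passage P t
    by standard (use delta_R_pos t0 T(3) in auto)
  define m where "m = max ?qS ?qT"
  have "\<exists>j\<le>Suc m. R_orbit P j w $ 1 < 0"
  proof (cases "?qS \<le> ?qT")
    case True
    show ?thesis
      by (rule exit_aux[of w s t m ?qS]) (use t0 S T True in \<open>auto simp: m_def max_def\<close>)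
  next
    case False
    show ?thesis
      by (rule exit_aux[of w t s m ?qT]) (use t0 S T False in \<open>auto simp: m_def max_def\<close>)
  qed
  then obtain j0 where j0: "j0 \<le> Suc m" "R_orbit P j0 w $ 1 < 0" by blast
  \<comment> \<open>The orbit of \<open>(0, w)\<close> leaves the right half-plane at time \<open>k\<close>.\<close>
  define k where "k = (LEAST j. R_orbit P j w $ 1 < 0)"
  have k: "R_orbit P k w $ 1 < 0" "k \<le> Suc m"
    using LeastI[of "\<lambda>j. R_orbit P j w $ 1 < 0", OF j0(2)] Least_le[of "\<lambda>j. R_orbit P j w $ 1 < 0", OF j0(2)] j0(1)
    unfolding k_def by auto
  have before: "0 \<le> R_orbit P j w $ 1" if "j < k" for j
    using not_less_Least[OF that[unfolded k_def]] by simp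
  obtain n where n: "k = Suc n" "1 \<le> n"
  proof (cases k)
    case (Suc n)
    then show ?thesis using that[of n] k t0 by (cases n) (auto simp: R_orbit_1)
  qed (use k in simp)
  have nm: "n \<le> m" using k n by simp
  have "min ?qS ?qT < k"
  proof (rule ccontr)
    assume "\<not> ?thesis"
    then have "0 \<le> R_orbit P k w $ 1" using R_orbit_nonneg_between[of t w s P k] S(2) T(2) t0 by simp
    then show False using k(1) by simp
  qed
  then have nq: "q_min P \<le> n" using n by (simp add: q_min_def S_pt_def T_pt_def)
  have stay: "\<forall>j\<le>n. 0 \<le> R_orbit P j w $ 1" using before n by simp
  obtain b where b: "crosses P n w b" using crosses_exists[OF stay] k n by auto
  have mono1: "b \<le> bT" and land1: "fan d (R_orbit P k w) \<le> 0"
    using crosses_mono[OF order_refl t0(2) T(5) b, of d] bT c fT n by auto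
  have b1: "b < - 1" using mono1 bT c by simp
  have mono2: "bS \<le> b" using crosses_mono[OF t0(2,3) b S(5)] by blast
  have land2: "0 \<le> fan c (R_orbit P k w)"
    using crosses_mono[OF t0(2,3) b S(5), of c] bS c fS n mono2 b1 by auto
  have bc: "c \<le> b" "b \<le> d" using mono1 mono2 bS bT by auto
  have E: "E j = (1 - r) *\<^sub>R R_orbit P j w + r *\<^sub>R R_orbit P (Suc j) w" for j
    unfolding E_def f_R_funpow_combination R_orbit_Suc' by (simp add: R_orbit_def)
  have Enonneg: "0 \<le> E j $ 1" if "j < n" for j using that stay r by (simp add: E)
  have E2: "E (Suc j) $ 2 \<le> 0" if "0 \<le> E j $ 1" for j
    using that delta_R_pos by (simp add: E_def)
  obtain r1 where r1: "0 \<le> r1" "r1 \<le> 1" "vector [0, b] = (1 - r1) *\<^sub>R R_orbit P n w + r1 *\<^sub>R R_orbit P k w"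
    using b n by (auto simp: crosses_def)
  have diff: "E n $ 1 = (r - r1) * (R_orbit P k w $ 1 - R_orbit P n w $ 1)"
  proof -
    have "(1 - r1) * R_orbit P n w $ 1 + r1 * R_orbit P k w $ 1 = 0"
      using arg_cong[OF r1(3), of "\<lambda>Z. Z $ 1"] by simp
    then show ?thesis unfolding E n by (simp add: algebra_simps)
  qed
  have xneg: "R_orbit P k w $ 1 - R_orbit P n w $ 1 < 0" using k stay by (smt (verit) le_refl)
  show ?thesis
  proof (cases "E n $ 1 < 0")
    case True
    then have "r1 \<le> r" using xneg unfolding diff by (simp add: mult_less_0_iff)
    then obtain u where u: "0 \<le> u" "u \<le> 1" "E n = (1 - u) *\<^sub>R R_orbit P k w + u *\<^sub>R vector [0, b]"
      using segment_split(2)[OF r r1(1,2)] unfolding r1(3) E n by blast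
    obtain n' where n': "n = Suc n'" using n by (cases n) auto
    have "E n \<in> Omega_set P"
      by (rule Omega_segment[OF b1 _ _ land2[unfolded c_def] land1[unfolded d_def] u(1,2) _ u(3) True])
        (use bc E2[of n'] Enonneg[of n'] n' in \<open>auto simp: c_def d_def\<close>)
    then show ?thesis using that[of n] n nq nm Enonneg by (simp add: q_max_def m_def S_pt_def T_pt_def)
  next
    case False
    then have nonneg: "0 \<le> E n $ 1" by simp
    then have "r \<le> r1" using xneg unfolding diff by (simp add: zero_le_mult_iff)
    then obtain u where u: "0 \<le> u" "u \<le> 1" "E n = (1 - u) *\<^sub>R R_orbit P n w + u *\<^sub>R vector [0, b]"
      using segment_split(1)[OF r r1(1,2)] unfolding r1(3) E n by blast
    have fb: "f_R P (vector [0, b]) = vector [b + 1, 0]" by (simp add: vec2_eq_iff)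
    have eq: "E (Suc n) = (1 - u) *\<^sub>R R_orbit P k w + u *\<^sub>R vector [b + 1, 0]"
    proof -
      have "E (Suc n) = f_R P (E n)" by (simp add: E_def)
      then show ?thesis unfolding u(3) f_R_combination fb n R_orbit_Suc by simp
    qed
    have neg: "E (Suc n) $ 1 < 0"
    proof (cases "u = 0")
      case True
      then show ?thesis using k(1) unfolding eq by simp
    next
      case False
      then have "u * (b + 1) < 0" "(1 - u) * R_orbit P k w $ 1 \<le> 0"
        using u b1 k(1) by (auto simp: mult_pos_neg mult_nonneg_nonpos)
      then show ?thesis unfolding eq by simp
    qed
    have "E (Suc n) \<in> Omega_set P"
      by (rule Omega_segment[OF b1 _ _ land2[unfolded c_def] land1[unfolded d_def] u(1,2) _ eq neg])
        (use bc E2[of n] nonneg in \<open>auto simp: c_def d_def\<close>)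
    moreover have "0 \<le> E j $ 1" if "j < Suc n" for j using that Enonneg nonneg by (auto simp: less_Suc_eq)
    ultimately show ?thesis using that[of "Suc n"] n nq nm by (simp add: q_max_def m_def S_pt_def T_pt_def)
  qed
qed

lemma induced_return:
  assumes Z: "Z \<in> Omega_set P"
  obtains p q where "(p, q) \<in> Gamma_set P" "1 \<le> p" "1 \<le> q"
    "\<And>i. i < p \<Longrightarrow> (bcmap P ^^ i) Z $ 1 \<le> 0"
    "\<And>i. p \<le> i \<Longrightarrow> i < p + q \<Longrightarrow> 0 \<le> (bcmap P ^^ i) Z $ 1"
    "return_time P Z = p + q" "induced_map P Z \<in> Omega_set P"
proof -
  have Z': "Z $ 1 < 0" "Z $ 2 \<le> 0" "0 \<le> fan (pre_icpt P (p_max P)) Z" "fan (pre_icpt P (p_min P)) Z \<le> 0"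
    using Z unfolding Omega_set_eq by auto
  obtain p w r where p: "p_min P \<le> p" "p \<le> p_max P"
    and left: "\<And>i. 1 \<le> i \<Longrightarrow> i < p \<Longrightarrow> (f_L P ^^ i) Z $ 1 \<le> 0 \<and> 0 < (f_L P ^^ i) Z $ 2"
    and entry: "0 < (f_L P ^^ p) Z $ 1"
    and w: "img_icpt P (p_min P) \<le> w" "w \<le> img_icpt P (p_max P)" "0 \<le> r" "r \<le> 1"
    and W: "(f_L P ^^ p) Z = (1 - r) *\<^sub>R vector [0, w] + r *\<^sub>R vector [w + 1, 0]"
    by (rule left_entry[OF p_min_less Z']) blast
  obtain q where q: "1 \<le> q" "q_min P \<le> q" "q \<le> q_max P"
    and right: "\<And>j. j < q \<Longrightarrow> 0 \<le> (f_R P ^^ j) ((f_L P ^^ p) Z) $ 1"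
    and land: "(f_R P ^^ q) ((f_L P ^^ p) Z) \<in> Omega_set P"
    by (rule right_exit[OF w]) (unfold W, blast)
  have p1: "1 \<le> p" using p p_min_less by simp
  have le0: "(f_L P ^^ i) Z $ 1 \<le> 0" if "i < p" for i
    using left[of i] Z' that by (cases i) auto
  have bL: "(bcmap P ^^ i) Z = (f_L P ^^ i) Z" if "i \<le> p" for i
    by (rule bcmap_funpow_L) (use that le0 in auto)
  have bR: "(bcmap P ^^ (j + p)) Z = (f_R P ^^ j) ((f_L P ^^ p) Z)" if "j \<le> q" for j
    unfolding funpow_add comp_def bL[OF order_refl]
    by (rule bcmap_funpow_R) (use that right in auto)
  have land': "(bcmap P ^^ (p + q)) Z \<in> Omega_set P" using bR[of q] land by (simp add: add.commute)
  have nonneg: "0 \<le> (bcmap P ^^ i) Z $ 1" if "p \<le> i" "i < p + q" for i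
  proof -
    have "i - p < q" "i = (i - p) + p" using that by auto
    then show ?thesis using bR[of "i - p"] right by simp
  qed
  have rt: "return_time P Z = p + q"
    unfolding return_time_def
  proof (rule Least_equality)
    show "1 \<le> p + q \<and> (bcmap P ^^ (p + q)) Z \<in> Phi"
      using land' p1 unfolding Omega_set_def by auto
    fix i assume i: "1 \<le> i \<and> (bcmap P ^^ i) Z \<in> Phi"
    show "p + q \<le> i"
    proof (rule ccontr)
      assume "\<not> p + q \<le> i"
      then show False
        using nonneg[of i] left[of i] bL[of i] i by (cases "p \<le> i") (auto simp: Phi_def)
    qed
  qed
  show ?thesis
  proof (rule that[of p q])
    show "(p, q) \<in> Gamma_set P" using p q by (simp add: Gamma_set_def)
    show "induced_map P Z \<in> Omega_set P" unfolding induced_map_def rt by (rule land')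
  qed (use p1 q le0 bL nonneg rt in auto)
qed

end


section \<open>Directions in the plane and quadratic forms\<close>

lemma unit_dir_nth [simp]: "unit_dir t $ 1 = cos t" "unit_dir t $ 2 = sin t"
  by (simp_all add: unit_dir_def)

lemma norm_vec2: "norm (v :: real^2) = sqrt ((v $ 1)\<^sup>2 + (v $ 2)\<^sup>2)"
  by (simp add: norm_vec_def L2_set_def sum_2)

lemma norm_unit_dir [simp]: "norm (unit_dir t) = 1"
  by (simp add: norm_vec2)

lemma matrix_vector_nth2 [simp]:
  fixes M :: "real^2^2"
  shows "(M *v v) $ 1 = M $ 1 $ 1 * v $ 1 + M $ 1 $ 2 * v $ 2"
    and "(M *v v) $ 2 = M $ 2 $ 1 * v $ 1 + M $ 2 $ 2 * v $ 2"
  by (simp_all add: matrix_vector_mult_def sum_2)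

lemma det_trace2:
  fixes M :: "real^2^2"
  shows "det M = M $ 1 $ 1 * M $ 2 $ 2 - M $ 1 $ 2 * M $ 2 $ 1" "trace M = M $ 1 $ 1 + M $ 2 $ 2"
  by (simp_all add: det_2 trace_def sum_2)

lemma det_nonzero_mult:
  fixes M :: "real^2^2"
  assumes "det M \<noteq> 0" "v \<noteq> 0"
  shows "M *v v \<noteq> 0"
  using assms invertible_det_nz[of M] matrix_left_invertible_ker[of M] unfolding invertible_def by blast

lemma unit_dir_exists:
  fixes v :: "real^2"
  obtains r t where "t \<in> K_circle" "v = r *\<^sub>R unit_dir t" "r = 0 \<longleftrightarrow> v = 0"
proof (cases "v = 0")
  case True
  then show ?thesis using that[of 0 0] by (simp add: K_circle_def)
next
  case False
  define n where "n = norm v"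
  have n: "0 < n" using False by (simp add: n_def)
  have n2: "(v $ 1)\<^sup>2 + (v $ 2)\<^sup>2 = n\<^sup>2" by (simp add: n_def norm_vec2)
  have "(v $ 1 / n)\<^sup>2 + (v $ 2 / n)\<^sup>2 = ((v $ 1)\<^sup>2 + (v $ 2)\<^sup>2) / n\<^sup>2" by (simp add: power_divide add_divide_distrib)
  also have "\<dots> = 1" unfolding n2 using n by simp
  finally obtain t where t: "0 \<le> t" "t < 2 * pi" "v $ 1 / n = cos t" "v $ 2 / n = sin t"
    using sincos_total_2pi by metis
  have v: "v $ 1 = n * cos t" "v $ 2 = n * sin t" using t n by (auto simp: field_simps)
  show ?thesis
  proof (cases "t < pi")
    case True
    have "t \<in> K_circle" using True t by (simp add: K_circle_def)
    moreover have "v = n *\<^sub>R unit_dir t" using v by (simp add: vec2_eq_iff)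
    moreover have "n = 0 \<longleftrightarrow> v = 0" using n False by simp
    ultimately show ?thesis by (rule that)
  next
    case False
    have "t - pi \<in> K_circle" using False t by (simp add: K_circle_def)
    moreover have "v = - n *\<^sub>R unit_dir (t - pi)" using v by (simp add: vec2_eq_iff cos_diff sin_diff)
    moreover have "- n = 0 \<longleftrightarrow> v = 0" using n \<open>v \<noteq> 0\<close> by simp
    ultimately show ?thesis by (rule that)
  qed
qed

lemma sin_K_diff_zero:
  assumes "s \<in> K_circle" "t \<in> K_circle" "sin (s - t) = 0"
  shows "s = t"
  using sin_eq_0_pi[of "s - t"] assms by (simp add: K_circle_def)

lemma unit_dir_unique:
  assumes "s \<in> K_circle" "t \<in> K_circle" "r *\<^sub>R unit_dir s = r' *\<^sub>R unit_dir t" "r \<noteq> 0"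
  shows "s = t"
proof (rule sin_K_diff_zero[OF assms(1,2)])
  have "r * cos s = r' * cos t" "r * sin s = r' * sin t" using assms(3) by (simp_all add: vec2_eq_iff)
  then have "r * sin (s - t) = 0" unfolding sin_diff right_diff_distrib
    by (metis (no_types, opaque_lifting) diff_self mult.assoc mult.commute)
  then show "sin (s - t) = 0" using assms by simp
qed

text \<open>A binary quadratic form. Every closed interval of directions is the set where a suitable such
  form is nonnegative.\<close>

definition quad_form :: "real \<Rightarrow> real \<Rightarrow> real \<Rightarrow> real^2 \<Rightarrow> real" where
  "quad_form a b c v = a * (v $ 1)\<^sup>2 + b * (v $ 1 * v $ 2) + c * (v $ 2)\<^sup>2"

lemma quad_form_scale: "quad_form a b c (r *\<^sub>R v) = r\<^sup>2 * quad_form a b c v"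
  by (simp add: quad_form_def power_mult_distrib algebra_simps power2_eq_square)

text \<open>A quadratic form that is nonnegative at \<open>v\<close> and at \<open>x\<close> but negative at \<open>y\<close> stays nonnegative
  when the \<open>y\<close>-component of \<open>v\<close> is shortened.\<close>

lemma quad_form_contract:
  assumes x: "0 \<le> quad_form a b c x" and y: "quad_form a b c y < 0"
    and v: "0 \<le> quad_form a b c (\<alpha> *\<^sub>R x + \<beta> *\<^sub>R y)" and r: "0 \<le> r" "r \<le> 1"
  shows "0 \<le> quad_form a b c (\<alpha> *\<^sub>R x + (r * \<beta>) *\<^sub>R y)"
proof -
  define B where "B = 2 * a * x $ 1 * y $ 1 + b * (x $ 1 * y $ 2 + x $ 2 * y $ 1) + 2 * c * x $ 2 * y $ 2"
  have eq: "quad_form a b c (\<alpha> *\<^sub>R x + \<beta> *\<^sub>R y)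
      = \<alpha>\<^sup>2 * quad_form a b c x + \<alpha> * \<beta> * B + \<beta>\<^sup>2 * quad_form a b c y" for \<beta>
    by (simp add: quad_form_def B_def power2_eq_square algebra_simps)
  have "quad_form a b c (\<alpha> *\<^sub>R x + (r * \<beta>) *\<^sub>R y) = r * quad_form a b c (\<alpha> *\<^sub>R x + \<beta> *\<^sub>R y)
      + (1 - r) * (\<alpha>\<^sup>2 * quad_form a b c x) + r * (1 - r) * \<beta>\<^sup>2 * (- quad_form a b c y)"
    unfolding eq by (simp add: power2_eq_square algebra_simps)
  also have "\<dots> \<ge> 0" using assms by (intro add_nonneg_nonneg mult_nonneg_nonneg) auto
  finally show ?thesis .
qed

lemma sin_sign:
  assumes "- pi < x" "x < pi"
  shows "0 \<le> sin x \<longleftrightarrow> 0 \<le> x" "sin x \<le> 0 \<longleftrightarrow> x \<le> 0" "sin x = 0 \<longleftrightarrow> x = 0"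
  using sin_gt_zero[of x] sin_gt_zero[of "- x"] assms sin_eq_0_pi[of x] by (auto simp: not_le) (linarith | fastforce)+

text \<open>The form is \<open>\<plusminus> sin (t - t0) sin (t1 - t)\<close>, with the negative sign when the interval contains the
  point where \<open>0\<close> and \<open>\<pi>\<close> are identified.\<close>

lemma K_interval_quad_form:
  assumes "t0 \<in> K_circle" "t1 \<in> K_circle"
  obtains a b c where
    "\<And>t. t \<in> K_circle \<Longrightarrow> t \<in> K_interval t0 t1 \<longleftrightarrow> 0 \<le> quad_form a b c (unit_dir t)"
proof -
  define e where "e = (if t0 \<le> t1 then 1 else - 1 :: real)"
  have eq: "quad_form (e * - (sin t0 * sin t1)) (e * (cos t0 * sin t1 + sin t0 * cos t1))
      (e * - (cos t0 * cos t1)) (unit_dir t) = e * (sin (t - t0) * sin (t1 - t))" for t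
    by (simp add: quad_form_def sin_diff power2_eq_square algebra_simps)
  show ?thesis
  proof (rule that)
    fix t assume t: "t \<in> K_circle"
    have r: "- pi < t - t0" "t - t0 < pi" "- pi < t1 - t" "t1 - t < pi"
      using assms t by (auto simp: K_circle_def)
    note s = sin_sign[OF r(1,2)] sin_sign[OF r(3,4)]
    show "t \<in> K_interval t0 t1 \<longleftrightarrow> 0 \<le> quad_form (e * - (sin t0 * sin t1))
        (e * (cos t0 * sin t1 + sin t0 * cos t1)) (e * - (cos t0 * cos t1)) (unit_dir t)"
      unfolding eq K_interval_def using t s by (auto simp: e_def zero_le_mult_iff mult_le_0_iff)
  qed
qed


section \<open>The fixed points of the angle maps\<close>

text \<open>The map that an invertible matrix induces on the circle of directions, with values represented in
  \<open>[0, \<pi>)\<close>.\<close>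

definition angle_map :: "real^2^2 \<Rightarrow> real \<Rightarrow> real" where
  "angle_map M t = (THE s. s \<in> K_circle \<and> (\<exists>r. M *v unit_dir t = r *\<^sub>R unit_dir s))"

lemma G_map_eq: "G_map P p q = angle_map (M_mat P p q)"
  by (simp add: fun_eq_iff G_map_def angle_map_def)

lemma angle_map:
  assumes "det M \<noteq> 0"
  shows "angle_map M t \<in> K_circle" and "\<exists>r. r \<noteq> 0 \<and> M *v unit_dir t = r *\<^sub>R unit_dir (angle_map M t)"
proof -
  have nz: "M *v unit_dir t \<noteq> 0" by (rule det_nonzero_mult[OF assms]) (metis norm_unit_dir norm_zero zero_neq_one)
  obtain r s where "s \<in> K_circle" "M *v unit_dir t = r *\<^sub>R unit_dir s" using unit_dir_exists by metis
  moreover have "s' = s" if "s' \<in> K_circle" "M *v unit_dir t = r' *\<^sub>R unit_dir s'" for r' s'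
    using unit_dir_unique[of s' s r' r] that calculation nz by force
  ultimately have "\<exists>!s. s \<in> K_circle \<and> (\<exists>r. M *v unit_dir t = r *\<^sub>R unit_dir s)" by blast
  from theI'[OF this, folded angle_map_def]
  have "angle_map M t \<in> K_circle" "\<exists>r. M *v unit_dir t = r *\<^sub>R unit_dir (angle_map M t)" by blast+
  then show "angle_map M t \<in> K_circle"
    and "\<exists>r. r \<noteq> 0 \<and> M *v unit_dir t = r *\<^sub>R unit_dir (angle_map M t)"
    using nz scaleR_zero_left by metis+
qed

lemma angle_map_fixed_iff:
  assumes "det M \<noteq> 0" "t \<in> K_circle"
  shows "angle_map M t = t \<longleftrightarrow> (\<exists>r. M *v unit_dir t = r *\<^sub>R unit_dir t)"
proof
  assume "angle_map M t = t"
  then show "\<exists>r. M *v unit_dir t = r *\<^sub>R unit_dir t" using angle_map(2)[OF assms(1), of t] by metis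
next
  assume "\<exists>r. M *v unit_dir t = r *\<^sub>R unit_dir t"
  then show "angle_map M t = t"
    using angle_map[OF assms(1), of t] unit_dir_unique[of "angle_map M t" t] assms(2) by metis
qed

text \<open>At a fixed point with eigenvalue \<open>\<sigma>\<close> the derivative of the circle map is the ratio of the
  other eigenvalue to \<open>\<sigma>\<close>.\<close>

lemma angle_map_derivative_unique:
  assumes "det M \<noteq> 0" and eig: "M *v unit_dir t = \<sigma> *\<^sub>R unit_dir t" and t: "t \<in> K_circle"
    and D: "has_circle_derivative (angle_map M) D t"
  shows "\<sigma> * D = trace M - \<sigma>"
proof -
  obtain l where l: "\<And>s. \<exists>k::int. l s = angle_map M s + of_int k * pi" and dl: "(l has_real_derivative D) (at t)"
    using D by (auto simp: has_circle_derivative_def)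
  define F where "F s = (M $ 1 $ 1 * cos s + M $ 1 $ 2 * sin s) * sin (l s)
    - (M $ 2 $ 1 * cos s + M $ 2 $ 2 * sin s) * cos (l s)" for s
  have F0: "F s = 0" for s
  proof -
    obtain k :: int where k: "l s = angle_map M s + of_int k * pi" using l by blast
    obtain r where "M *v unit_dir s = r *\<^sub>R unit_dir (angle_map M s)" using angle_map(2)[OF assms(1)] by blast
    then have "M $ 1 $ 1 * cos s + M $ 1 $ 2 * sin s = r * cos (angle_map M s)"
      "M $ 2 $ 1 * cos s + M $ 2 $ 2 * sin s = r * sin (angle_map M s)" by (simp_all add: vec2_eq_iff)
    then show ?thesis unfolding F_def k by (simp add: sin_add cos_add algebra_simps)
  qed
  have e: "M $ 1 $ 1 * cos t + M $ 1 $ 2 * sin t = \<sigma> * cos t"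
    "M $ 2 $ 1 * cos t + M $ 2 $ 2 * sin t = \<sigma> * sin t"
    using eig by (simp_all add: vec2_eq_iff)
  have "(F has_real_derivative
      ((- M $ 1 $ 1 * sin t + M $ 1 $ 2 * cos t) * sin (l t) + (\<sigma> * cos t) * (cos (l t) * D)
      - ((- M $ 2 $ 1 * sin t + M $ 2 $ 2 * cos t) * cos (l t) - (\<sigma> * sin t) * (sin (l t) * D)))) (at t)"
    unfolding F_def by (rule derivative_eq_intros dl refl)+ (simp add: e[symmetric] algebra_simps)
  moreover have "(F has_real_derivative 0) (at t)" unfolding F0[abs_def] by simp
  ultimately have 0: "(- M $ 1 $ 1 * sin t + M $ 1 $ 2 * cos t) * sin (l t) + (\<sigma> * cos t) * (cos (l t) * D)
      - ((- M $ 2 $ 1 * sin t + M $ 2 $ 2 * cos t) * cos (l t) - (\<sigma> * sin t) * (sin (l t) * D)) = 0"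
    by (rule DERIV_unique)
  obtain k :: int where k: "l t = t + of_int k * pi"
    using l[of t] angle_map_fixed_iff[OF assms(1) t] eig by metis
  define c where "c = cos (of_int k * pi)"
  have sk: "sin (of_int k * pi) = 0" by (simp add: sin_times_pi_eq_0)
  then have c: "c \<noteq> 0" using sin_zero_norm_cos_one[OF sk] by (auto simp: c_def)
  have sl: "sin (l t) = c * sin t" "cos (l t) = c * cos t"
    unfolding k by (simp_all add: sin_add cos_add c_def sk)
  have "c * ((- M $ 1 $ 1 * sin t + M $ 1 $ 2 * cos t) * sin t
      - (- M $ 2 $ 1 * sin t + M $ 2 $ 2 * cos t) * cos t + \<sigma> * D * ((cos t)\<^sup>2 + (sin t)\<^sup>2)) = 0"
    using 0 unfolding sl by algebra
  then have "\<sigma> * D = (- M $ 2 $ 1 * sin t + M $ 2 $ 2 * cos t) * cos t - (- M $ 1 $ 1 * sin t + M $ 1 $ 2 * cos t) * sin t"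
    using c by simp
  also have "\<dots> = (M $ 1 $ 1 + M $ 2 $ 2) * ((cos t)\<^sup>2 + (sin t)\<^sup>2)
      - ((M $ 1 $ 1 * cos t + M $ 1 $ 2 * sin t) * cos t + (M $ 2 $ 1 * cos t + M $ 2 $ 2 * sin t) * sin t)"
    by algebra
  also have "\<dots> = (M $ 1 $ 1 + M $ 2 $ 2) * ((cos t)\<^sup>2 + (sin t)\<^sup>2) - \<sigma> * ((cos t)\<^sup>2 + (sin t)\<^sup>2)"
    unfolding e by algebra
  finally show ?thesis by (simp add: det_trace2)
qed

lemma angle_map_derivative_exists:
  assumes "det M \<noteq> 0" and eig: "M *v unit_dir t = \<sigma> *\<^sub>R unit_dir t" and l0: "\<sigma> \<noteq> 0" and t: "t \<in> K_circle"
  shows "has_circle_derivative (angle_map M) ((trace M - \<sigma>) / \<sigma>) t"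
proof -
  define X where "X s = M $ 1 $ 1 * cos s + M $ 1 $ 2 * sin s" for s
  define Y where "Y s = M $ 2 $ 1 * cos s + M $ 2 $ 2 * sin s" for s
  define n where "n s = cos t * Y s - sin t * X s" for s
  define d where "d s = cos t * X s + sin t * Y s" for s
  \<comment> \<open>a lift of the circle map near \<open>t\<close>, where \<open>d\<close> does not vanish\<close>
  define l where "l s = (if d s \<noteq> 0 then t + arctan (n s / d s) else angle_map M s)" for s
  have Mu: "X s = (M *v unit_dir s) $ 1" "Y s = (M *v unit_dir s) $ 2" for s by (simp_all add: X_def Y_def)
  have e: "X t = \<sigma> * cos t" "Y t = \<sigma> * sin t" unfolding Mu eig by simp_all
  have nt: "n t = 0" by (simp add: n_def e)
  have "d t = \<sigma> * ((cos t)\<^sup>2 + (sin t)\<^sup>2)" unfolding d_def e by (simp only: power2_eq_square) algebra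
  then have dt: "d t = \<sigma>" by simp
  have lift: "\<exists>k::int. l s = angle_map M s + of_int k * pi" for s
  proof (cases "d s = 0")
    case True
    then show ?thesis by (intro exI[of _ 0]) (simp add: l_def)
  next
    case False
    obtain r where r: "r \<noteq> 0" "M *v unit_dir s = r *\<^sub>R unit_dir (angle_map M s)"
      using angle_map(2)[OF assms(1)] by blast
    define g where "g = angle_map M s"
    define \<phi> where "\<phi> = arctan (n s / d s)"
    have XY: "X s = r * cos g" "Y s = r * sin g" unfolding Mu r(2) by (simp_all add: g_def)
    have nd: "n s = r * sin (g - t)" "d s = r * cos (g - t)"
      unfolding n_def d_def XY by (simp_all add: sin_diff cos_diff algebra_simps)
    have c: "cos \<phi> \<noteq> 0" by (simp add: \<phi>_def)
    have "tan \<phi> = n s / d s" unfolding \<phi>_def by (rule tan_arctan)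
    then have "sin \<phi> * d s = n s * cos \<phi>" using False c by (simp add: tan_def field_simps)
    then have "r * sin (\<phi> - (g - t)) = 0" unfolding nd sin_diff[of \<phi>] by (simp add: algebra_simps)
    then have "sin (\<phi> - (g - t)) = 0" using r by simp
    then obtain k :: int where "\<phi> - (g - t) = of_int k * pi" using sin_zero_iff_int2 by metis
    then show ?thesis using False by (intro exI[of _ k]) (simp add: l_def \<phi>_def g_def)
  qed
  have dn: "(n has_real_derivative (cos t * (- M $ 2 $ 1 * sin t + M $ 2 $ 2 * cos t)
      - sin t * (- M $ 1 $ 1 * sin t + M $ 1 $ 2 * cos t))) (at t)"
    unfolding n_def X_def Y_def by (rule derivative_eq_intros refl)+ (simp add: algebra_simps)
  have "cos t * (- M $ 2 $ 1 * sin t + M $ 2 $ 2 * cos t) - sin t * (- M $ 1 $ 1 * sin t + M $ 1 $ 2 * cos t)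
      = (M $ 1 $ 1 + M $ 2 $ 2) * ((cos t)\<^sup>2 + (sin t)\<^sup>2) - (X t * cos t + Y t * sin t)"
    unfolding X_def Y_def by algebra
  also have "X t * cos t + Y t * sin t = \<sigma> * ((cos t)\<^sup>2 + (sin t)\<^sup>2)"
    unfolding e by algebra
  finally have "cos t * (- M $ 2 $ 1 * sin t + M $ 2 $ 2 * cos t)
      - sin t * (- M $ 1 $ 1 * sin t + M $ 1 $ 2 * cos t) = trace M - \<sigma>"
    by (simp add: det_trace2)
  with dn have dn': "(n has_real_derivative trace M - \<sigma>) (at t)" by simp
  define d' where "d' = cos t * (- M $ 1 $ 1 * sin t + M $ 1 $ 2 * cos t) + sin t * (- M $ 2 $ 1 * sin t + M $ 2 $ 2 * cos t)"
  have dd: "(d has_real_derivative d') (at t)"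
    unfolding d_def X_def Y_def d'_def by (rule derivative_eq_intros refl)+ (simp add: algebra_simps)
  have d0: "((\<lambda>s. t + arctan (n s / d s)) has_real_derivative (trace M - \<sigma>) / \<sigma>) (at t)"
    by (rule derivative_eq_intros dn' dd refl)+ (use l0 in \<open>simp_all add: nt dt\<close>)
  have ev: "\<forall>\<^sub>F s in nhds t. l s = t + arctan (n s / d s)"
  proof -
    have "isCont d t" using dd by (rule DERIV_isCont)
    then have "\<forall>\<^sub>F s in at t. d s \<noteq> 0"
      using dt l0 unfolding isCont_def by (metis tendsto_imp_eventually_ne)
    then have "\<forall>\<^sub>F s in nhds t. d s \<noteq> 0" using dt l0 by (simp add: eventually_nhds_conv_at)
    then show ?thesis by eventually_elim (simp add: l_def)
  qed
  have "(l has_real_derivative (trace M - \<sigma>) / \<sigma>) (at t)"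
    using d0 DERIV_cong_ev[OF refl ev refl] by blast
  then show ?thesis unfolding has_circle_derivative_def using lift by blast
qed

lemma eigen_direction_exists:
  fixes M :: "real^2^2"
  assumes "\<sigma>\<^sup>2 - trace M * \<sigma> + det M = 0"
  obtains t where "t \<in> K_circle" "M *v unit_dir t = \<sigma> *\<^sub>R unit_dir t"
proof -
  define A where "A = M - \<sigma> *\<^sub>R mat 1"
  have An: "A $ 1 $ 1 = M $ 1 $ 1 - \<sigma>" "A $ 1 $ 2 = M $ 1 $ 2" "A $ 2 $ 1 = M $ 2 $ 1" "A $ 2 $ 2 = M $ 2 $ 2 - \<sigma>"
    by (simp_all add: A_def mat_def)
  have "det A = \<sigma>\<^sup>2 - trace M * \<sigma> + det M"
    by (simp add: det_trace2 An power2_eq_square algebra_simps)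
  then have "det A = 0" using assms by simp
  then obtain v where v: "v \<noteq> 0" "A *v v = 0"
    using invertible_det_nz[of A] matrix_left_invertible_ker[of A] invertible_left_inverse[of A] by auto
  obtain r t where rt: "t \<in> K_circle" "v = r *\<^sub>R unit_dir t" "r \<noteq> 0" using unit_dir_exists v(1) by metis
  have "r *\<^sub>R (A *v unit_dir t) = 0" using v(2) unfolding rt(2) by (simp add: matrix_vector_mult_scaleR)
  then have "A *v unit_dir t = 0" using rt(3) by simp
  then have "M *v unit_dir t = \<sigma> *\<^sub>R unit_dir t" by (simp add: vec2_eq_iff An algebra_simps)
  then show ?thesis using that rt(1) by blast
qed

lemma eigenvalue_root:
  fixes M :: "real^2^2"
  assumes "M *v unit_dir t = \<sigma> *\<^sub>R unit_dir t"
  shows "\<sigma>\<^sup>2 - trace M * \<sigma> + det M = 0"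
proof -
  have e: "(M $ 1 $ 1 - \<sigma>) * cos t = - M $ 1 $ 2 * sin t" "(M $ 2 $ 2 - \<sigma>) * sin t = - M $ 2 $ 1 * cos t"
    using assms by (simp_all add: vec2_eq_iff algebra_simps)
  define p where "p = \<sigma>\<^sup>2 - trace M * \<sigma> + det M"
  have p: "p = (M $ 1 $ 1 - \<sigma>) * (M $ 2 $ 2 - \<sigma>) - M $ 1 $ 2 * M $ 2 $ 1"
    by (simp add: p_def det_trace2 power2_eq_square algebra_simps)
  have "p * cos t = (M $ 2 $ 2 - \<sigma>) * ((M $ 1 $ 1 - \<sigma>) * cos t) - M $ 1 $ 2 * (M $ 2 $ 1 * cos t)"
    unfolding p by (simp add: algebra_simps)
  also have "\<dots> = - M $ 1 $ 2 * ((M $ 2 $ 2 - \<sigma>) * sin t) - M $ 1 $ 2 * (M $ 2 $ 1 * cos t)"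
    unfolding e(1) by (simp add: algebra_simps)
  also have "\<dots> = 0" unfolding e(2) by simp
  finally have pc: "p * cos t = 0" .
  have "p * sin t = (M $ 1 $ 1 - \<sigma>) * ((M $ 2 $ 2 - \<sigma>) * sin t) - M $ 2 $ 1 * (M $ 1 $ 2 * sin t)"
    unfolding p by (simp add: algebra_simps)
  also have "\<dots> = - M $ 2 $ 1 * ((M $ 1 $ 1 - \<sigma>) * cos t) - M $ 2 $ 1 * (M $ 1 $ 2 * sin t)"
    unfolding e(2) by (simp add: algebra_simps)
  also have "\<dots> = 0" unfolding e(1) by simp
  finally have ps: "p * sin t = 0" .
  have "p * ((cos t)\<^sup>2 + (sin t)\<^sup>2) = p * cos t * cos t + p * sin t * sin t"
    by algebra
  then have "p = 0" using pc ps by simp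
  then show ?thesis by (simp add: p_def)
qed

lemma eigen_direction_unique:
  fixes M :: "real^2^2"
  assumes "M *v unit_dir t = \<sigma> *\<^sub>R unit_dir t" "M *v unit_dir t' = \<sigma> *\<^sub>R unit_dir t'"
    and K: "t \<in> K_circle" "t' \<in> K_circle" and tr: "trace M \<noteq> 2 * \<sigma>"
  shows "t = t'"
proof (rule ccontr)
  assume "t \<noteq> t'"
  then have s: "sin (t' - t) \<noteq> 0" using sin_K_diff_zero K by metis
  have e: "(M $ 1 $ 1 - \<sigma>) * cos t + M $ 1 $ 2 * sin t = 0" "M $ 2 $ 1 * cos t + (M $ 2 $ 2 - \<sigma>) * sin t = 0"
    "(M $ 1 $ 1 - \<sigma>) * cos t' + M $ 1 $ 2 * sin t' = 0" "M $ 2 $ 1 * cos t' + (M $ 2 $ 2 - \<sigma>) * sin t' = 0"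
    using assms by (simp_all add: vec2_eq_iff algebra_simps)
  have "(M $ 1 $ 1 - \<sigma>) * sin (t' - t) = sin t' * ((M $ 1 $ 1 - \<sigma>) * cos t + M $ 1 $ 2 * sin t)
      - sin t * ((M $ 1 $ 1 - \<sigma>) * cos t' + M $ 1 $ 2 * sin t')" by (simp add: sin_diff algebra_simps)
  then have "M $ 1 $ 1 = \<sigma>" using s unfolding e by simp
  moreover have "(M $ 2 $ 2 - \<sigma>) * sin (t' - t) = cos t * (M $ 2 $ 1 * cos t' + (M $ 2 $ 2 - \<sigma>) * sin t')
      - cos t' * (M $ 2 $ 1 * cos t + (M $ 2 $ 2 - \<sigma>) * sin t)" by (simp add: sin_diff algebra_simps)
  then have "M $ 2 $ 2 = \<sigma>" using s unfolding e by simp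
  ultimately show False using tr by (simp add: det_trace2)
qed

text \<open>The two fixed points are the eigendirections, the attracting one belonging to the eigenvalue of
  larger modulus. As the determinant is positive, the eigenvalues have the same sign.\<close>

lemma theta_eigen:
  assumes pos: "0 < det (M_mat P p q)" and less: "det (M_mat P p q) < (1/4) * (trace (M_mat P p q))\<^sup>2"
  obtains \<sigma> \<rho> where "0 < \<rho>" "\<rho> < 1" "\<sigma> \<noteq> 0"
    "M_mat P p q *v unit_dir (theta_s P p q) = \<sigma> *\<^sub>R unit_dir (theta_s P p q)"
    "M_mat P p q *v unit_dir (theta_u P p q) = (\<sigma> * \<rho>) *\<^sub>R unit_dir (theta_u P p q)"
    "theta_s P p q \<in> K_circle" "theta_u P p q \<in> K_circle"
proof -
  define M where "M = M_mat P p q"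
  define T where "T = trace M"
  define d where "d = sqrt (T\<^sup>2 - 4 * det M)"
  have dM: "det M \<noteq> 0" "0 < det M" using pos by (simp_all add: M_def)
  have d2: "d\<^sup>2 = T\<^sup>2 - 4 * det M" "0 < d" using less by (simp_all add: d_def M_def T_def)
  have "d\<^sup>2 < \<bar>T\<bar>\<^sup>2" using d2(1) dM by simp
  then have dT: "d < \<bar>T\<bar>" by (rule power2_less_imp_less) simp
  define \<sigma> where "\<sigma> = (T + sgn T * d) / 2"
  define \<mu> where "\<mu> = (T - sgn T * d) / 2"
  have sum: "\<sigma> + \<mu> = T" by (simp add: \<sigma>_def \<mu>_def field_simps)
  have T0: "T \<noteq> 0" using dT d2 by auto
  have "\<sigma> * \<mu> = (T\<^sup>2 - (sgn T)\<^sup>2 * d\<^sup>2) / 4" by (simp add: \<sigma>_def \<mu>_def power2_eq_square algebra_simps)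
  also have "(sgn T)\<^sup>2 = 1" using T0 by (simp add: sgn_if)
  finally have prod: "\<sigma> * \<mu> = det M" using d2 by simp
  define \<rho> where "\<rho> = \<mu> / \<sigma>"
  have l0: "\<sigma> \<noteq> 0" "\<mu> \<noteq> 0" using prod dM by auto
  have "0 < \<sigma> * \<mu>" using prod dM by simp
  then have \<rho>0: "0 < \<rho>" by (auto simp: \<rho>_def zero_less_divide_iff zero_less_mult_iff)
  have "\<sigma>\<^sup>2 - \<mu>\<^sup>2 = (\<sigma> + \<mu>) * (\<sigma> - \<mu>)" by (simp add: power2_eq_square algebra_simps)
  also have "\<sigma> - \<mu> = sgn T * d" by (simp add: \<sigma>_def \<mu>_def field_simps)
  also have "(\<sigma> + \<mu>) * (sgn T * d) = \<bar>T\<bar> * d" unfolding sum by (simp add: abs_sgn)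
  finally have "\<mu>\<^sup>2 < \<sigma>\<^sup>2" using dT d2(2) T0 by (smt (verit) mult_pos_pos)
  then have "\<rho>\<^sup>2 < 1\<^sup>2" using l0 by (simp add: \<rho>_def power_divide)
  then have "\<rho> < 1" by (rule power2_less_imp_less) simp
  note \<rho> = \<rho>0 this
  have \<mu>: "\<mu> = \<sigma> * \<rho>" using l0 by (simp add: \<rho>_def)
  have ne: "\<sigma> \<noteq> \<mu>" using \<rho> l0 by (simp add: \<mu>)
  have root: "x\<^sup>2 - trace M * x + det M = (x - \<sigma>) * (x - \<mu>)" for x
    unfolding T_def[symmetric] sum[symmetric] prod[symmetric] by (simp add: power2_eq_square algebra_simps)
  obtain ts where ts: "ts \<in> K_circle" "M *v unit_dir ts = \<sigma> *\<^sub>R unit_dir ts"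
    using eigen_direction_exists[of \<sigma> M] root[of \<sigma>] by auto
  obtain tu where tu: "tu \<in> K_circle" "M *v unit_dir tu = \<mu> *\<^sub>R unit_dir tu"
    using eigen_direction_exists[of \<mu> M] root[of \<mu>] by auto
  have Ds: "(trace M - \<sigma>) / \<sigma> = \<rho>" and Du: "(trace M - \<mu>) / \<mu> = inverse \<rho>"
    using sum by (simp_all add: T_def[symmetric] \<rho>_def field_simps)
  have \<rho>': "1 < inverse \<rho>" using \<rho> by (simp add: one_less_inverse)
  have fix_cases: "M *v unit_dir t = \<sigma> *\<^sub>R unit_dir t \<and> \<sigma> * D = \<mu> \<or> M *v unit_dir t = \<mu> *\<^sub>R unit_dir t \<and> \<mu> * D = \<sigma>"
    if t: "t \<in> K_circle" "angle_map M t = t" "has_circle_derivative (angle_map M) D t" for t D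
  proof -
    obtain r where r: "M *v unit_dir t = r *\<^sub>R unit_dir t" using angle_map_fixed_iff[OF dM(1)] t by metis
    have "r = \<sigma> \<or> r = \<mu>" using eigenvalue_root[OF r] unfolding root by simp
    moreover have "r * D = \<sigma> + \<mu> - r" using angle_map_derivative_unique[OF dM(1) r t(1,3)] sum by (simp add: T_def)
    ultimately show ?thesis using r by auto
  qed
  have "theta_s P p q = ts"
    unfolding theta_s_def G_map_eq M_def[symmetric]
  proof (rule the_equality)
    show "ts \<in> K_circle \<and> angle_map M ts = ts \<and> (\<exists>D. has_circle_derivative (angle_map M) D ts \<and> 0 < D \<and> D < 1)"
      using ts angle_map_fixed_iff[OF dM(1)] angle_map_derivative_exists[OF dM(1) ts(2) l0(1) ts(1)] \<rho>
      unfolding Ds by blast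
    fix t assume a: "t \<in> K_circle \<and> angle_map M t = t \<and> (\<exists>D. has_circle_derivative (angle_map M) D t \<and> 0 < D \<and> D < 1)"
    then obtain D where D: "has_circle_derivative (angle_map M) D t" "0 < D" "D < 1" by blast
    have "\<mu> * D \<noteq> \<sigma>"
    proof
      assume "\<mu> * D = \<sigma>"
      then have "\<rho> * D = 1" using l0 by (simp add: \<mu>)
      moreover have "\<rho> * D < 1 * 1" using D \<rho> by (intro mult_strict_mono) auto
      ultimately show False by simp
    qed
    then have "M *v unit_dir t = \<sigma> *\<^sub>R unit_dir t" using fix_cases D(1) a by blast
    then show "t = ts" using eigen_direction_unique[of M t \<sigma> ts] ts a sum ne by (simp add: T_def)
  qed
  moreover have "theta_u P p q = tu"
    unfolding theta_u_def G_map_eq M_def[symmetric]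
  proof (rule the_equality)
    show "tu \<in> K_circle \<and> angle_map M tu = tu \<and> (\<exists>D. has_circle_derivative (angle_map M) D tu \<and> 1 < D)"
      using tu angle_map_fixed_iff[OF dM(1)] angle_map_derivative_exists[OF dM(1) tu(2) l0(2) tu(1)] \<rho>'
      unfolding Du by blast
    fix t assume a: "t \<in> K_circle \<and> angle_map M t = t \<and> (\<exists>D. has_circle_derivative (angle_map M) D t \<and> 1 < D)"
    then obtain D where D: "has_circle_derivative (angle_map M) D t" "1 < D" by blast
    have "\<sigma> * D \<noteq> \<mu>" using D(2) \<rho> l0 by (simp add: \<mu>)
    then have "M *v unit_dir t = \<mu> *\<^sub>R unit_dir t" using fix_cases D(1) a by blast
    then show "t = tu" using eigen_direction_unique[of M t \<mu> tu] tu a sum ne by (simp add: T_def)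
  qed
  ultimately show ?thesis using that[of \<rho> \<sigma>] \<rho> l0 ts tu unfolding M_def \<mu> by simp
qed


section \<open>Directions in which the norm increases\<close>

lemma quad_form_two_zeros:
  assumes "sin (t2 - t1) \<noteq> 0" "quad_form a b c (unit_dir t1) = 0" "quad_form a b c (unit_dir t2) = 0"
  obtains k where "\<And>t. quad_form a b c (unit_dir t) = k * (sin (t - t1) * sin (t - t2))"
proof -
  define s where "s = sin (t2 - t1)"
  define B where "B = 2 * a * (cos t1 * cos t2) + b * (cos t1 * sin t2 + sin t1 * cos t2) + 2 * c * (sin t1 * sin t2)"
  have "quad_form a b c (unit_dir t) = - B / s\<^sup>2 * (sin (t - t1) * sin (t - t2))" for t
  proof -
    define x where "x = sin (t2 - t)"
    define y where "y = sin (t - t1)"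
    have eq: "s *\<^sub>R unit_dir t = x *\<^sub>R unit_dir t1 + y *\<^sub>R unit_dir t2"
    proof -
      have "sin (t2 - t1) * cos t = sin (t2 - t) * cos t1 + sin (t - t1) * cos t2"
        "sin (t2 - t1) * sin t = sin (t2 - t) * sin t1 + sin (t - t1) * sin t2"
        by (simp_all add: sin_diff algebra_simps)
      then show ?thesis by (simp add: vec2_eq_iff s_def x_def y_def)
    qed
    have "s\<^sup>2 * quad_form a b c (unit_dir t) = quad_form a b c (x *\<^sub>R unit_dir t1 + y *\<^sub>R unit_dir t2)"
      unfolding eq[symmetric] quad_form_scale ..
    also have "\<dots> = x\<^sup>2 * quad_form a b c (unit_dir t1) + x * y * B + y\<^sup>2 * quad_form a b c (unit_dir t2)"
      by (simp add: quad_form_def B_def power2_eq_square algebra_simps)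
    also have "\<dots> = x * y * B" using assms by simp
    finally have "s\<^sup>2 * quad_form a b c (unit_dir t) = x * y * B" .
    moreover have "x = - sin (t - t2)" by (simp add: x_def sin_diff)
    ultimately show ?thesis using assms(1) by (simp add: y_def s_def field_simps)
  qed
  then show ?thesis by (rule that)
qed

lemma not_strict_mono_antimono:
  fixes H :: "real \<Rightarrow> real"
  assumes "0 < e" "strict_mono_on {t - e<..<t + e} H" "0 < e'" "strict_antimono_on {t - e'<..<t + e'} H"
  shows False
proof -
  define h where "h = min e e' / 2"
  have h: "0 < h" "h < e" "h < e'" using assms(1,3) by (auto simp: h_def min_def)
  have "H t < H (t + h)" using assms(2) h by (intro strict_mono_onD[OF assms(2)]) auto
  moreover have "H (t + h) < H t" using assms(4) h by (intro monotone_onD[OF assms(4)]) auto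
  ultimately show False by simp
qed

lemma theta_dec_inc_eq:
  assumes sols: "{t \<in> K_circle. H_map P p q t = 1} = {t1, t2}" and t: "t1 \<noteq> t2"
    and e: "0 < e"
    and dec: "strict_antimono_on {t1 - e<..<t1 + e} (H_map P p q)"
    and inc: "strict_mono_on {t2 - e<..<t2 + e} (H_map P p q)"
  shows "theta_dec P p q = t1" "theta_inc P p q = t2"
proof -
  have sol: "t \<in> K_circle \<and> H_map P p q t = 1 \<longleftrightarrow> t = t1 \<or> t = t2" for t using sols by blast
  show "theta_dec P p q = t1"
    unfolding theta_dec_def conj_assoc[symmetric] sol
    by (rule the_equality) (use dec inc e not_strict_mono_antimono in \<open>metis+\<close>)
  show "theta_inc P p q = t2"
    unfolding theta_inc_def conj_assoc[symmetric] sol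
    by (rule the_equality) (use dec inc e not_strict_mono_antimono in \<open>metis+\<close>)
qed

text \<open>The square of the norm growth minus \<open>1\<close> is a quadratic form in the direction, and with exactly two
  zeros \<open>t1\<close> and \<open>t2\<close> it is a nonzero multiple of \<open>sin (t - t1) sin (t - t2)\<close>. The norm is thus contracted
  precisely on the open interval from the decreasing to the increasing solution.\<close>

lemma H_map_expands:
  assumes ex: "dec_inc_exist P p q" and t: "t \<in> K_circle" "t \<notin> K_interval (theta_dec P p q) (theta_inc P p q)"
  shows "1 < H_map P p q t"
proof -
  define H where "H = H_map P p q"
  define M where "M = M_mat P p q"
  define a where "a = (M $ 1 $ 1)\<^sup>2 + (M $ 2 $ 1)\<^sup>2 - 1"
  define b where "b = 2 * (M $ 1 $ 1 * M $ 1 $ 2 + M $ 2 $ 1 * M $ 2 $ 2)"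
  define c where "c = (M $ 1 $ 2)\<^sup>2 + (M $ 2 $ 2)\<^sup>2 - 1"
  have H0: "0 \<le> H s" for s by (simp add: H_def H_map_def)
  have H2: "(H s)\<^sup>2 = 1 + quad_form a b c (unit_dir s)" for s
  proof -
    have "(H s)\<^sup>2 = (M $ 1 $ 1 * cos s + M $ 1 $ 2 * sin s)\<^sup>2 + (M $ 2 $ 1 * cos s + M $ 2 $ 2 * sin s)\<^sup>2"
      by (simp add: H_def H_map_def M_def norm_vec2)
    also have "\<dots> = ((cos s)\<^sup>2 + (sin s)\<^sup>2) + quad_form a b c (unit_dir s)"
      by (simp add: quad_form_def a_def b_def c_def power2_eq_square algebra_simps del: sin_cos_squared_add3 sin_cos_squared_add2 sin_cos_squared_add)
    finally show ?thesis by simp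
  qed
  have H1: "H s = 1 \<longleftrightarrow> quad_form a b c (unit_dir s) = 0" for s
    using H0[of s] H2[of s] by (auto simp: power2_eq_1_iff)
  obtain x y where "{t \<in> K_circle. H t = 1} = {x, y}" "x \<noteq> y"
    using ex unfolding dec_inc_exist_def H_def card_2_iff by blast
  then obtain t1 t2 where sols: "{t \<in> K_circle. H t = 1} = {t1, t2}" and t12: "t1 < t2"
    by (metis insert_commute linorder_neqE_linordered_idom)
  then have K: "t1 \<in> K_circle" "t2 \<in> K_circle" and z: "H t1 = 1" "H t2 = 1" by blast+
  define d where "d = t2 - t1"
  have d: "0 < d" "d < pi" using K t12 by (auto simp: d_def K_circle_def)
  have "sin (t2 - t1) \<noteq> 0" using sin_gt_zero[OF d] by (simp add: d_def)
  then obtain k where k: "\<And>s. quad_form a b c (unit_dir s) = k * (sin (s - t1) * sin (s - t2))"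
    using quad_form_two_zeros z H1 by metis
  have Hk: "(H s)\<^sup>2 = 1 + k * (sin (s - t1) * sin (s - t2))" for s by (simp add: H2 k)
  have k0: "k \<noteq> 0"
  proof
    assume "k = 0"
    then have "{t \<in> K_circle. H t = 1} = K_circle" using H1 k by auto
    then have "finite K_circle" using sols by (metis finite.emptyI finite_insert)
    then show False by (simp add: K_circle_def infinite_Ico)
  qed
  define m where "m = t1 + t2"
  have prod: "sin (s - t1) * sin (s - t2) = (cos d - cos (2 * s - m)) / 2" for s
    unfolding sin_times_sin by (simp add: d_def m_def algebra_simps)
  define e where "e = min d (pi - d) / 2"
  have e: "0 < e" "2 * e \<le> d" "2 * e \<le> pi - d" using d by (auto simp: e_def)
  have near2: "cos (2 * y - m) < cos (2 * x - m)" if "x \<in> {t2 - e<..<t2 + e}" "y \<in> {t2 - e<..<t2 + e}" "x < y" for x y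
    using that e by (intro cos_monotone_0_pi) (auto simp: m_def d_def)
  have near1: "cos (2 * x - m) < cos (2 * y - m)" if "x \<in> {t1 - e<..<t1 + e}" "y \<in> {t1 - e<..<t1 + e}" "x < y" for x y
  proof -
    have "cos (m - 2 * x) < cos (m - 2 * y)"
      using that e by (intro cos_monotone_0_pi) (auto simp: m_def d_def)
    then show ?thesis using cos_minus[of "2 * x - m"] cos_minus[of "2 * y - m"] by simp
  qed
  have less: "H x < H y" if "k * (cos (2 * y - m) - cos (2 * x - m)) < 0" for x y
  proof -
    have "k * (A / 2) = (k * A) / 2" for A by simp
    then have "(H x)\<^sup>2 < (H y)\<^sup>2" unfolding Hk prod using that by (simp add: right_diff_distrib)
    then show ?thesis using H0 by (rule power2_less_imp_less)
  qed
  have range: "- pi < t - t1" "t - t1 < pi" "- pi < t - t2" "t - t2 < pi"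
    using t(1) K by (auto simp: K_circle_def)
  note sg = sin_sign[OF range(1,2)] sin_sign[OF range(3,4)]
  have "0 < k * (sin (t - t1) * sin (t - t2))"
  proof (cases "0 < k")
    case True
    have "strict_antimono_on {t1 - e<..<t1 + e} H"
      by (rule monotone_onI) (use less near1 True in \<open>simp add: mult_pos_neg\<close>)
    moreover have "strict_mono_on {t2 - e<..<t2 + e} H"
      by (rule strict_mono_onI) (use less near2 True in \<open>simp add: mult_pos_neg\<close>)
    ultimately have "theta_dec P p q = t1" "theta_inc P p q = t2"
      using theta_dec_inc_eq[of P p q t1 t2 e] sols t12 e by (simp_all add: H_def)
    then have "t < t1 \<or> t2 < t" using t t12 by (auto simp: K_interval_def)
    then have "0 < sin (t - t1) * sin (t - t2)"
    proof
      assume "t < t1"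
      then show ?thesis using sg t12 by (intro mult_neg_neg) (simp_all add: not_le[symmetric])
    next
      assume "t2 < t"
      then show ?thesis using sg t12 by (intro mult_pos_pos) (simp_all add: not_le[symmetric])
    qed
    then show ?thesis using True by simp
  next
    case False
    then have k: "k < 0" using k0 by simp
    have "strict_mono_on {t1 - e<..<t1 + e} H"
      by (rule strict_mono_onI) (use less near1 k in \<open>simp add: mult_neg_pos\<close>)
    moreover have "strict_antimono_on {t2 - e<..<t2 + e} H"
      by (rule monotone_onI) (use less near2 k in \<open>simp add: mult_neg_pos\<close>)
    ultimately have "theta_dec P p q = t2" "theta_inc P p q = t1"
      using theta_dec_inc_eq[of P p q t2 t1 e] sols t12 e by (simp_all add: H_def insert_commute)
    then have "t1 < t \<and> t < t2" using t t12 by (auto simp: K_interval_def)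
    then have "sin (t - t1) * sin (t - t2) < 0"
      using sg by (intro mult_pos_neg) (simp_all add: not_le[symmetric])
    then show ?thesis using k by (simp add: mult_neg_neg)
  qed
  then have "1\<^sup>2 < (H t)\<^sup>2" unfolding Hk by simp
  then show ?thesis unfolding H_def[symmetric] using H0 by (rule power2_less_imp_less)
qed


section \<open>The invariant expanding cone\<close>

lemma det_matrix_power: "det (matrix_power A n) = det A ^ n"
  by (induction n) (simp_all add: det_mul)

lemma det_A: "det (A_L P) = delta_L P" "det (A_R P) = delta_R P"
  by (simp_all add: det_2 A_L_def A_R_def)

context chaotic
begin

lemma det_M_mat: "0 < det (M_mat P p q)"
  using delta_L_pos delta_R_pos by (simp add: M_mat_def det_mul det_matrix_power det_A)

lemma finite_Gamma: "finite (Gamma_set P)"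
  by (rule finite_subset[of _ "{..p_max P} \<times> {..q_max P}"]) (auto simp: Gamma_set_def)

text \<open>The quadratic forms whose nonnegativity describes one of the intervals separating the stable from the
  unstable directions. Together they describe the cone \<open>C\<^sub>J\<close>.\<close>

definition cone_forms :: "(real \<times> real \<times> real) set" where
  "cone_forms = {(a, b, c). \<exists>J. separates P (Gamma_set P) J \<and>
     (\<forall>t\<in>K_circle. t \<in> J \<longleftrightarrow> 0 \<le> quad_form a b c (unit_dir t))}"

lemma J_set_subset: "J_set P \<subseteq> K_circle"
proof -
  obtain J where J: "separates P (Gamma_set P) J" using unmixed by (auto simp: unmixed_def)
  then have "J \<subseteq> K_circle" by (auto simp: separates_def closed_K_interval_def K_interval_def split: if_splits)
  then show ?thesis using J by (auto simp: J_set_def)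
qed

lemma C_J_iff:
  assumes "v \<noteq> 0"
  shows "v \<in> C_J P \<longleftrightarrow> (\<forall>(a, b, c)\<in>cone_forms. 0 \<le> quad_form a b c v)"
proof
  assume "v \<in> C_J P"
  then obtain \<alpha> t where v: "v = \<alpha> *\<^sub>R unit_dir t" "t \<in> J_set P" by (auto simp: C_J_def)
  then have "t \<in> K_circle" using J_set_subset by blast
  then show "\<forall>(a, b, c)\<in>cone_forms. 0 \<le> quad_form a b c v"
    using v by (auto simp: cone_forms_def J_set_def quad_form_scale)
next
  assume forms: "\<forall>(a, b, c)\<in>cone_forms. 0 \<le> quad_form a b c v"
  obtain r t where t: "t \<in> K_circle" "v = r *\<^sub>R unit_dir t" "r \<noteq> 0" using unit_dir_exists assms by metis
  have "t \<in> J" if J: "separates P (Gamma_set P) J" for J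
  proof -
    obtain t0 t1 where "t0 \<in> K_circle" "t1 \<in> K_circle" "J = K_interval t0 t1"
      using J by (auto simp: separates_def closed_K_interval_def)
    then obtain a b c where abc: "\<forall>t\<in>K_circle. t \<in> J \<longleftrightarrow> 0 \<le> quad_form a b c (unit_dir t)"
      using K_interval_quad_form by metis
    then have "(a, b, c) \<in> cone_forms" using J by (auto simp: cone_forms_def)
    then have "0 \<le> quad_form a b c v" using forms by blast
    then have "0 \<le> quad_form a b c (unit_dir t)"
      using t(3) unfolding t(2) quad_form_scale by (simp add: zero_le_mult_iff)
    then show "t \<in> J" using abc t(1) by blast
  qed
  then show "v \<in> C_J P" using t(2) by (auto simp: C_J_def J_set_def)
qed

text \<open>Up to a scalar, the matrix shortens the component of a vector along the repelling eigendirection,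
  at which the forms are negative.\<close>

lemma C_J_invariant:
  assumes G: "(p, q) \<in> Gamma_set P" and v: "v \<in> C_J P" "v \<noteq> 0"
  shows "M_mat P p q *v v \<in> C_J P" and "M_mat P p q *v v \<noteq> 0"
proof -
  let ?M = "M_mat P p q"
  show nz: "?M *v v \<noteq> 0" using det_M_mat det_nonzero_mult v(2) by (metis less_irrefl)
  let ?s = "unit_dir (theta_s P p q)" and ?u = "unit_dir (theta_u P p q)"
  obtain \<sigma> \<rho> where \<rho>: "0 < \<rho>" "\<rho> < 1" and \<sigma>: "\<sigma> \<noteq> 0"
    and es: "?M *v ?s = \<sigma> *\<^sub>R ?s" and eu: "?M *v ?u = (\<sigma> * \<rho>) *\<^sub>R ?u"
    and K: "theta_s P p q \<in> K_circle" "theta_u P p q \<in> K_circle"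
    using theta_eigen[OF det_M_mat det_less[OF G]] by blast
  obtain J0 where "separates P (Gamma_set P) J0" using unmixed by (auto simp: unmixed_def)
  then have "theta_s P p q \<noteq> theta_u P p q" using G by (auto simp: separates_def)
  define d where "d = sin (theta_u P p q - theta_s P p q)"
  have d: "d \<noteq> 0" unfolding d_def using sin_K_diff_zero K \<open>theta_s P p q \<noteq> theta_u P p q\<close> by metis
  define x where "x = (v $ 1 * sin (theta_u P p q) - v $ 2 * cos (theta_u P p q)) / d"
  define y where "y = (v $ 2 * cos (theta_s P p q) - v $ 1 * sin (theta_s P p q)) / d"
  have dx: "d * x = v $ 1 * sin (theta_u P p q) - v $ 2 * cos (theta_u P p q)"
    and dy: "d * y = v $ 2 * cos (theta_s P p q) - v $ 1 * sin (theta_s P p q)"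
    using d by (simp_all add: x_def y_def)
  have "d *\<^sub>R v = (d * x) *\<^sub>R ?s + (d * y) *\<^sub>R ?u"
    unfolding dx dy by (simp add: vec2_eq_iff d_def sin_diff algebra_simps)
  then have "d *\<^sub>R v = d *\<^sub>R (x *\<^sub>R ?s + y *\<^sub>R ?u)" by (simp add: scaleR_add_right)
  then have vxy: "v = x *\<^sub>R ?s + y *\<^sub>R ?u" using d by simp
  have Mv: "?M *v v = \<sigma> *\<^sub>R (x *\<^sub>R ?s + (\<rho> * y) *\<^sub>R ?u)"
    unfolding vxy matrix_vector_right_distrib matrix_vector_mult_scaleR es eu
    by (simp add: scaleR_add_right algebra_simps)
  show "?M *v v \<in> C_J P"
    unfolding C_J_iff[OF nz]
  proof (intro ballI, clarify)
    fix a b c assume abc: "(a, b, c) \<in> cone_forms"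
    then obtain J where J: "separates P (Gamma_set P) J"
      and iff: "\<forall>t\<in>K_circle. t \<in> J \<longleftrightarrow> 0 \<le> quad_form a b c (unit_dir t)"
      by (auto simp: cone_forms_def)
    have "0 \<le> quad_form a b c v" using abc v C_J_iff by blast
    moreover have "0 \<le> quad_form a b c ?s" "quad_form a b c ?u < 0"
      using J G iff K by (auto simp: separates_def not_le[symmetric])
    ultimately have "0 \<le> quad_form a b c (x *\<^sub>R ?s + (\<rho> * y) *\<^sub>R ?u)"
      using \<rho> unfolding vxy by (intro quad_form_contract) auto
    then show "0 \<le> quad_form a b c (?M *v v)" unfolding Mv quad_form_scale by simp
  qed
qed

text \<open>The unit vectors of the cone form a compact set, so that the norm grows on them by a uniform
  factor.\<close>

lemma C_J_expanding_one:
  assumes G: "(p, q) \<in> Gamma_set P"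
  obtains \<kappa> where "1 < \<kappa>" "\<And>v. v \<in> C_J P \<Longrightarrow> \<kappa> * norm v \<le> norm (M_mat P p q *v v)"
proof -
  let ?M = "M_mat P p q"
  define S where "S = {v \<in> sphere 0 1. \<forall>(a, b, c)\<in>cone_forms. 0 \<le> quad_form a b c v}"
  have S: "v \<in> S \<longleftrightarrow> norm v = 1 \<and> v \<in> C_J P" for v
    using C_J_iff[of v] by (cases "v = 0") (auto simp: S_def)
  have "S = sphere 0 1 \<inter> (\<Inter>(a, b, c)\<in>cone_forms. {v. 0 \<le> quad_form a b c v})" by (auto simp: S_def)
  moreover have "closed {v. 0 \<le> quad_form a b c v}" for a b c
    unfolding quad_form_def by (intro closed_Collect_le continuous_intros)
  ultimately have "compact S" by (auto intro!: compact_Int_closed closed_INT)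
  have gt: "1 < norm (?M *v v)" if v: "v \<in> S" for v
  proof -
    obtain \<alpha> t where t: "v = \<alpha> *\<^sub>R unit_dir t" "t \<in> J_set P" using v S by (auto simp: C_J_def)
    then have "\<bar>\<alpha>\<bar> = 1" using v S by auto
    moreover have "1 < H_map P p q t"
      using H_map_expands[OF dec_inc_exist[OF G]] J_avoids[OF G] t(2) J_set_subset by blast
    ultimately show ?thesis by (simp add: t(1) H_map_def matrix_vector_mult_scaleR)
  qed
  have "\<exists>\<kappa>>1. \<forall>v\<in>S. \<kappa> \<le> norm (?M *v v)"
  proof (cases "S = {}")
    case False
    have "continuous_on S (\<lambda>v. norm (?M *v v))"
      by (intro continuous_on_norm linear_continuous_on matrix_vector_mul_bounded_linear)
    then obtain v where "v \<in> S" "\<forall>w\<in>S. norm (?M *v v) \<le> norm (?M *v w)"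
      using continuous_attains_inf[OF \<open>compact S\<close> False] by blast
    then show ?thesis using gt by blast
  qed (use gt_ex in auto)
  then obtain \<kappa> where \<kappa>: "1 < \<kappa>" "\<And>v. v \<in> S \<Longrightarrow> \<kappa> \<le> norm (?M *v v)" by blast
  show ?thesis
  proof (rule that[OF \<kappa>(1)])
    fix v assume v: "v \<in> C_J P"
    show "\<kappa> * norm v \<le> norm (?M *v v)"
    proof (cases "v = 0")
      case False
      define w where "w = inverse (norm v) *\<^sub>R v"
      obtain \<alpha> t where t: "v = \<alpha> *\<^sub>R unit_dir t" "t \<in> J_set P" using v by (auto simp: C_J_def)
      have "w = (inverse (norm v) * \<alpha>) *\<^sub>R unit_dir t" by (simp add: w_def t(1))
      then have "w \<in> C_J P" unfolding C_J_def using t(2) by blast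
      then have "w \<in> S" using False by (simp add: S w_def)
      then have "\<kappa> \<le> norm (?M *v w)" using \<kappa>(2) by blast
      also have "\<dots> = norm (?M *v v) / norm v"
        by (simp add: w_def matrix_vector_mult_scaleR divide_inverse mult.commute)
      finally show ?thesis using False by (simp add: field_simps)
    qed simp
  qed
qed

lemma C_J_expanding:
  obtains \<kappa> where "1 < \<kappa>"
    "\<And>p q v. (p, q) \<in> Gamma_set P \<Longrightarrow> v \<in> C_J P \<Longrightarrow> \<kappa> * norm v \<le> norm (M_mat P p q *v v)"
proof -
  have "\<forall>x\<in>Gamma_set P. \<exists>\<kappa>>1. \<forall>v\<in>C_J P. \<kappa> * norm v \<le> norm (M_mat P (fst x) (snd x) *v v)"
    using C_J_expanding_one by (metis prod.collapse)
  then obtain k where k: "\<forall>x\<in>Gamma_set P. 1 < k x \<and> (\<forall>v\<in>C_J P. k x * norm v \<le> norm (M_mat P (fst x) (snd x) *v v))"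
    by metis
  define \<kappa> where "\<kappa> = Min (insert 2 (k ` Gamma_set P))"
  have "1 < \<kappa>" using k finite_Gamma by (simp add: \<kappa>_def)
  moreover have "\<kappa> * norm v \<le> norm (M_mat P p q *v v)" if pq: "(p, q) \<in> Gamma_set P" and v: "v \<in> C_J P" for p q v
  proof -
    have "\<kappa> \<le> k (p, q)" using finite_Gamma pq by (simp add: \<kappa>_def)
    then have "\<kappa> * norm v \<le> k (p, q) * norm v" by (intro mult_right_mono) auto
    also have "\<dots> \<le> norm (M_mat P p q *v v)" using k pq v by fastforce
    finally show ?thesis .
  qed
  ultimately show ?thesis by (rule that)
qed

end


section \<open>Growth of derivatives along orbits\<close>

text \<open>The Jacobian of the \<open>n\<close>-th iterate. It is only meaningful for orbits avoiding the switching line; a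
  point on that line is counted as being on the right.\<close>

primrec jacobian :: "params \<Rightarrow> real^2 \<Rightarrow> nat \<Rightarrow> real^2^2" where
  "jacobian P Z 0 = mat 1"
| "jacobian P Z (Suc n) = (if (bcmap P ^^ n) Z $ 1 < 0 then A_L P else A_R P) ** jacobian P Z n"

lemma bcmap_has_derivative:
  assumes "Z $ 1 \<noteq> 0"
  shows "(bcmap P has_derivative (\<lambda>v. (if Z $ 1 < 0 then A_L P else A_R P) *v v)) (at Z)"
proof (cases "Z $ 1 < 0")
  case True
  have "((\<lambda>Z. A_L P *v Z + vector [1, 0]) has_derivative (\<lambda>v. A_L P *v v)) (at Z)"
    by (intro has_derivative_add_const bounded_linear_imp_has_derivative matrix_vector_mul_bounded_linear)
  moreover have "open {Z :: real^2. Z $ 1 < 0}"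
    by (intro open_Collect_less continuous_intros)
  ultimately have "(bcmap P has_derivative (\<lambda>v. A_L P *v v)) (at Z)"
    by (rule has_derivative_transform_within_open) (use True in \<open>auto simp: bcmap_def f_L_def\<close>)
  then show ?thesis using True by simp
next
  case False
  have "((\<lambda>Z. A_R P *v Z + vector [1, 0]) has_derivative (\<lambda>v. A_R P *v v)) (at Z)"
    by (intro has_derivative_add_const bounded_linear_imp_has_derivative matrix_vector_mul_bounded_linear)
  moreover have "open {Z :: real^2. 0 < Z $ 1}"
    by (intro open_Collect_less continuous_intros)
  ultimately have "(bcmap P has_derivative (\<lambda>v. A_R P *v v)) (at Z)"
    by (rule has_derivative_transform_within_open) (use False assms in \<open>auto simp: bcmap_def f_R_def\<close>)
  then show ?thesis using False by simp
qed

lemma jacobian_has_derivative: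
  assumes "\<And>i. i < n \<Longrightarrow> (bcmap P ^^ i) Z $ 1 \<noteq> 0"
  shows "((bcmap P ^^ n) has_derivative (\<lambda>v. jacobian P Z n *v v)) (at Z)"
  using assms
proof (induction n)
  case 0
  then show ?case by (simp add: id_def[symmetric] has_derivative_id)
next
  case (Suc n)
  have "(bcmap P \<circ> (bcmap P ^^ n) has_derivative
      (\<lambda>v. (if (bcmap P ^^ n) Z $ 1 < 0 then A_L P else A_R P) *v v) \<circ> (\<lambda>v. jacobian P Z n *v v)) (at Z)"
    using Suc by (intro diff_chain_at bcmap_has_derivative) auto
  then show ?case by (simp add: comp_def matrix_vector_mul_assoc)
qed

lemma jacobian_add: "jacobian P Z (m + n) = jacobian P ((bcmap P ^^ n) Z) m ** jacobian P Z n"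
  by (induction m) (simp_all add: funpow_add matrix_mul_assoc)

lemma jacobian_left:
  "(\<And>i. i < n \<Longrightarrow> (bcmap P ^^ i) Z $ 1 < 0) \<Longrightarrow> jacobian P Z n = matrix_power (A_L P) n"
  by (induction n) simp_all

lemma jacobian_right:
  "(\<And>i. i < n \<Longrightarrow> 0 < (bcmap P ^^ i) Z $ 1) \<Longrightarrow> jacobian P Z n = matrix_power (A_R P) n"
proof (induction n)
  case (Suc n)
  have "0 < (bcmap P ^^ n) Z $ 1" using Suc.prems by simp
  then have "\<not> (bcmap P ^^ n) Z $ 1 < 0" by linarith
  then show ?case using Suc by simp
qed simp

context chaotic
begin

lemma regular_return:
  assumes Z: "Z \<in> Omega_set P - Xi_inf P"
  shows "\<exists>p q. (p, q) \<in> Gamma_set P \<and> 1 \<le> p \<and>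
    (\<forall>i<p + q. (bcmap P ^^ i) Z $ 1 \<noteq> 0) \<and> jacobian P Z (p + q) = M_mat P p q \<and>
    (bcmap P ^^ (p + q)) Z \<in> Omega_set P - Xi_inf P"
proof -
  have Om: "Z \<in> Omega_set P" using Z by simp
  obtain p q where pq: "(p, q) \<in> Gamma_set P" "1 \<le> p" "1 \<le> q"
    and left: "\<And>i. i < p \<Longrightarrow> (bcmap P ^^ i) Z $ 1 \<le> 0"
    and right: "\<And>i. p \<le> i \<Longrightarrow> i < p + q \<Longrightarrow> 0 \<le> (bcmap P ^^ i) Z $ 1"
    and rt: "return_time P Z = p + q" and ind: "induced_map P Z \<in> Omega_set P"
    using induced_return[OF Om] by blast
  have "(induced_map P ^^ i) Z \<notin> Xi P" for i using Z by (auto simp: Xi_inf_def)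
  from this[of 0] have Xi: "Z \<notin> Xi P" by simp
  have nz: "(bcmap P ^^ i) Z $ 1 \<noteq> 0" if "i < p + q" for i
  proof (cases i)
    case 0
    then show ?thesis using Om by (simp add: Omega_set_def Phi_def)
  next
    case (Suc j)
    then have "1 \<le> i \<and> i \<le> return_time P Z - 1" using that rt by simp
    then show ?thesis using Xi Om by (auto simp: Xi_def switching_line_def)
  qed
  have "jacobian P Z (q + p) = jacobian P ((bcmap P ^^ p) Z) q ** jacobian P Z p" by (rule jacobian_add)
  also have "jacobian P Z p = matrix_power (A_L P) p"
    by (rule jacobian_left) (use left nz in \<open>simp add: less_le\<close>)
  also have "jacobian P ((bcmap P ^^ p) Z) q = matrix_power (A_R P) q"
  proof (rule jacobian_right)
    fix i assume "i < q"
    then show "0 < (bcmap P ^^ i) ((bcmap P ^^ p) Z) $ 1"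
      using right[of "i + p"] nz[of "i + p"] by (simp add: funpow_add less_le)
  qed
  finally have jac: "jacobian P Z (p + q) = M_mat P p q" by (simp add: M_mat_def add.commute)
  have eq: "(bcmap P ^^ (p + q)) Z = induced_map P Z" by (simp add: induced_map_def rt)
  have "(induced_map P ^^ i) (induced_map P Z) \<notin> Xi P" for i
    using \<open>(induced_map P ^^ Suc i) Z \<notin> Xi P\<close> by (simp add: funpow_swap1)
  then have "induced_map P Z \<in> Omega_set P - Xi_inf P" using ind by (simp add: Xi_inf_def)
  then have "(bcmap P ^^ (p + q)) Z \<in> Omega_set P - Xi_inf P" unfolding eq .
  then show ?thesis using pq nz jac by blast
qed

lemma orbit_regular:
  assumes "Z \<in> Omega_set P - Xi_inf P"
  shows "(bcmap P ^^ n) Z $ 1 \<noteq> 0"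
  using assms
proof (induction n arbitrary: Z rule: less_induct)
  case (less n)
  obtain p q where pq: "1 \<le> p" "\<forall>i<p + q. (bcmap P ^^ i) Z $ 1 \<noteq> 0"
    "(bcmap P ^^ (p + q)) Z \<in> Omega_set P - Xi_inf P"
    using regular_return[OF less.prems] by blast
  show ?case
  proof (cases "n < p + q")
    case False
    then have "n = (n - (p + q)) + (p + q)" by simp
    then have "(bcmap P ^^ n) Z = (bcmap P ^^ (n - (p + q))) ((bcmap P ^^ (p + q)) Z)"
      by (metis comp_apply funpow_add)
    then show ?thesis using less.IH[OF _ pq(3), of "n - (p + q)"] False pq(1) by simp
  qed (use pq(2) in blast)
qed

lemma one_step_lower_bound:
  obtains \<epsilon> where "0 < \<epsilon>" "\<epsilon> \<le> 1" "\<And>v. \<epsilon> * norm v \<le> norm (A_L P *v v)" "\<And>v. \<epsilon> * norm v \<le> norm (A_R P *v v)"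
proof -
  have below: "\<exists>B>0. \<forall>v. B * norm v \<le> norm (A *v v)" if "det A \<noteq> 0" for A :: "real^2^2"
  proof -
    have "inj ((*v) A)" using det_nonzero_mult[OF that]
      by (subst linear_injective_0[OF matrix_vector_mul_linear]) blast
    then show ?thesis using linear_inj_bounded_below_pos[OF matrix_vector_mul_linear] by metis
  qed
  obtain B1 where B1: "0 < B1" "\<And>v. B1 * norm v \<le> norm (A_L P *v v)"
    using below[of "A_L P"] delta_L_pos by (auto simp: det_A)
  obtain B2 where B2: "0 < B2" "\<And>v. B2 * norm v \<le> norm (A_R P *v v)"
    using below[of "A_R P"] delta_R_pos by (auto simp: det_A)
  have le: "min 1 (min B1 B2) * norm v \<le> B1 * norm v" "min 1 (min B1 B2) * norm v \<le> B2 * norm v" for v :: "real^2"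
    by (intro mult_right_mono; simp)+
  show ?thesis
    by (rule that[of "min 1 (min B1 B2)"]) (use B1 B2 le order_trans in \<open>auto, blast+\<close>)
qed

text \<open>Each return takes at most \<open>N\<close> steps and gains a factor \<open>\<kappa>\<close>, hence on average at least \<open>g = \<kappa>\<^bsup>1/N\<^esup>\<close> per
  step; the constant \<open>c\<close> absorbs what an incomplete return may lose.\<close>

lemma jacobian_growth:
  "\<exists>c>0. \<exists>g>1. \<forall>Z\<in>Omega_set P - Xi_inf P. \<forall>v\<in>C_J P - {0}. \<forall>n.
     c * g ^ n * norm v \<le> norm (jacobian P Z n *v v)"
proof -
  obtain \<kappa> where \<kappa>: "1 < \<kappa>"
    "\<And>p q v. (p, q) \<in> Gamma_set P \<Longrightarrow> v \<in> C_J P \<Longrightarrow> \<kappa> * norm v \<le> norm (M_mat P p q *v v)"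
    using C_J_expanding by blast
  obtain \<epsilon> where \<epsilon>: "0 < \<epsilon>" "\<epsilon> \<le> 1"
    "\<And>v. \<epsilon> * norm v \<le> norm (A_L P *v v)" "\<And>v. \<epsilon> * norm v \<le> norm (A_R P *v v)"
    using one_step_lower_bound by blast
  have step: "\<epsilon> ^ n * norm v \<le> norm (jacobian P Z n *v v)" for n v Z
  proof (induction n)
    case (Suc n)
    have "\<epsilon> ^ Suc n * norm v \<le> \<epsilon> * norm (jacobian P Z n *v v)"
      using mult_left_mono[OF Suc, of \<epsilon>] \<epsilon>(1) by (simp add: mult.assoc)
    also have "\<dots> \<le> norm (jacobian P Z (Suc n) *v v)"
      using \<epsilon>(3,4) by (simp add: matrix_vector_mul_assoc[symmetric])
    finally show ?case .
  qed simp
  define N where "N = p_max P + q_max P"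
  have N: "0 < N" using p_min_less by (simp add: N_def)
  define g where "g = root N \<kappa>"
  have gN: "g ^ N = \<kappa>" using N \<kappa>(1) by (simp add: g_def)
  have g: "1 < g" using N \<kappa>(1) by (simp add: g_def)
  define c where "c = \<epsilon> ^ N / \<kappa>"
  have c: "0 < c" using \<epsilon> \<kappa> by (simp add: c_def)
  have g_le: "g ^ r \<le> \<kappa>" if "r \<le> N" for r
    unfolding gN[symmetric] using g that by (intro power_increasing) auto
  have "c * g ^ n * norm v \<le> norm (jacobian P Z n *v v)"
    if "Z \<in> Omega_set P - Xi_inf P" "v \<in> C_J P" "v \<noteq> 0" for Z v n
    using that
  proof (induction n arbitrary: Z v rule: less_induct)
    case (less n)
    obtain p q where pq: "(p, q) \<in> Gamma_set P" "1 \<le> p"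
      and jac: "jacobian P Z (p + q) = M_mat P p q"
      and next_pt: "(bcmap P ^^ (p + q)) Z \<in> Omega_set P - Xi_inf P"
      using regular_return[OF less.prems(1)] by blast
    have pqN: "p + q \<le> N" using pq by (simp add: Gamma_set_def N_def)
    show ?case
    proof (cases "n < p + q")
      case True
      have "c * g ^ n = \<epsilon> ^ N * (g ^ n / \<kappa>)" by (simp add: c_def)
      also have "\<dots> \<le> \<epsilon> ^ n * 1"
        using g_le[of n] \<epsilon> \<kappa> g True pqN by (intro mult_mono power_decreasing) auto
      finally have "c * g ^ n * norm v \<le> \<epsilon> ^ n * norm v" by (intro mult_right_mono) auto
      then show ?thesis using step[of n v Z] by simp
    next
      case False
      define m where "m = n - (p + q)"
      have n: "n = m + (p + q)" "m < n" using False pq(2) by (auto simp: m_def)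
      let ?w = "M_mat P p q *v v"
      have "c * g ^ n * norm v = c * g ^ m * (g ^ (p + q) * norm v)" by (simp add: n(1) power_add)
      also have "\<dots> \<le> c * g ^ m * (\<kappa> * norm v)"
        using g_le[OF pqN] c g by (intro mult_left_mono mult_right_mono) auto
      also have "\<dots> \<le> c * g ^ m * norm ?w"
        using \<kappa>(2)[OF pq(1) less.prems(2)] c g by (intro mult_left_mono) auto
      also have "\<dots> \<le> norm (jacobian P ((bcmap P ^^ (p + q)) Z) m *v ?w)"
        using less.IH[OF n(2) next_pt] C_J_invariant[OF pq(1) less.prems(2,3)] by blast
      also have "jacobian P ((bcmap P ^^ (p + q)) Z) m *v ?w = jacobian P Z n *v v"
        unfolding n(1) jacobian_add[of P Z m] jac by (simp add: matrix_vector_mul_assoc)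
      finally show ?thesis .
    qed
  qed
  then show ?thesis using c g by blast
qed

end

lemma liminf_growth_rate_pos:
  fixes u :: "nat \<Rightarrow> real"
  assumes c: "0 < c" and g: "1 < g" and le: "\<And>n. c * g ^ n \<le> u n"
  shows "0 < liminf (\<lambda>n. ereal (1 / real n * ln (u n)))"
proof -
  have lg: "0 < ln g" using g by simp
  have "(\<lambda>n. ln c / real n) \<longlonglongrightarrow> 0" by (rule lim_const_over_n)
  then have "\<forall>\<^sub>F n in sequentially. - (ln g / 2) < ln c / real n"
    using lg by (intro order_tendstoD) auto
  moreover have "\<forall>\<^sub>F n in sequentially. 0 < n" by (rule eventually_gt_at_top)
  ultimately have "\<forall>\<^sub>F n in sequentially. ereal (ln g / 2) \<le> ereal (1 / real n * ln (u n))"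
  proof eventually_elim
    case (elim n)
    have "ln c + real n * ln g = ln (c * g ^ n)" using c g by (simp add: ln_mult ln_realpow)
    also have "\<dots> \<le> ln (u n)" using le[of n] c g by (intro ln_mono) auto
    finally have "1 / real n * (ln c + real n * ln g) \<le> 1 / real n * ln (u n)"
      by (intro mult_left_mono) auto
    moreover have "1 / real n * (ln c + real n * ln g) = ln c / real n + ln g"
      using elim(2) by (simp add: field_simps)
    ultimately have "ln g / 2 \<le> 1 / real n * ln (u n)" using elim(1) by linarith
    then show ?case by (simp only: ereal_less_eq)
  qed
  then have "ereal (ln g / 2) \<le> liminf (\<lambda>n. ereal (1 / real n * ln (u n)))" by (rule Liminf_bounded)
  moreover have "(0 :: ereal) < ereal (ln g / 2)" using lg by simp
  ultimately show ?thesis by (rule less_le_trans[rotated])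
qed

theorem theorem10p2:
  fixes P :: params and Z v :: "real^2"
  assumes "tau_L P > 0" and "delta_L P > 0" and "delta_R P > 0"
    and "algorithm P = CHAOS"
    and "Z \<in> Omega_set P - Xi_inf P"
    and "v \<in> C_J P" and "v \<noteq> 0"
  shows "liminf (\<lambda>n. ereal (1 / real n *
           ln (norm (frechet_derivative (bcmap P ^^ n) (at Z) v)))) > 0"
proof -
  interpret chaotic P by unfold_locales (rule assms)+
  obtain c g where cg: "0 < c" "1 < g"
    and growth: "\<forall>Z\<in>Omega_set P - Xi_inf P. \<forall>v\<in>C_J P - {0}. \<forall>n.
      c * g ^ n * norm v \<le> norm (jacobian P Z n *v v)"
    using jacobian_growth by blast
  have growth: "c * g ^ n * norm v \<le> norm (jacobian P Z n *v v)" for n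
    using growth assms(5-7) by simp
  have "((bcmap P ^^ n) has_derivative (\<lambda>v. jacobian P Z n *v v)) (at Z)" for n
    by (rule jacobian_has_derivative) (rule orbit_regular[OF assms(5)])
  then have "frechet_derivative (bcmap P ^^ n) (at Z) v = jacobian P Z n *v v" for n
    using frechet_derivative_at by metis
  then have le: "(c * norm v) * g ^ n \<le> norm (frechet_derivative (bcmap P ^^ n) (at Z) v)" for n
    using growth[of n] by (simp add: mult_ac)
  have "0 < c * norm v" using cg assms(7) by simp
  then show ?thesis by (rule liminf_growth_rate_pos[OF _ cg(2) le])
qed

end
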